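(* Let $X$ be a local isometric immersion of $S^n$ in $S^{n+m}$ with flat and non-degenerate normal bundle, and $(x_1,\dots,x_n)$ a line of curvature coordinate system. Let $(A_1,F,b)$ be the solution of the partial $G_{m,n+1}$-system I corresponding to $X$ and a parallel normal frame $e_{n+1},\dots,e_{n+m}$, let $e_i=\frac1{b_i}X_{x_i}$ and $g=(e_{n+1},\dots,e_{n+m},e_1,\dots,e_n,X)$, let $E^I$ be the frame of $(A_1,F,b)$ such that $E^I(x,1)=g(x)$, and let $(\tilde A_1,\tilde F,\tilde b,\tilde E^I)=g_{s,\pi}\cdot(A_1,F,b,E^I)$ as in the context. Write $$\tilde E^I(x,1)=(\tilde e_{n+1}(x),\dots,\tilde e_{n+m}(x),\tilde e_1(x),\dots,\tilde e_n(x),\tilde X(x)).$$ Then: (i) $\tilde X$ is a local isometric immersion of $S^n$ in $S^{n+m}$ with flat and non-degenerate normal bundle, $x$ is a line of curvature coordinate system, and $\{\tilde e_\alpha\}_{\alpha=n+1}^{n+m}$ is a parallel normal frame. (ii) The solution of the partial $G_{m,n+1}$-system I corresponding to $\tilde X$ is $(\tilde A_1,\tilde F,\tilde b)$. (iii) The bundle morphism $P(e_\alpha(x))=\tilde e_\alpha(x)$ for $n+1\le\alpha\le n+m$ is a Ribaucour transformation that covers the map $X(x)\mapsto\tilde X(x)$.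
   Context: $\mathcal M_{p\times q}$: real $p\times q$ matrices; $gl_*(n)$: real $n\times n$ matrices with zero diagonal; $C_i$: the $n\times n$ matrix whose only non-zero entry is a $1$ at $(i,i)$. Flat means $d\theta+\theta\wedge\theta=0$. Reality condition for $E(x,\lambda)$ of size $m+n+1$: $\overline{E(x,\bar\lambda)}=E(x,\lambda)$, $I_{m,n+1}E(x,\lambda)I_{m,n+1}^{-1}=E(x,-\lambda)$, $EE^t=I$, with $I_{m,n+1}=\mathrm{diag}(I_m,-I_{n+1})$. Partial $G_{m,n+1}$-system: $(F,G,b)$ with values in $gl_*(n)\times\mathcal M_{(m-n)\times n}\times\mathcal M_{n\times1}$ is a solution if, in block sizes $(n,m-n,n,1)$, $$\Theta_\lambda=\sum_{i=1}^n\begin{pmatrix}-FC_i+C_iF^t&C_iG^t&-\lambda C_i&0\\-GC_i&0&0&0\\ \lambda C_i&0&-F^tC_i+C_iF&C_ib\\0&0&-b^tC_i&0\end{pmatrix}dx_i$$ is flat for all $\lambda\in\mathbb C$. Partial $G_{m,n+1}$-system I: $(A_1,F,b)$ with $A_1\in\mathcal M_{m\times n}$, $A_1^tA_1=I$, is a solution if $$\Theta^I_\lambda=\sum_{i=1}^n\begin{pmatrix}0&-A_1C_i\lambda&0\\ C_iA_1^t\lambda&-F^tC_i+C_iF&C_ib\\0&-b^tC_i&0\end{pmatrix}dx_i$$ is flat for all $\lambda\in\mathbb C$. A frame is a trivialization of the Lax connection ($E^{-1}dE=\Theta_\lambda$, resp. $(E^I)^{-1}dE^I=\Theta^I_\lambda$)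 satisfying the reality condition. The solution corresponding to $X$ and the frame $e_\alpha$ is $(A_1,F,b)$, where $I=\sum_ib_i^2dx_i^2$, $II=\sum_{i=1}^n\sum_{j=1}^ma_{ji}b_idx_i^2e_{n+j}$, $A_1=(a_{ij})$, $A_1^tA_1=I$, $b=(b_1,\dots,b_n)^t$, $F=(f_{ij})$, $f_{ij}=(b_i)_{x_j}/b_j$ for $i\ne j$, $f_{ii}=0$. The action: $0\ne s\in\mathbb R$, $W\in\mathbb R^m$, $Z\in\mathbb R^{n+1}$ are unit vectors, $\pi$ the Hermitian projection onto $\mathbb C\binom W{iZ}$, and $g_{s,\pi}(\lambda)=\left(\pi+\frac{\lambda-is}{\lambda+is}(I-\pi)\right)\left(\bar\pi+\frac{\lambda+is}{\lambda-is}(I-\bar\pi)\right)$. Choose $A=(A_1,A_2)$ with values in $O(m)$ and $G$ such that $(F,G,b)$ is a solution of the partial $G_{m,n+1}$-system with frame $E=E^I\begin{pmatrix}A&0\\0&I_{n+1}\end{pmatrix}$. Put $\binom{\tilde W}{i\tilde Z}(x)=E(x,-is)^{-1}\binom W{iZ}$, $\hat W=\tilde W/\|\tilde W\|$, $\hat Z=\tilde Z/\|\tilde Z\|$. Then $\tilde f_{ij}=f_{ij}-2s\hat w_i\hat z_j$ for $i\ne j$, $\tilde f_{ii}=0$, $\tilde b_i=b_i-2s\hat w_i\hat z_{n+1}$, $\tilde A_1$ consists of the first $n$ columns of $A(I-2\hat W\hat W^t)$, and $$\tilde E^I(x,\lambda)=E^I(x,\lambda)\left(I-\frac2{\lambda^2+s^2}\begin{pmatrix}\lambda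 A\hat W\\ s\hat Z\end{pmatrix}\begin{pmatrix}\lambda\hat W^tA^t&s\hat Z^t\end{pmatrix}\right).$$ Conventions: $I=\sum\omega_i^2$, $II=\sum\omega_{i\alpha}\omega_ie_\alpha$ with $\omega_i=\langle dX,e_i\rangle$, $\omega_{i\alpha}=\langle e_i,de_\alpha\rangle$, $e_\alpha$ normal in $S^{n+m}$. Non-degenerate normal bundle: the space of shape operators at each point has dimension $n$. Line of curvature coordinates: $I$ and $II$ are diagonal in $dx_1,\dots,dx_n$. Ribaucour transformation: for $n$-dimensional submanifolds $M,\tilde M$ of a space form, let $\gamma_{x,v}(t)=\exp_x(tv)$. A sphere congruence is a vector bundle isomorphism $P:\nu(M)\to\nu(\tilde M)$ of normal bundles covering a diffeomorphism $\ell:M\to\tilde M$ such that (a) if $\zeta$ is a parallel normal field of $M$, then $P\circ\zeta\circ\ell^{-1}$ is a parallel normal field of $\tilde M$; (b) for any non-zero $\zeta\in\nu_x(M)$, the geodesics $\gamma_{x,\zeta}$ and $\gamma_{\ell(x),P(\zeta)}$ intersect at a point equidistant from $x$ and $\ell(x)$ (the distance depends on $x$). It is a Ribaucour transformation if in addition (c) if $e$ is an eigenvector of the shape operator $A_\zeta$ of $M$, then $\ell_*(e)$ is an eigenvector of the shape operator $A_{P(\zeta)}$ of $\tilde M$; (d) the geodesics $\gamma_{x,e}$ and $\gamma_{\ell(x),\ell_*(e)}$ intersect at a point equidistant from $x$ and $\ell(x)$.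
   Formalization: The conclusions are stated on the open set where all b̃_i are non-zero (where X̃ is an immersion; b̃_i can vanish elsewhere), and in (c), (d) of a Ribaucour transformation e is a principal direction, i.e. an eigenvector of A_ζ for every normal ζ at the point; for a single ζ the claim is false. *)

theory Defs
  imports "HOL-Analysis.Analysis"
begin

section \<open>Smooth maps on open subsets of \<open>real ^ 'n\<close>\<close>

definition pdv :: "(real ^ 'n \<Rightarrow> 'b::real_normed_vector) \<Rightarrow> 'n::finite \<Rightarrow> real ^ 'n \<Rightarrow> 'b" where
  "pdv f i x = frechet_derivative f (at x) (axis i 1)"

primrec C_k_on ::
    "nat \<Rightarrow> (real ^ 'n::finite) set \<Rightarrow> (real ^ 'n \<Rightarrow> 'b::real_normed_vector) \<Rightarrow> bool" where
  "C_k_on 0 U f \<longleftrightarrow> continuous_on U f"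
| "C_k_on (Suc k) U f \<longleftrightarrow> (\<forall>x\<in>U. f differentiable (at x)) \<and> (\<forall>i. C_k_on k U (pdv f i))"

definition smooth_on :: "(real ^ 'n::finite) set \<Rightarrow> (real ^ 'n \<Rightarrow> 'b::real_normed_vector) \<Rightarrow> bool" where
  "smooth_on U f \<longleftrightarrow> (\<forall>k. C_k_on k U f)"


section \<open>Immersed submanifolds of the unit sphere\<close>

text \<open>
  A submanifold of the unit sphere of a Euclidean space is given by an immersion \<open>X\<close> of an open
  set \<open>U\<close> of coordinates \<open>x\<close>; tangent vectors are represented by their coordinate vectors in
  \<open>real ^ 'n\<close>, and objects attached to the point \<open>X x\<close> are indexed by \<open>x\<close>.
\<close>

definition sphere_immersion ::
    "(real ^ 'n::finite) set \<Rightarrow> (real ^ 'n \<Rightarrow> 'a::euclidean_space) \<Rightarrow> bool" where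
  "sphere_immersion U X \<longleftrightarrow> open U \<and> smooth_on U X \<and>
     (\<forall>x\<in>U. norm (X x) = 1 \<and> inj (frechet_derivative X (at x)))"

definition first_ff :: "(real ^ 'n::finite \<Rightarrow> 'a::euclidean_space) \<Rightarrow> real ^ 'n \<Rightarrow> real ^ 'n ^ 'n" where
  "first_ff X x = (\<chi> i k. pdv X i x \<bullet> pdv X k x)"

text \<open>
  The normal space in the tangent space of the sphere, hence also orthogonal to the position
  vector.
\<close>
definition normal_fibre :: "(real ^ 'n::finite \<Rightarrow> 'a::euclidean_space) \<Rightarrow> real ^ 'n \<Rightarrow> 'a set" where
  "normal_fibre X x = {v. v \<bullet> X x = 0 \<and> (\<forall>i. v \<bullet> pdv X i x = 0)}"

definition normal_part :: "(real ^ 'n::finite \<Rightarrow> 'a::euclidean_space) \<Rightarrow> real ^ 'n \<Rightarrow> 'a \<Rightarrow> 'a" where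
  "normal_part X x v =
     (THE w. w \<in> normal_fibre X x \<and> (\<forall>u \<in> normal_fibre X x. (v - w) \<bullet> u = 0))"

text \<open>
  The second fundamental form with the sign convention \<open>II = \<Sum> \<omega>\<^sub>i\<^sub>\<alpha> \<omega>\<^sub>i e\<^sub>\<alpha>\<close>,
  \<open>\<omega>\<^sub>i\<^sub>\<alpha> = \<langle>e\<^sub>i, d e\<^sub>\<alpha>\<rangle>\<close>: its component along a normal field \<open>\<zeta>\<close> is
  \<open>\<langle>dX, d\<zeta>\<rangle>\<close>, which is the negative of \<open>\<langle>d\<^sup>2X, \<zeta>\<rangle>\<close>
  (see \<open>second_ff_inner_normal_field\<close> below).
\<close>
definition second_ff ::
    "(real ^ 'n::finite \<Rightarrow> 'a::euclidean_space) \<Rightarrow> real ^ 'n \<Rightarrow> 'n \<Rightarrow> 'n \<Rightarrow> 'a" where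
  "second_ff X x i k = - normal_part X x (pdv (pdv X i) k x)"

text \<open>The matrix of the shape operator in the coordinate basis of the tangent space.\<close>
definition shape_op ::
    "(real ^ 'n::finite \<Rightarrow> 'a::euclidean_space) \<Rightarrow> real ^ 'n \<Rightarrow> 'a \<Rightarrow> real ^ 'n ^ 'n" where
  "shape_op X x v = matrix_inv (first_ff X x) ** (\<chi> i k. second_ff X x i k \<bullet> v)"

definition normal_field ::
    "(real ^ 'n::finite) set \<Rightarrow> (real ^ 'n \<Rightarrow> 'a::euclidean_space) \<Rightarrow> (real ^ 'n \<Rightarrow> 'a) \<Rightarrow> bool" where
  "normal_field U X \<zeta> \<longleftrightarrow> smooth_on U \<zeta> \<and> (\<forall>x\<in>U. \<zeta> x \<in> normal_fibre X x)"

definition normal_conn ::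
    "(real ^ 'n::finite \<Rightarrow> 'a::euclidean_space) \<Rightarrow> 'n \<Rightarrow> (real ^ 'n \<Rightarrow> 'a) \<Rightarrow> real ^ 'n \<Rightarrow> 'a" where
  "normal_conn X i \<zeta> x = normal_part X x (pdv \<zeta> i x)"

definition parallel_normal_field ::
    "(real ^ 'n::finite) set \<Rightarrow> (real ^ 'n \<Rightarrow> 'a::euclidean_space) \<Rightarrow> (real ^ 'n \<Rightarrow> 'a) \<Rightarrow> bool" where
  "parallel_normal_field U X \<zeta> \<longleftrightarrow>
     normal_field U X \<zeta> \<and> (\<forall>x\<in>U. \<forall>i. normal_conn X i \<zeta> x = 0)"

definition parallel_normal_frame ::
    "(real ^ 'n::finite) set \<Rightarrow> (real ^ 'n \<Rightarrow> 'a::euclidean_space) \<Rightarrow>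
     ('m::finite \<Rightarrow> real ^ 'n \<Rightarrow> 'a) \<Rightarrow> bool" where
  "parallel_normal_frame U X e \<longleftrightarrow>
     (\<forall>j. parallel_normal_field U X (e j)) \<and>
     (\<forall>x\<in>U. (\<forall>j k. e j x \<bullet> e k x = (if j = k then 1 else 0)) \<and>
            span (range (\<lambda>j. e j x)) = normal_fibre X x)"

definition flat_normal_bundle ::
    "(real ^ 'n::finite) set \<Rightarrow> (real ^ 'n \<Rightarrow> 'a::euclidean_space) \<Rightarrow> bool" where
  "flat_normal_bundle U X \<longleftrightarrow>
     (\<forall>\<zeta>. normal_field U X \<zeta> \<longrightarrow> (\<forall>x\<in>U. \<forall>i k.
        normal_conn X i (normal_conn X k \<zeta>) x = normal_conn X k (normal_conn X i \<zeta>) x))"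

definition nondegenerate_normal_bundle ::
    "(real ^ 'n::finite) set \<Rightarrow> (real ^ 'n \<Rightarrow> 'a::euclidean_space) \<Rightarrow> bool" where
  "nondegenerate_normal_bundle U X \<longleftrightarrow>
     (\<forall>x\<in>U. dim (shape_op X x ` normal_fibre X x) = CARD('n))"

definition line_of_curvature_coordinates ::
    "(real ^ 'n::finite) set \<Rightarrow> (real ^ 'n \<Rightarrow> 'a::euclidean_space) \<Rightarrow> bool" where
  "line_of_curvature_coordinates U X \<longleftrightarrow>
     (\<forall>x\<in>U. \<forall>i k. i \<noteq> k \<longrightarrow> first_ff X x $ i $ k = 0 \<and> second_ff X x i k = 0)"

text \<open>
  The unit sphere of \<open>real ^ 'n option\<close> is the sphere whose dimension is the cardinality of
  \<open>'n\<close>. The coordinate domain, with the induced metric, has to be locally isometric to it.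
\<close>
definition local_isometric_immersion_of_sphere ::
    "(real ^ 'n::finite) set \<Rightarrow> (real ^ 'n \<Rightarrow> 'a::euclidean_space) \<Rightarrow> bool" where
  "local_isometric_immersion_of_sphere U X \<longleftrightarrow> sphere_immersion U X \<and>
     (\<forall>x\<in>U. \<exists>V \<phi>. open V \<and> x \<in> V \<and> V \<subseteq> U \<and>
        smooth_on V (\<phi> :: real ^ 'n \<Rightarrow> real ^ 'n option) \<and>
        (\<forall>y\<in>V. norm (\<phi> y) = 1 \<and> first_ff \<phi> y = first_ff X y))"


section \<open>Ribaucour transformations in the unit sphere\<close>

text \<open>\<open>exp\<^sub>p(tv)\<close> in the unit sphere.\<close>
definition sphere_geodesic :: "'a::euclidean_space \<Rightarrow> 'a \<Rightarrow> real \<Rightarrow> 'a" where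
  "sphere_geodesic p v t = cos (t * norm v) *\<^sub>R p + (sin (t * norm v) / norm v) *\<^sub>R v"

definition sphere_dist :: "'a::euclidean_space \<Rightarrow> 'a \<Rightarrow> real" where
  "sphere_dist p q = arccos (p \<bullet> q)"

definition meet_equidistantly :: "'a::euclidean_space \<Rightarrow> 'a \<Rightarrow> 'a \<Rightarrow> 'a \<Rightarrow> bool" where
  "meet_equidistantly p v q w \<longleftrightarrow>
     (\<exists>c \<in> range (sphere_geodesic p v) \<inter> range (sphere_geodesic q w).
        sphere_dist c p = sphere_dist c q)"

definition linear_on_subspace :: "'a::real_vector set \<Rightarrow> ('a \<Rightarrow> 'b::real_vector) \<Rightarrow> bool" where
  "linear_on_subspace S f \<longleftrightarrow>
     (\<forall>u\<in>S. \<forall>v\<in>S. f (u + v) = f u + f v) \<and> (\<forall>c. \<forall>v\<in>S. f (c *\<^sub>R v) = c *\<^sub>R f v)"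

definition diffeomorphism_on ::
    "(real ^ 'n::finite) set \<Rightarrow> (real ^ 'n) set \<Rightarrow> (real ^ 'n \<Rightarrow> real ^ 'n) \<Rightarrow> bool" where
  "diffeomorphism_on U V l \<longleftrightarrow>
     bij_betw l U V \<and> smooth_on U l \<and> smooth_on V (inv_into U l)"

text \<open>The section \<open>P \<circ> \<zeta> \<circ> l\<^sup>-\<^sup>1\<close> over \<open>V = l ` U\<close>, for \<open>P\<close> with fibre maps \<open>P x\<close>.\<close>
definition push_section ::
    "(real ^ 'n::finite) set \<Rightarrow> (real ^ 'n \<Rightarrow> real ^ 'n) \<Rightarrow> (real ^ 'n \<Rightarrow> 'a \<Rightarrow> 'a) \<Rightarrow>
     (real ^ 'n \<Rightarrow> 'a) \<Rightarrow> real ^ 'n \<Rightarrow> 'a" where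
  "push_section U l P \<zeta> y = P (inv_into U l y) (\<zeta> (inv_into U l y))"

definition normal_bundle_isomorphism ::
    "(real ^ 'n::finite) set \<Rightarrow> (real ^ 'n \<Rightarrow> 'a::euclidean_space) \<Rightarrow>
     (real ^ 'n) set \<Rightarrow> (real ^ 'n \<Rightarrow> 'a) \<Rightarrow>
     (real ^ 'n \<Rightarrow> real ^ 'n) \<Rightarrow> (real ^ 'n \<Rightarrow> 'a \<Rightarrow> 'a) \<Rightarrow> bool" where
  "normal_bundle_isomorphism U X V Y l P \<longleftrightarrow>
     diffeomorphism_on U V l \<and>
     (\<forall>x\<in>U. linear_on_subspace (normal_fibre X x) (P x) \<and>
            bij_betw (P x) (normal_fibre X x) (normal_fibre Y (l x))) \<and>
     (\<forall>\<zeta>. normal_field U X \<zeta> \<longrightarrow> normal_field V Y (push_section U l P \<zeta>))"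

definition sphere_congruence ::
    "(real ^ 'n::finite) set \<Rightarrow> (real ^ 'n \<Rightarrow> 'a::euclidean_space) \<Rightarrow>
     (real ^ 'n) set \<Rightarrow> (real ^ 'n \<Rightarrow> 'a) \<Rightarrow>
     (real ^ 'n \<Rightarrow> real ^ 'n) \<Rightarrow> (real ^ 'n \<Rightarrow> 'a \<Rightarrow> 'a) \<Rightarrow> bool" where
  "sphere_congruence U X V Y l P \<longleftrightarrow>
     sphere_immersion U X \<and> sphere_immersion V Y \<and>
     normal_bundle_isomorphism U X V Y l P \<and>
     (\<forall>\<zeta>. parallel_normal_field U X \<zeta> \<longrightarrow> parallel_normal_field V Y (push_section U l P \<zeta>)) \<and>
     (\<forall>x\<in>U. \<forall>v \<in> normal_fibre X x. v \<noteq> 0 \<longrightarrow> meet_equidistantly (X x) v (Y (l x)) (P x v))"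

definition eigenvector :: "real ^ 'n ^ 'n \<Rightarrow> real ^ 'n \<Rightarrow> bool" where
  "eigenvector S a \<longleftrightarrow> a \<noteq> 0 \<and> (\<exists>\<mu>. S *v a = \<mu> *\<^sub>R a)"

text \<open>
  The eigenvectors in the last two clauses are the principal directions: vectors that are
  eigenvectors of \<open>A\<^sub>v\<close> for every normal vector \<open>v\<close>. If \<open>a\<close> were only an eigenvector
  of \<open>A\<^sub>v\<close> for a single \<open>v\<close>, every tangent vector would qualify at umbilic \<open>v\<close> (for
  instance \<open>v = 0\<close>).
\<close>
definition ribaucour_transformation ::
    "(real ^ 'n::finite) set \<Rightarrow> (real ^ 'n \<Rightarrow> 'a::euclidean_space) \<Rightarrow>
     (real ^ 'n) set \<Rightarrow> (real ^ 'n \<Rightarrow> 'a) \<Rightarrow>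
     (real ^ 'n \<Rightarrow> real ^ 'n) \<Rightarrow> (real ^ 'n \<Rightarrow> 'a \<Rightarrow> 'a) \<Rightarrow> bool" where
  "ribaucour_transformation U X V Y l P \<longleftrightarrow>
     sphere_congruence U X V Y l P \<and>
     (\<forall>x\<in>U. \<forall>a. (\<forall>v \<in> normal_fibre X x. eigenvector (shape_op X x v) a) \<longrightarrow>
        (\<forall>v \<in> normal_fibre X x.
           eigenvector (shape_op Y (l x) (P x v)) (frechet_derivative l (at x) a)) \<and>
        meet_equidistantly
          (X x) (frechet_derivative X (at x) a)
          (Y (l x)) (frechet_derivative Y (at (l x)) (frechet_derivative l (at x) a)))"


section \<open>The partial \<open>G\<^sub>m\<^sub>,\<^sub>n\<^sub>+\<^sub>1\<close>-systems\<close>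

text \<open>
  The index types \<open>'n\<close> and \<open>'m\<close> have \<open>n\<close> and \<open>m\<close> elements. Indices of size \<open>n + 1\<close> are
  \<open>'n option\<close>, with \<open>None\<close> last, and indices of size \<open>m + n + 1\<close> are \<open>'m + 'n option\<close>.
  The first \<open>n\<close> of the \<open>m\<close> indices are singled out by an injection \<open>\<iota> :: 'n \<Rightarrow> 'm\<close>
  (\<open>m = n\<close> is allowed); accordingly an \<open>(m - n) \<times> n\<close> matrix is a \<open>real ^ 'n ^ 'm\<close> whose
  rows in \<open>range \<iota>\<close> are unused.
\<close>

text \<open>The position of an index in the block sizes \<open>(n, m - n, n, 1)\<close>.\<close>
datatype ('n, 'm) block_index = B1 'n | B2 'm | B3 'n | B4

definition block_of :: "('n \<Rightarrow> 'm) \<Rightarrow> 'm + 'n option \<Rightarrow> ('n, 'm) block_index" where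
  "block_of \<iota> r = (case r of
      Inl p \<Rightarrow> if p \<in> range \<iota> then B1 (inv \<iota> p) else B2 p
    | Inr (Some k) \<Rightarrow> B3 k
    | Inr None \<Rightarrow> B4)"

definition elem_diag :: "'n::finite \<Rightarrow> real ^ 'n ^ 'n" where
  "elem_diag i = (\<chi> k l. if k = i \<and> l = i then 1 else 0)"

definition lax_G ::
    "('n::finite \<Rightarrow> 'm::finite) \<Rightarrow> real ^ 'n ^ 'n \<Rightarrow> real ^ 'n ^ 'm \<Rightarrow> real ^ 'n \<Rightarrow>
     complex \<Rightarrow> 'n \<Rightarrow> complex ^ ('m + 'n option) ^ ('m + 'n option)" where
  "lax_G \<iota> F G b lam i = (let C = elem_diag i in \<chi> r c.
     case (block_of \<iota> r, block_of \<iota> c) of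
       (B1 p, B1 q) \<Rightarrow> of_real ((- (F ** C) + C ** transpose F) $ p $ q)
     | (B1 p, B2 q) \<Rightarrow> of_real ((C ** transpose G) $ p $ q)
     | (B1 p, B3 q) \<Rightarrow> - lam * of_real (C $ p $ q)
     | (B2 p, B1 q) \<Rightarrow> of_real (- (G ** C) $ p $ q)
     | (B3 p, B1 q) \<Rightarrow> lam * of_real (C $ p $ q)
     | (B3 p, B3 q) \<Rightarrow> of_real ((- (transpose F ** C) + C ** F) $ p $ q)
     | (B3 p, B4) \<Rightarrow> of_real ((C *v b) $ p)
     | (B4, B3 q) \<Rightarrow> of_real (- (b v* C) $ q)
     | _ \<Rightarrow> 0)"

definition lax_G_I ::
    "real ^ 'n ^ 'm \<Rightarrow> real ^ 'n ^ 'n \<Rightarrow> real ^ 'n \<Rightarrow>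
     complex \<Rightarrow> 'n::finite \<Rightarrow> complex ^ ('m::finite + 'n option) ^ ('m + 'n option)" where
  "lax_G_I A1 F b lam i = (let C = elem_diag i in \<chi> r c.
     case (r, c) of
       (Inl p, Inr (Some q)) \<Rightarrow> - of_real ((A1 ** C) $ p $ q) * lam
     | (Inr (Some p), Inl q) \<Rightarrow> of_real ((C ** transpose A1) $ p $ q) * lam
     | (Inr (Some p), Inr (Some q)) \<Rightarrow> of_real ((- (transpose F ** C) + C ** F) $ p $ q)
     | (Inr (Some p), Inr None) \<Rightarrow> of_real ((C *v b) $ p)
     | (Inr None, Inr (Some q)) \<Rightarrow> of_real (- (b v* C) $ q)
     | _ \<Rightarrow> 0)"

text \<open>\<open>d\<theta> + \<theta> \<and> \<theta> = 0\<close> for \<open>\<theta> = \<Sum> \<theta>\<^sub>i dx\<^sub>i\<close>; here \<open>\<theta> x i\<close> is the coefficient of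
  \<open>dx\<^sub>i\<close> at \<open>x\<close>.\<close>
definition flat_connection ::
    "(real ^ 'n::finite) set \<Rightarrow> (real ^ 'n \<Rightarrow> 'n \<Rightarrow> complex ^ 'N ^ 'N::finite) \<Rightarrow> bool" where
  "flat_connection U \<theta> \<longleftrightarrow> (\<forall>x\<in>U. \<forall>i k.
     pdv (\<lambda>y. \<theta> y k) i x - pdv (\<lambda>y. \<theta> y i) k x + (\<theta> x i ** \<theta> x k - \<theta> x k ** \<theta> x i) = 0)"

definition partial_G_solution ::
    "(real ^ 'n::finite) set \<Rightarrow> ('n \<Rightarrow> 'm::finite) \<Rightarrow> (real ^ 'n \<Rightarrow> real ^ 'n ^ 'n) \<Rightarrow>
     (real ^ 'n \<Rightarrow> real ^ 'n ^ 'm) \<Rightarrow> (real ^ 'n \<Rightarrow> real ^ 'n) \<Rightarrow> bool" where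
  "partial_G_solution U \<iota> F G b \<longleftrightarrow>
     smooth_on U F \<and> smooth_on U G \<and> smooth_on U b \<and>
     (\<forall>x\<in>U. \<forall>i. F x $ i $ i = 0) \<and>
     (\<forall>lam. flat_connection U (\<lambda>x. lax_G \<iota> (F x) (G x) (b x) lam))"

definition partial_G_I_solution ::
    "(real ^ 'n::finite) set \<Rightarrow> (real ^ 'n \<Rightarrow> real ^ 'n ^ 'm::finite) \<Rightarrow>
     (real ^ 'n \<Rightarrow> real ^ 'n ^ 'n) \<Rightarrow> (real ^ 'n \<Rightarrow> real ^ 'n) \<Rightarrow> bool" where
  "partial_G_I_solution U A1 F b \<longleftrightarrow>
     smooth_on U A1 \<and> smooth_on U F \<and> smooth_on U b \<and>
     (\<forall>x\<in>U. transpose (A1 x) ** A1 x = mat 1 \<and> (\<forall>i. F x $ i $ i = 0)) \<and>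
     (\<forall>lam. flat_connection U (\<lambda>x. lax_G_I (A1 x) (F x) (b x) lam))"

definition corresponding_solution ::
    "(real ^ 'n::finite) set \<Rightarrow> (real ^ 'n \<Rightarrow> 'a::euclidean_space) \<Rightarrow>
     ('m::finite \<Rightarrow> real ^ 'n \<Rightarrow> 'a) \<Rightarrow>
     (real ^ 'n \<Rightarrow> real ^ 'n ^ 'm) \<Rightarrow> (real ^ 'n \<Rightarrow> real ^ 'n ^ 'n) \<Rightarrow> (real ^ 'n \<Rightarrow> real ^ 'n) \<Rightarrow> bool" where
  "corresponding_solution U X e A1 F b \<longleftrightarrow>
     partial_G_I_solution U A1 F b \<and>
     (\<forall>x\<in>U. \<forall>i k.
        first_ff X x $ i $ k = (if i = k then (b x $ i)\<^sup>2 else 0) \<and>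
        second_ff X x i k =
          (if i = k then \<Sum>j\<in>UNIV. (A1 x $ j $ i * b x $ i) *\<^sub>R e j x else 0) \<and>
        F x $ i $ k = (if i = k then 0 else pdv (\<lambda>y. b y $ i) k x / b x $ k))"


section \<open>Frames\<close>

abbreviation cmat :: "real ^ 'p ^ 'q \<Rightarrow> complex ^ 'p ^ 'q" where
  "cmat \<equiv> map_matrix complex_of_real"

definition sign_mat :: "complex ^ ('m::finite + 'k::finite) ^ ('m + 'k)" where
  "sign_mat = (\<chi> r c. if r = c then (case r of Inl _ \<Rightarrow> 1 | Inr _ \<Rightarrow> -1) else 0)"

definition reality_condition ::
    "(real ^ 'n::finite) set \<Rightarrow>
     (real ^ 'n \<Rightarrow> complex \<Rightarrow> complex ^ ('m::finite + 'n option) ^ ('m + 'n option)) \<Rightarrow> bool" where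
  "reality_condition U E \<longleftrightarrow> (\<forall>x\<in>U. \<forall>lam.
     map_matrix cnj (E x (cnj lam)) = E x lam \<and>
     sign_mat ** E x lam ** matrix_inv sign_mat = E x (- lam) \<and>
     E x lam ** transpose (E x lam) = mat 1)"

definition lax_frame ::
    "(real ^ 'n::finite) set \<Rightarrow>
     (complex \<Rightarrow> real ^ 'n \<Rightarrow> 'n \<Rightarrow> complex ^ ('m::finite + 'n option) ^ ('m + 'n option)) \<Rightarrow>
     (real ^ 'n \<Rightarrow> complex \<Rightarrow> complex ^ ('m + 'n option) ^ ('m + 'n option)) \<Rightarrow> bool" where
  "lax_frame U \<Theta> E \<longleftrightarrow>
     (\<forall>lam. smooth_on U (\<lambda>x. E x lam) \<and>
        (\<forall>x\<in>U. invertible (E x lam) \<and>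
           (\<forall>i. matrix_inv (E x lam) ** pdv (\<lambda>y. E y lam) i x = \<Theta> lam x i))) \<and>
     reality_condition U E"

definition frame_G ::
    "(real ^ 'n::finite) set \<Rightarrow> ('n \<Rightarrow> 'm::finite) \<Rightarrow> (real ^ 'n \<Rightarrow> real ^ 'n ^ 'n) \<Rightarrow>
     (real ^ 'n \<Rightarrow> real ^ 'n ^ 'm) \<Rightarrow> (real ^ 'n \<Rightarrow> real ^ 'n) \<Rightarrow>
     (real ^ 'n \<Rightarrow> complex \<Rightarrow> complex ^ ('m + 'n option) ^ ('m + 'n option)) \<Rightarrow> bool" where
  "frame_G U \<iota> F G b E \<longleftrightarrow> lax_frame U (\<lambda>lam x. lax_G \<iota> (F x) (G x) (b x) lam) E"

definition frame_G_I ::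
    "(real ^ 'n::finite) set \<Rightarrow> (real ^ 'n \<Rightarrow> real ^ 'n ^ 'm::finite) \<Rightarrow>
     (real ^ 'n \<Rightarrow> real ^ 'n ^ 'n) \<Rightarrow> (real ^ 'n \<Rightarrow> real ^ 'n) \<Rightarrow>
     (real ^ 'n \<Rightarrow> complex \<Rightarrow> complex ^ ('m + 'n option) ^ ('m + 'n option)) \<Rightarrow> bool" where
  "frame_G_I U A1 F b E \<longleftrightarrow> lax_frame U (\<lambda>lam x. lax_G_I (A1 x) (F x) (b x) lam) E"

text \<open>The matrix with columns \<open>e\<^sub>n\<^sub>+\<^sub>1, \<dots>, e\<^sub>n\<^sub>+\<^sub>m, e\<^sub>1, \<dots>, e\<^sub>n, X\<close>.\<close>
definition column_matrix ::
    "('m::finite \<Rightarrow> real ^ ('m + 'n option)) \<Rightarrow> ('n::finite \<Rightarrow> real ^ ('m + 'n option)) \<Rightarrow>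
     real ^ ('m + 'n option) \<Rightarrow> real ^ ('m + 'n option) ^ ('m + 'n option)" where
  "column_matrix e t X = (\<chi> r c. (case c of
      Inl j \<Rightarrow> e j | Inr (Some i) \<Rightarrow> t i | Inr None \<Rightarrow> X) $ r)"


section \<open>The action of \<open>g\<^sub>s\<^sub>,\<^sub>\<pi>\<close>\<close>

definition diag_block :: "real ^ 'm ^ 'm \<Rightarrow> real ^ ('m::finite + 'k::finite) ^ ('m + 'k)" where
  "diag_block A = (\<chi> r c. case (r, c) of
      (Inl p, Inl q) \<Rightarrow> A $ p $ q
    | (Inr p, Inr q) \<Rightarrow> (if p = q then 1 else 0)
    | _ \<Rightarrow> 0)"

definition join_vec :: "'c ^ 'm::finite \<Rightarrow> 'c ^ 'k::finite \<Rightarrow> 'c ^ ('m + 'k)" where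
  "join_vec u v = (\<chi> r. case r of Inl p \<Rightarrow> u $ p | Inr q \<Rightarrow> v $ q)"

definition cvec :: "real ^ 'p \<Rightarrow> complex ^ 'p" where
  "cvec v = (\<chi> p. complex_of_real (v $ p))"

definition outer :: "'c::times ^ 'p \<Rightarrow> 'c ^ 'q \<Rightarrow> 'c ^ 'q ^ 'p" where
  "outer u v = (\<chi> r c. u $ r * v $ c)"

text \<open>
  The relation \<open>(A1', F', b', EI') = g\<^sub>s\<^sub>,\<^sub>\<pi> \<cdot> (A1, F, b, EI)\<close>, where \<open>\<pi>\<close> is the projection onto
  the line spanned by \<open>(W, iZ)\<close>. It depends on the choice of \<open>A = (A1, A2)\<close> and \<open>G\<close>.
  The excluded values \<open>lam = \<plusminus> \<i> s\<close> are the poles of \<open>EI'\<close>.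
\<close>
definition simple_element_action ::
    "(real ^ 'n::finite) set \<Rightarrow> ('n \<Rightarrow> 'm::finite) \<Rightarrow> real \<Rightarrow> real ^ 'm \<Rightarrow> real ^ 'n option \<Rightarrow>
     (real ^ 'n \<Rightarrow> real ^ 'n ^ 'm) \<Rightarrow> (real ^ 'n \<Rightarrow> real ^ 'n ^ 'n) \<Rightarrow> (real ^ 'n \<Rightarrow> real ^ 'n) \<Rightarrow>
     (real ^ 'n \<Rightarrow> complex \<Rightarrow> complex ^ ('m + 'n option) ^ ('m + 'n option)) \<Rightarrow>
     (real ^ 'n \<Rightarrow> real ^ 'n ^ 'm) \<Rightarrow> (real ^ 'n \<Rightarrow> real ^ 'n ^ 'n) \<Rightarrow> (real ^ 'n \<Rightarrow> real ^ 'n) \<Rightarrow>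
     (real ^ 'n \<Rightarrow> complex \<Rightarrow> complex ^ ('m + 'n option) ^ ('m + 'n option)) \<Rightarrow> bool" where
  "simple_element_action U \<iota> s W Z A1 F b EI A1' F' b' EI' \<longleftrightarrow>
     (\<exists>A G E Wt Zt Wh Zh.
        partial_G_solution U \<iota> F G b \<and>
        frame_G U \<iota> F G b E \<and>
        (\<forall>x\<in>U.
           orthogonal_matrix (A x) \<and>
           (\<forall>i. column (\<iota> i) (A x) = column i (A1 x)) \<and>
           (\<forall>lam. E x lam = EI x lam ** cmat (diag_block (A x))) \<and>
           join_vec (cvec (Wt x)) (\<i> *s cvec (Zt x)) =
             matrix_inv (E x (- \<i> * of_real s)) *v join_vec (cvec W) (\<i> *s cvec Z) \<and>
           Wh x = Wt x /\<^sub>R norm (Wt x) \<and>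
           Zh x = Zt x /\<^sub>R norm (Zt x) \<and>
           (\<forall>i k. F' x $ i $ k =
              (if i = k then 0 else F x $ i $ k - 2 * s * Wh x $ \<iota> i * Zh x $ Some k)) \<and>
           (\<forall>i. b' x $ i = b x $ i - 2 * s * Wh x $ \<iota> i * Zh x $ None) \<and>
           (\<forall>i. column i (A1' x) =
              column (\<iota> i) (A x ** (mat 1 - 2 *\<^sub>R outer (Wh x) (Wh x)))) \<and>
           (\<forall>lam. lam\<^sup>2 + (of_real s)\<^sup>2 \<noteq> 0 \<longrightarrow>
              (let N = join_vec (lam *s cvec (A x *v Wh x)) (of_real s *s cvec (Zh x)) in
               EI' x lam =
                 EI x lam ** (mat 1 - map_matrix (\<lambda>z. 2 / (lam\<^sup>2 + (of_real s)\<^sup>2) * z) (outer N N))))))"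


section \<open>The sign convention for the second fundamental form\<close>

lemma subspace_normal_fibre: "subspace (normal_fibre X x)"
  by (auto simp: subspace_def normal_fibre_def inner_add_left)

lemma normal_part_inner:
  assumes "u \<in> normal_fibre X x"
  shows "normal_part X x v \<bullet> u = v \<bullet> u"
proof -
  let ?N = "normal_fibre X x"
  have sp: "span ?N = ?N" using subspace_normal_fibre by (simp add: span_eq_iff)
  obtain y z where y: "y \<in> span ?N" and z: "\<And>w. w \<in> span ?N \<Longrightarrow> orthogonal z w" and v: "v = y + z"
    using orthogonal_subspace_decomp_exists[of ?N v] by blast
  have "\<exists>!w. w \<in> ?N \<and> (\<forall>u\<in>?N. (v - w) \<bullet> u = 0)"
  proof (rule ex1I[of _ y])
    show "y \<in> ?N \<and> (\<forall>u\<in>?N. (v - y) \<bullet> u = 0)"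
      using y z v sp by (auto simp: orthogonal_def)
  next
    fix w assume w: "w \<in> ?N \<and> (\<forall>u\<in>?N. (v - w) \<bullet> u = 0)"
    have d: "w - y \<in> ?N" using w y sp subspace_normal_fibre[of X x] by (auto intro: subspace_diff)
    have "(v - w) \<bullet> (w - y) = 0" "(v - y) \<bullet> (w - y) = 0"
      using w d z v sp by (auto simp: orthogonal_def)
    then have "(w - y) \<bullet> (w - y) = 0" by (simp add: inner_diff_left)
    then show "w = y" by simp
  qed
  from theI'[OF this] have "(v - normal_part X x v) \<bullet> u = 0"
    using assms by (simp add: normal_part_def)
  then show ?thesis by (simp add: inner_diff_left)
qed

lemma second_ff_inner_normal_field:
  assumes "sphere_immersion U X" "normal_field U X \<zeta>" "x \<in> U"
  shows "second_ff X x i k \<bullet> \<zeta> x = pdv X i x \<bullet> pdv \<zeta> k x"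
proof -
  have U: "open U" and sX: "smooth_on U X" and sz: "smooth_on U \<zeta>"
    and nz: "\<And>y. y \<in> U \<Longrightarrow> \<zeta> y \<in> normal_fibre X y"
    using assms by (auto simp: sphere_immersion_def normal_field_def)
  have "C_k_on (Suc (Suc 0)) U X" "C_k_on (Suc 0) U \<zeta>"
    using sX sz unfolding smooth_on_def by blast+
  then have dX: "pdv X i differentiable (at x)" and dz: "\<zeta> differentiable (at x)"
    using assms(3) by auto
  let ?f = "\<lambda>y. pdv X i y \<bullet> \<zeta> y"
  have 1: "(?f has_derivative (\<lambda>h. pdv X i x \<bullet> frechet_derivative \<zeta> (at x) h +
        frechet_derivative (pdv X i) (at x) h \<bullet> \<zeta> x)) (at x)"
    using dX dz unfolding frechet_derivative_works by (rule has_derivative_inner)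
  have 2: "(?f has_derivative (\<lambda>h. 0)) (at x)"
  proof (rule has_derivative_transform_within_open[OF _ U assms(3)])
    show "((\<lambda>_. 0) has_derivative (\<lambda>h. 0)) (at x)" by simp
    show "\<And>y. y \<in> U \<Longrightarrow> 0 = ?f y" using nz by (auto simp: normal_fibre_def inner_commute)
  qed
  have "pdv X i x \<bullet> pdv \<zeta> k x + pdv (pdv X i) k x \<bullet> \<zeta> x = 0"
    using has_derivative_unique[OF 1 2] unfolding pdv_def by metis
  then show ?thesis
    using normal_part_inner[OF nz[OF assms(3)]] by (simp add: second_ff_def)
qed

end

theory Submission
  imports Defs
begin

text \<open>
  The coefficients of the Lax connection of system I are wedge products \<open>\<epsilon>\<^sub>i \<and> w\<close> of a fixed unit vector
  with \<open>w = (lam a\<^sub>i, f\<^sub>i, b\<^sub>i)\<close>. The section \<open>(Y, \<i>Z)\<close> of the Lax connection at \<open>- \<i>s\<close>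
  is isotropic, and \<open>v = (\<mu> Y, s Z)\<close> satisfies
  \<open>\<partial>\<^sub>i v + (\<epsilon>\<^sub>i \<and> w) v = (\<mu>\<^sup>2 + s\<^sup>2) (a\<^sub>i \<bullet> Y) \<epsilon>\<^sub>i\<close>. Hence reflecting the frame at a real
  parameter \<open>\<mu>\<close> in \<open>v\<close> changes \<open>w\<close> by a multiple of \<open>v\<close>, which is the asserted change of
  \<open>(A\<^sub>1, F, b)\<close>. At \<open>\<mu> = 1\<close> this gives an adapted frame of the new submanifold, from whose
  structure equations (i) and (ii) are read off; at \<open>\<mu> = 0\<close> it gives the isometry with the sphere.
  Corresponding geodesics of the old and the new frame are interchanged by a reflection, so they meet
  on its mirror: this is the Ribaucour property.
\<close>

section \<open>Calculus of smooth maps\<close>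

text \<open>The new \<open>w\<close> must again have the form (lam a, f, b) with a, f, b independent
  of the spectral parameter, so the multiple of v that is subtracted must not involve \<mu>. This is
  where isotropy enters: Y \<bullet> Y = Z \<bullet> Z gives v \<bullet> v = (\<mu>^2 + s^2) (Z
  \<bullet> Z), and the factor \<mu>^2 + s^2 cancels against the one in the derivative of v. What
  remains is 2 (a_i \<bullet> Y) / (Z \<bullet> Z), and v = (\<mu> Y, s Z) itself has the required
  dependence on \<mu>. Isotropy is inherited from the unit initial vectors, since E E^t = I makes
  the frame preserve the complex bilinear form. A second obstacle is that flatness is demanded at
  every complex parameter although the new frame has poles at lam = i s and lam = - i s. All frames
  are therefore handled as real matrices at real \<mu>, where s \<noteq> 0 excludes poles, and
  flatness is carried over to complex parameters through its polynomial form. Finally, the new b may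
  vanish or change sign. The geometry is done where no component vanishes, and only b \<noteq> 0,
  never b > 0, is assumed of an adapted frame.\<close>

lemma pdv_eqI: "(f has_derivative D) (at x) \<Longrightarrow> pdv f i x = D (axis i 1)"
  unfolding pdv_def using frechet_derivative_at by metis

section \<open>Symmetry of second partial derivatives\<close>

lemma has_derivative_pdv_line:
  fixes f :: "real ^ 'n::finite \<Rightarrow> real"
  assumes "f differentiable (at (p + t *\<^sub>R axis i 1))"
  shows "((\<lambda>t. f (p + t *\<^sub>R axis i 1)) has_real_derivative pdv f i (p + t *\<^sub>R axis i 1)) (at t)"
proof -
  let ?u = "axis i 1 :: real ^ 'n" and ?D = "frechet_derivative f (at (p + t *\<^sub>R axis i 1))"
  have D: "(f has_derivative ?D) (at (p + t *\<^sub>R ?u))"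
    using assms by (simp add: frechet_derivative_works)
  have "((\<lambda>t. p + t *\<^sub>R ?u) has_derivative (\<lambda>d. d *\<^sub>R ?u)) (at t)"
    by (auto intro!: derivative_eq_intros)
  from has_derivative_compose[OF this D]
  have "((\<lambda>t. f (p + t *\<^sub>R ?u)) has_derivative (\<lambda>d. ?D (d *\<^sub>R ?u))) (at t)" .
  moreover have "?D (d *\<^sub>R ?u) = pdv f i (p + t *\<^sub>R ?u) * d" for d
    using linear_cmul[OF has_derivative_linear[OF D]] by (simp add: pdv_def)
  ultimately show ?thesis by (simp add: has_field_derivative_def)
qed

text \<open>The mean value theorem is applied in direction i to the difference of f in direction k,
  and then in direction k to \<open>pdv f i\<close>. The left side is symmetric in i and k while the
  right side is not, which is what yields the symmetry of second derivatives.\<close>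

lemma second_difference_mvt:
  fixes f :: "real ^ 'n::finite \<Rightarrow> real"
  assumes "\<And>y. y \<in> ball x r \<Longrightarrow> f differentiable (at y)"
    and "\<And>y. y \<in> ball x r \<Longrightarrow> pdv f i differentiable (at y)"
    and h: "0 < h" "2 * h < r"
  shows "\<exists>y. dist x y < 2 * h \<and>
    f (x + h *\<^sub>R axis i 1 + h *\<^sub>R axis k 1) - f (x + h *\<^sub>R axis i 1) - f (x + h *\<^sub>R axis k 1) + f x =
      h * h * pdv (pdv f i) k y"
proof -
  let ?u = "axis i 1 :: real ^ 'n" and ?v = "axis k 1 :: real ^ 'n"
  have near: "dist x (x + s *\<^sub>R ?u + t *\<^sub>R ?v) \<le> s + t" if "0 \<le> s" "0 \<le> t" for s t
  proof -
    have "norm (s *\<^sub>R ?u + t *\<^sub>R ?v) \<le> norm (s *\<^sub>R ?u) + norm (t *\<^sub>R ?v)"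
      by (rule norm_triangle_ineq)
    then show ?thesis using that by (simp add: dist_norm norm_minus_commute add_ac norm_axis_1)
  qed
  have inb: "x + s *\<^sub>R ?u + t *\<^sub>R ?v \<in> ball x r" if "0 \<le> s" "s \<le> h" "0 \<le> t" "t \<le> h" for s t
    using near[of s t] that h by simp
  let ?G = "\<lambda>s. f ((x + h *\<^sub>R ?v) + s *\<^sub>R ?u) - f (x + s *\<^sub>R ?u)"
  have dG: "(?G has_real_derivative
      pdv f i ((x + h *\<^sub>R ?v) + s *\<^sub>R ?u) - pdv f i (x + s *\<^sub>R ?u)) (at s)"
    if "0 \<le> s" "s \<le> h" for s
  proof (intro DERIV_diff has_derivative_pdv_line assms(1))
    show "(x + h *\<^sub>R ?v) + s *\<^sub>R ?u \<in> ball x r"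
      using inb[of s h] that h by (simp add: add_ac)
    show "x + s *\<^sub>R ?u \<in> ball x r" using inb[of s 0] that h by simp
  qed
  obtain a where a: "0 < a" "a < h" and
    Ga: "?G h - ?G 0 = (h - 0) * (pdv f i ((x + h *\<^sub>R ?v) + a *\<^sub>R ?u) - pdv f i (x + a *\<^sub>R ?u))"
    using MVT2[OF h(1) dG] by blast
  let ?H = "\<lambda>t. pdv f i ((x + a *\<^sub>R ?u) + t *\<^sub>R ?v)"
  have dH: "(?H has_real_derivative pdv (pdv f i) k ((x + a *\<^sub>R ?u) + t *\<^sub>R ?v)) (at t)"
    if "0 \<le> t" "t \<le> h" for t
    using that a by (intro has_derivative_pdv_line assms(2) inb) auto
  obtain c where c: "0 < c" "c < h" and
    Hc: "?H h - ?H 0 = (h - 0) * pdv (pdv f i) k ((x + a *\<^sub>R ?u) + c *\<^sub>R ?v)"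
    using MVT2[OF h(1) dH] by blast
  have "dist x (x + a *\<^sub>R ?u + c *\<^sub>R ?v) < 2 * h" using near[of a c] a c by simp
  moreover have "?G h - ?G 0 = h * h * pdv (pdv f i) k (x + a *\<^sub>R ?u + c *\<^sub>R ?v)"
    using Ga Hc by (simp add: add_ac)
  ultimately show ?thesis by (intro exI[of _ "x + a *\<^sub>R ?u + c *\<^sub>R ?v"]) (simp add: algebra_simps)
qed

text \<open>For each small h the same second difference equals h^2 times either mixed derivative,
  taken at two points within 2h of x. Continuity of both mixed derivatives at x then forces their
  values there to agree.\<close>

lemma pdv_commute_real:
  fixes f :: "real ^ 'n::finite \<Rightarrow> real"
  assumes "open U" "C_k_on 2 U f" "x \<in> U"
  shows "pdv (pdv f i) k x = pdv (pdv f k) i x"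
proof -
  have C: "C_k_on (Suc (Suc 0)) U f" using assms(2) by (simp add: numeral_2_eq_2)
  have d1: "f differentiable (at y)" if "y \<in> U" for y using C that by simp
  have d2: "pdv f l differentiable (at y)" if "y \<in> U" for y l using C that by simp
  have cont: "isCont (pdv (pdv f l) j) x" for l j
    using C assms(1,3) by (simp add: continuous_on_eq_continuous_at)
  have "\<bar>pdv (pdv f i) k x - pdv (pdv f k) i x\<bar> \<le> \<epsilon>" if "\<epsilon> > 0" for \<epsilon>
  proof -
    obtain r where r: "r > 0" "ball x r \<subseteq> U" using assms(1,3) openE by blast
    obtain d1' where 1: "d1' > 0" "\<And>y. dist y x < d1' \<Longrightarrow> dist (pdv (pdv f i) k y) (pdv (pdv f i) k x) < \<epsilon> / 2"
      using cont[of i k] \<open>\<epsilon> > 0\<close> unfolding continuous_at_eps_delta by (meson half_gt_zero)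
    obtain d2' where 2: "d2' > 0" "\<And>y. dist y x < d2' \<Longrightarrow> dist (pdv (pdv f k) i y) (pdv (pdv f k) i x) < \<epsilon> / 2"
      using cont[of k i] \<open>\<epsilon> > 0\<close> unfolding continuous_at_eps_delta by (meson half_gt_zero)
    \<comment> \<open>The intermediate points lie within 2h of x, so a quarter of the minimum keeps
      them strictly inside all three radii.\<close>
    define h where "h = min r (min d1' d2') / 4"
    have h: "h > 0" "2 * h < r" "2 * h < d1'" "2 * h < d2'"
      using r 1 2 by (auto simp: h_def min_def)
    obtain y where y: "dist x y < 2 * h" "f (x + h *\<^sub>R axis i 1 + h *\<^sub>R axis k 1)
        - f (x + h *\<^sub>R axis i 1) - f (x + h *\<^sub>R axis k 1) + f x = h * h * pdv (pdv f i) k y"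
      using second_difference_mvt[of x r f i h k] d1 d2 r h by blast
    obtain z where z: "dist x z < 2 * h" "f (x + h *\<^sub>R axis k 1 + h *\<^sub>R axis i 1)
        - f (x + h *\<^sub>R axis k 1) - f (x + h *\<^sub>R axis i 1) + f x = h * h * pdv (pdv f k) i z"
      using second_difference_mvt[of x r f k h i] d1 d2 r h by blast
    have "h * h * pdv (pdv f i) k y = h * h * pdv (pdv f k) i z"
      unfolding y(2)[symmetric] z(2)[symmetric] by (simp add: algebra_simps)
    then have "pdv (pdv f i) k y = pdv (pdv f k) i z" using h by simp
    moreover have "dist (pdv (pdv f i) k y) (pdv (pdv f i) k x) < \<epsilon> / 2"
      "dist (pdv (pdv f k) i z) (pdv (pdv f k) i x) < \<epsilon> / 2"
      using 1(2)[of y] 2(2)[of z] y z h by (auto simp: dist_commute)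
    ultimately show ?thesis unfolding dist_real_def by linarith
  qed
  then show ?thesis by (metis abs_ge_zero dense_ge eq_iff_diff_eq_0 abs_le_zero_iff)
qed

section \<open>Closure properties of smooth maps\<close>

lemma pdv_cong:
  assumes "open U" "x \<in> U" "\<And>y. y \<in> U \<Longrightarrow> f y = g y"
  shows "pdv f i x = pdv g i x"
proof -
  have "(f has_derivative D) (at x) \<longleftrightarrow> (g has_derivative D) (at x)" for D
    using assms by (metis has_derivative_transform_within_open)
  then show ?thesis by (simp add: pdv_def frechet_derivative_def)
qed

lemma differentiable_cong_open:
  assumes "open U" "x \<in> U" "\<And>y. y \<in> U \<Longrightarrow> f y = g y" "f differentiable (at x)"
  shows "g differentiable (at x)"
  using assms unfolding differentiable_def by (metis has_derivative_transform_within_open)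

text \<open>Rules such as the product rule describe \<open>pdv\<close> only at points of U, whereas
  \<open>C_k_on\<close> recurses on \<open>pdv\<close> as a function. Congruence on the open set U
  closes this gap in every closure proof below.\<close>

lemma C_k_on_cong:
  assumes "open U" "\<And>y. y \<in> U \<Longrightarrow> f y = g y" "C_k_on k U f"
  shows "C_k_on k U g"
  using assms(2,3)
proof (induction k arbitrary: f g)
  case 0
  then show ?case using continuous_on_eq by auto
next
  case (Suc k)
  have "C_k_on k U (pdv g i)" for i
    using Suc.IH[of "pdv f i" "pdv g i"] Suc.prems pdv_cong[OF assms(1)] by (metis C_k_on.simps(2))
  then show ?case using Suc.prems differentiable_cong_open[OF assms(1)] by (metis C_k_on.simps(2))
qed

text \<open>The product rule pairs f with \<open>pdv g i\<close>, which is one order less regular,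
  so the inductions for products and inverses have to lower the order of f. At the bottom,
  differentiability supplies continuity.\<close>

lemma C_k_on_Suc_D: "C_k_on (Suc k) U f \<Longrightarrow> C_k_on k U f"
proof (induction k arbitrary: f)
  case 0
  then show ?case
    by (auto intro!: continuous_at_imp_continuous_on differentiable_imp_continuous_within)
qed auto

lemma C_k_on_subset: "C_k_on k U f \<Longrightarrow> V \<subseteq> U \<Longrightarrow> C_k_on k V f"
  by (induction k arbitrary: f) (auto intro: continuous_on_subset)

lemma pdv_const [simp]: "pdv (\<lambda>y. c) i = (\<lambda>x. 0)"
  by (rule ext) (simp add: pdv_def)

lemma C_k_on_const: "C_k_on k U (\<lambda>x. c)"
  by (induction k arbitrary: c) auto

lemma pdv_linear:
  assumes "bounded_linear h" "f differentiable (at x)"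
  shows "pdv (\<lambda>x. h (f x)) i x = h (pdv f i x)"
  using pdv_eqI[OF bounded_linear.has_derivative[OF assms(1)
      assms(2)[unfolded frechet_derivative_works]]]
  by (simp add: pdv_def)

lemma differentiable_linear:
  assumes "bounded_linear h" "f differentiable F"
  shows "(\<lambda>x. h (f x)) differentiable F"
  using assms bounded_linear.has_derivative unfolding differentiable_def by blast

lemma C_k_on_linear:
  assumes "open U" "bounded_linear h" "C_k_on k U f"
  shows "C_k_on k U (\<lambda>x. h (f x))"
  using assms(3)
proof (induction k arbitrary: f)
  case 0
  then show ?case using bounded_linear.continuous_on[OF assms(2)] by simp
next
  case (Suc k)
  have "C_k_on k U (pdv (\<lambda>x. h (f x)) i)" for i
    by (rule C_k_on_cong[OF assms(1) pdv_linear[OF assms(2), symmetric] Suc.IH[of "pdv f i"]])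
      (use Suc.prems in auto)
  then show ?case using Suc.prems differentiable_linear[OF assms(2)] by auto
qed

lemma pdv_add:
  assumes "f differentiable (at x)" "g differentiable (at x)"
  shows "pdv (\<lambda>x. f x + g x) i x = pdv f i x + pdv g i x"
  using pdv_eqI[OF has_derivative_add[OF assms[unfolded frechet_derivative_works]]]
  by (simp add: pdv_def)

lemma C_k_on_add:
  assumes "open U" "C_k_on k U f" "C_k_on k U g"
  shows "C_k_on k U (\<lambda>x. f x + g x)"
  using assms(2,3)
proof (induction k arbitrary: f g)
  case 0
  then show ?case by (simp add: continuous_on_add)
next
  case (Suc k)
  have "C_k_on k U (pdv (\<lambda>x. f x + g x) i)" for i
    by (rule C_k_on_cong[OF assms(1) _ Suc.IH[of "pdv f i" "pdv g i"]])
      (use Suc.prems pdv_add[of f _ g] in auto)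
  then show ?case using Suc.prems by auto
qed

lemma pdv_bilinear:
  assumes "bounded_bilinear B" "f differentiable (at x)" "g differentiable (at x)"
  shows "pdv (\<lambda>x. B (f x) (g x)) i x = B (f x) (pdv g i x) + B (pdv f i x) (g x)"
  using pdv_eqI[OF bounded_bilinear.FDERIV[OF assms(1)
      assms(2)[unfolded frechet_derivative_works] assms(3)[unfolded frechet_derivative_works]]]
  by (simp add: pdv_def)

lemma differentiable_bilinear:
  assumes "bounded_bilinear B" "f differentiable (at x)" "g differentiable (at x)"
  shows "(\<lambda>x. B (f x) (g x)) differentiable (at x)"
  using bounded_bilinear.FDERIV[OF assms(1)] assms(2,3) unfolding differentiable_def by blast

lemma C_k_on_bilinear:
  assumes "open U" "bounded_bilinear B" "C_k_on k U f" "C_k_on k U g"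
  shows "C_k_on k U (\<lambda>x. B (f x) (g x))"
  using assms(3,4)
proof (induction k arbitrary: f g)
  case 0
  then show ?case using bounded_bilinear.continuous_on[OF assms(2)] by simp
next
  case (Suc k)
  have "C_k_on k U (pdv (\<lambda>x. B (f x) (g x)) i)" for i
  proof (rule C_k_on_cong[OF assms(1)])
    show "C_k_on k U (\<lambda>x. B (f x) (pdv g i x) + B (pdv f i x) (g x))"
      using Suc.prems C_k_on_Suc_D[OF Suc.prems(1)] C_k_on_Suc_D[OF Suc.prems(2)]
      by (intro C_k_on_add[OF assms(1)] Suc.IH) auto
    show "B (f y) (pdv g i y) + B (pdv f i y) (g y) = pdv (\<lambda>x. B (f x) (g x)) i y" if "y \<in> U" for y
      by (rule pdv_bilinear[OF assms(2), symmetric]) (use Suc.prems that in auto)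
  qed
  moreover have "(\<lambda>x. B (f x) (g x)) differentiable (at x)" if "x \<in> U" for x
    by (rule differentiable_bilinear[OF assms(2)]) (use Suc.prems that in auto)
  ultimately show ?case by simp
qed

lemma pdv_inverse:
  fixes f :: "real ^ 'n::finite \<Rightarrow> real"
  assumes "f differentiable (at x)" "f x \<noteq> 0"
  shows "pdv (\<lambda>x. inverse (f x)) i x = - (inverse (f x) * (pdv f i x * inverse (f x)))"
  using pdv_eqI[OF Deriv.has_derivative_inverse[OF assms(2) assms(1)[unfolded frechet_derivative_works]]]
  by (simp add: pdv_def)

lemma C_k_on_inverse:
  fixes f :: "real ^ 'n::finite \<Rightarrow> real"
  assumes "open U" "C_k_on k U f" "\<And>x. x \<in> U \<Longrightarrow> f x \<noteq> 0"
  shows "C_k_on k U (\<lambda>x. inverse (f x))"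
  using assms(2)
proof (induction k)
  case 0
  then show ?case using assms(3) by (simp add: continuous_on_inverse)
next
  case (Suc k)
  have I: "C_k_on k U (\<lambda>x. inverse (f x))" using Suc C_k_on_Suc_D by blast
  have "C_k_on k U (pdv (\<lambda>x. inverse (f x)) i)" for i
  proof (rule C_k_on_cong[OF assms(1)])
    show "C_k_on k U (\<lambda>x. - (inverse (f x) * (pdv f i x * inverse (f x))))"
      using I Suc.prems
      by (intro C_k_on_linear[OF assms(1) bounded_linear_minus[OF bounded_linear_ident]]
          C_k_on_bilinear[OF assms(1) bounded_bilinear_mult]) auto
    show "- (inverse (f y) * (pdv f i y * inverse (f y))) = pdv (\<lambda>x. inverse (f x)) i y" if "y \<in> U" for y
      by (rule pdv_inverse[symmetric]) (use Suc.prems assms(3) that in auto)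
  qed
  moreover have "(\<lambda>x. inverse (f x)) differentiable (at x)" if "x \<in> U" for x
    using Suc.prems assms(3) that by (auto intro: differentiable_inverse)
  ultimately show ?case by auto
qed

lemma smooth_on_differentiable: "smooth_on U f \<Longrightarrow> x \<in> U \<Longrightarrow> f differentiable (at x)"
  unfolding smooth_on_def by (metis C_k_on.simps(2))

lemma smooth_on_continuous: "smooth_on U f \<Longrightarrow> continuous_on U f"
  unfolding smooth_on_def by (metis C_k_on.simps(1))

lemma smooth_on_pdv: "smooth_on U f \<Longrightarrow> smooth_on U (pdv f i)"
  unfolding smooth_on_def by (metis C_k_on.simps(2))

lemma smooth_on_cong:
  "open U \<Longrightarrow> smooth_on U f \<Longrightarrow> (\<And>y. y \<in> U \<Longrightarrow> f y = g y) \<Longrightarrow> smooth_on U g"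
  unfolding smooth_on_def using C_k_on_cong by blast

lemma smooth_on_subset: "smooth_on U f \<Longrightarrow> V \<subseteq> U \<Longrightarrow> smooth_on V f"
  unfolding smooth_on_def using C_k_on_subset by blast

lemma smooth_on_const: "smooth_on U (\<lambda>x. c)"
  unfolding smooth_on_def using C_k_on_const by blast

lemma smooth_on_linear: "open U \<Longrightarrow> bounded_linear h \<Longrightarrow> smooth_on U f \<Longrightarrow> smooth_on U (\<lambda>x. h (f x))"
  unfolding smooth_on_def using C_k_on_linear by blast

lemma smooth_on_add:
  "open U \<Longrightarrow> smooth_on U f \<Longrightarrow> smooth_on U g \<Longrightarrow> smooth_on U (\<lambda>x. f x + g x)"
  unfolding smooth_on_def using C_k_on_add by blast

lemma smooth_on_minus: "open U \<Longrightarrow> smooth_on U f \<Longrightarrow> smooth_on U (\<lambda>x. - f x)"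
  by (rule smooth_on_linear[OF _ bounded_linear_minus[OF bounded_linear_ident]])

lemma smooth_on_diff:
  "open U \<Longrightarrow> smooth_on U f \<Longrightarrow> smooth_on U g \<Longrightarrow> smooth_on U (\<lambda>x. f x - g x)"
  using smooth_on_add[of U f "\<lambda>x. - g x"] smooth_on_minus by fastforce

lemma smooth_on_bilinear:
  "open U \<Longrightarrow> bounded_bilinear B \<Longrightarrow> smooth_on U f \<Longrightarrow> smooth_on U g \<Longrightarrow>
    smooth_on U (\<lambda>x. B (f x) (g x))"
  unfolding smooth_on_def using C_k_on_bilinear by blast

lemmas smooth_on_mult = smooth_on_bilinear[OF _ bounded_bilinear_mult]
lemmas smooth_on_scaleR = smooth_on_bilinear[OF _ bounded_bilinear_scaleR]
lemmas smooth_on_inner = smooth_on_bilinear[OF _ bounded_bilinear_inner]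

lemma smooth_on_divide:
  fixes f g :: "real ^ 'n::finite \<Rightarrow> real"
  shows "open U \<Longrightarrow> smooth_on U f \<Longrightarrow> smooth_on U g \<Longrightarrow> (\<And>x. x \<in> U \<Longrightarrow> g x \<noteq> 0) \<Longrightarrow>
    smooth_on U (\<lambda>x. f x / g x)"
  unfolding divide_inverse
  by (rule smooth_on_mult) (auto simp: smooth_on_def intro!: C_k_on_inverse)

lemma smooth_on_sum:
  "open U \<Longrightarrow> (\<And>j. j \<in> J \<Longrightarrow> smooth_on U (f j)) \<Longrightarrow> smooth_on U (\<lambda>x. \<Sum>j\<in>J. f j x)"
  by (induction J rule: infinite_finite_induct) (auto intro: smooth_on_add smooth_on_const)

text \<open>Differentiation commutes with taking the inner product with a basis vector, which
  reduces the vector-valued case to the real one.\<close>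

lemma pdv_commute:
  fixes f :: "real ^ 'n::finite \<Rightarrow> 'b::euclidean_space"
  assumes "open U" "smooth_on U f" "x \<in> U"
  shows "pdv (pdv f i) k x = pdv (pdv f k) i x"
proof (rule euclidean_eqI)
  fix c :: 'b
  let ?g = "\<lambda>y. f y \<bullet> c"
  have bl: "bounded_linear (\<lambda>v. v \<bullet> c)" by (rule bounded_linear_inner_left)
  have 1: "pdv ?g j y = pdv f j y \<bullet> c" if "y \<in> U" for j y
    by (rule pdv_linear[OF bl]) (use assms that smooth_on_differentiable in auto)
  have 2: "pdv (pdv ?g j) l x = pdv (pdv f j) l x \<bullet> c" for j l
  proof -
    have "pdv (pdv ?g j) l x = pdv (\<lambda>y. pdv f j y \<bullet> c) l x"
      by (rule pdv_cong[OF assms(1,3) 1])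
    also have "\<dots> = pdv (pdv f j) l x \<bullet> c"
      by (rule pdv_linear[OF bl]) (use assms smooth_on_differentiable smooth_on_pdv in blast)
    finally show ?thesis .
  qed
  have "smooth_on U ?g" by (rule smooth_on_linear[OF assms(1) bl assms(2)])
  then have "pdv (pdv ?g i) k x = pdv (pdv ?g k) i x"
    using pdv_commute_real[OF assms(1) _ assms(3)] unfolding smooth_on_def by blast
  then show "pdv (pdv f i) k x \<bullet> c = pdv (pdv f k) i x \<bullet> c" by (simp add: 2)
qed

section \<open>Orthonormal frames adapted to a line of curvature parametrization\<close>

lemma frechet_derivative_eq_sum_pdv:
  fixes f :: "real ^ 'n::finite \<Rightarrow> 'b::real_normed_vector"
  assumes "f differentiable (at x)"
  shows "frechet_derivative f (at x) h = (\<Sum>i\<in>UNIV. h $ i *\<^sub>R pdv f i x)"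
proof -
  have l: "linear (frechet_derivative f (at x))"
    by (rule linear_frechet_derivative[OF assms])
  have "h = (\<Sum>i\<in>UNIV. h $ i *\<^sub>R axis i 1)"
    by (simp add: vec_eq_iff axis_def if_distrib cong: if_cong)
  then have "frechet_derivative f (at x) h = frechet_derivative f (at x) (\<Sum>i\<in>UNIV. h $ i *\<^sub>R axis i 1)"
    by metis
  also have "\<dots> = (\<Sum>i\<in>UNIV. h $ i *\<^sub>R pdv f i x)"
    by (simp add: linear_sum[OF l] linear_cmul[OF l] pdv_def)
  finally show ?thesis .
qed

lemma matrix_inv_eqI:
  fixes M N :: "'a::semiring_1 ^ 'k::finite ^ 'k"
  assumes "M ** N = mat 1" "N ** M = mat 1"
  shows "matrix_inv M = N"
proof -
  have "M ** matrix_inv M = mat 1 \<and> matrix_inv M ** M = mat 1"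
    unfolding matrix_inv_def by (rule someI[of _ N]) (use assms in simp)
  then have "matrix_inv M ** (M ** N) = N" by (simp add: matrix_mul_assoc)
  then show ?thesis using assms by simp
qed

definition diag_mat :: "real ^ 'n \<Rightarrow> real ^ 'n ^ 'n::finite" where
  "diag_mat w = (\<chi> i k. if i = k then w $ i else 0)"

lemma diag_mat_mult: "diag_mat v ** diag_mat w = diag_mat (\<chi> i. v $ i * w $ i)"
  by (simp add: vec_eq_iff diag_mat_def matrix_matrix_mult_def mult_delta_left)

lemma diag_mat_mult_vec: "(diag_mat w *v a) $ i = w $ i * a $ i"
  by (simp add: diag_mat_def matrix_vector_mult_def mult_delta_left)

lemma matrix_inv_diag_mat:
  assumes "\<And>i. w $ i \<noteq> 0"
  shows "matrix_inv (diag_mat w) = diag_mat (\<chi> i. inverse (w $ i))"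
  by (rule matrix_inv_eqI) (use assms in \<open>simp_all add: diag_mat_mult, simp_all add: diag_mat_def mat_def vec_eq_iff\<close>)

lemma dim_range_diag_mat: "dim (range (diag_mat :: real ^ 'n \<Rightarrow> _)) = CARD('n::finite)"
proof -
  have "linear (diag_mat :: real ^ 'n \<Rightarrow> _)"
    by (rule linearI) (auto simp: diag_mat_def vec_eq_iff)
  moreover have "inj (diag_mat :: real ^ 'n \<Rightarrow> _)"
    by (auto simp: inj_def diag_mat_def vec_eq_iff split: if_splits)
  ultimately show ?thesis
    using dim_image_eq[of "diag_mat :: real ^ 'n \<Rightarrow> _" UNIV] by simp
qed

text \<open>The equations \<open>dX\<close>, \<open>de\<close> and \<open>dt\<close> are the columns
  of dg = g (\<epsilon>_i \<and> w_i) at parameter 1, for g with columns e, t, X. Old and new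
  submanifold are both instances: (i) and (ii) are read off in one of them, and (iii) compares the
  two.\<close>

locale adapted_frame =
  fixes U :: "(real ^ 'n::finite) set"
    and X :: "real ^ 'n \<Rightarrow> 'a::euclidean_space"
    and e :: "'m::finite \<Rightarrow> real ^ 'n \<Rightarrow> 'a"
    and t :: "'n \<Rightarrow> real ^ 'n \<Rightarrow> 'a"
    and A :: "real ^ 'n \<Rightarrow> real ^ 'n ^ 'm"
    and F :: "real ^ 'n \<Rightarrow> real ^ 'n ^ 'n"
    and b :: "real ^ 'n \<Rightarrow> real ^ 'n"
  assumes open_U: "open U"
    and smooth_X: "smooth_on U X"
    and smooth_e: "\<And>j. smooth_on U (e j)"
    and smooth_t: "\<And>i. smooth_on U (t i)"
    and smooth_b: "smooth_on U b"
    and b_nz: "\<And>x i. x \<in> U \<Longrightarrow> b x $ i \<noteq> 0"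
    and ortho_A: "\<And>x. x \<in> U \<Longrightarrow> transpose (A x) ** A x = mat 1"
    and XX: "\<And>x. x \<in> U \<Longrightarrow> X x \<bullet> X x = 1"
    and eX: "\<And>x j. x \<in> U \<Longrightarrow> e j x \<bullet> X x = 0"
    and tX: "\<And>x i. x \<in> U \<Longrightarrow> t i x \<bullet> X x = 0"
    and ee: "\<And>x j k. x \<in> U \<Longrightarrow> e j x \<bullet> e k x = (if j = k then 1 else 0)"
    and et: "\<And>x j i. x \<in> U \<Longrightarrow> e j x \<bullet> t i x = 0"
    and tt: "\<And>x i k. x \<in> U \<Longrightarrow> t i x \<bullet> t k x = (if i = k then 1 else 0)"
    and expansion: "\<And>x v. x \<in> U \<Longrightarrow>
      v = (\<Sum>j\<in>UNIV. (v \<bullet> e j x) *\<^sub>R e j x) + (\<Sum>i\<in>UNIV. (v \<bullet> t i x) *\<^sub>R t i x) + (v \<bullet> X x) *\<^sub>R X x"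
    and dX: "\<And>x i. x \<in> U \<Longrightarrow> pdv X i x = b x $ i *\<^sub>R t i x"
    and de: "\<And>x j i. x \<in> U \<Longrightarrow> pdv (e j) i x = A x $ j $ i *\<^sub>R t i x"
    and dt: "\<And>x k i. x \<in> U \<Longrightarrow> pdv (t k) i x =
      (if i = k
       then - (\<Sum>j\<in>UNIV. A x $ j $ i *\<^sub>R e j x) - (\<Sum>l\<in>UNIV. F x $ i $ l *\<^sub>R t l x) - b x $ i *\<^sub>R X x
       else F x $ i $ k *\<^sub>R t i x)"
begin

lemmas ip = XX eX tX ee et tt

lemma te: "x \<in> U \<Longrightarrow> t i x \<bullet> e j x = 0"
  using et by (simp add: inner_commute)

lemma Xe: "x \<in> U \<Longrightarrow> X x \<bullet> e j x = 0"
  using eX by (simp add: inner_commute)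

lemma smooth_bi: "smooth_on U (\<lambda>x. b x $ i)"
  by (rule smooth_on_linear[OF open_U bounded_linear_vec_nth smooth_b])

lemma normal_fibre_iff:
  "x \<in> U \<Longrightarrow> v \<in> normal_fibre X x \<longleftrightarrow> v \<bullet> X x = 0 \<and> (\<forall>i. v \<bullet> t i x = 0)"
  using b_nz by (auto simp: normal_fibre_def dX)

lemma combination_in_normal_fibre: "x \<in> U \<Longrightarrow> (\<Sum>j\<in>UNIV. c j *\<^sub>R e j x) \<in> normal_fibre X x"
  by (simp add: normal_fibre_iff inner_sum_left eX et)

lemma e_in_normal_fibre: "x \<in> U \<Longrightarrow> e j x \<in> normal_fibre X x"
  by (simp add: normal_fibre_iff eX et)

lemma combination_inner_e: "x \<in> U \<Longrightarrow> (\<Sum>j\<in>UNIV. c j *\<^sub>R e j x) \<bullet> e k x = c k"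
  by (simp add: inner_sum_left ee if_distrib cong: if_cong)

lemma normal_expansion:
  "x \<in> U \<Longrightarrow> v \<in> normal_fibre X x \<Longrightarrow> v = (\<Sum>j\<in>UNIV. (v \<bullet> e j x) *\<^sub>R e j x)"
  by (subst expansion[of x v]) (simp_all add: normal_fibre_iff)

lemma normal_part_eq:
  assumes "x \<in> U"
  shows "normal_part X x v = (\<Sum>j\<in>UNIV. (v \<bullet> e j x) *\<^sub>R e j x)"
  unfolding normal_part_def
proof (rule the_equality)
  let ?w = "\<Sum>j\<in>UNIV. (v \<bullet> e j x) *\<^sub>R e j x"
  have "(v - ?w) \<bullet> u = 0" if "u \<in> normal_fibre X x" for u
  proof -
    have u: "u = (\<Sum>j\<in>UNIV. (u \<bullet> e j x) *\<^sub>R e j x)" by (rule normal_expansion[OF assms that])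
    have w: "(v - ?w) \<bullet> e j x = 0" for j
      by (simp add: inner_diff_left combination_inner_e assms)
    have "(v - ?w) \<bullet> (\<Sum>j\<in>UNIV. (u \<bullet> e j x) *\<^sub>R e j x) = 0"
      unfolding inner_sum_right inner_scaleR_right w by simp
    with arg_cong[OF u, of "\<lambda>z. (v - ?w) \<bullet> z"] show ?thesis by (rule trans)
  qed
  then show "?w \<in> normal_fibre X x \<and> (\<forall>u\<in>normal_fibre X x. (v - ?w) \<bullet> u = 0)"
    by (intro conjI ballI combination_in_normal_fibre[OF assms])
next
  fix w assume w: "w \<in> normal_fibre X x \<and> (\<forall>u\<in>normal_fibre X x. (v - w) \<bullet> u = 0)"
  then have "w \<bullet> e j x = v \<bullet> e j x" for j
    using e_in_normal_fibre[OF assms, of j] by (simp add: inner_diff_left)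
  then show "w = (\<Sum>j\<in>UNIV. (v \<bullet> e j x) *\<^sub>R e j x)"
    using normal_expansion[OF assms, of w] w by simp
qed

lemma first_ff_eq:
  "x \<in> U \<Longrightarrow> first_ff X x $ i $ k = (if i = k then (b x $ i)\<^sup>2 else 0)"
  by (simp add: first_ff_def dX tt power2_eq_square)

lemma first_ff_diag: "x \<in> U \<Longrightarrow> first_ff X x = diag_mat (\<chi> i. (b x $ i)\<^sup>2)"
  by (simp add: vec_eq_iff first_ff_eq diag_mat_def)

lemma ddX:
  assumes "x \<in> U"
  shows "pdv (pdv X i) k x = b x $ i *\<^sub>R pdv (t i) k x + pdv (\<lambda>y. b y $ i) k x *\<^sub>R t i x"
proof -
  have "pdv (pdv X i) k x = pdv (\<lambda>y. b y $ i *\<^sub>R t i y) k x"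
    by (rule pdv_cong[OF open_U assms dX])
  also have "\<dots> = b x $ i *\<^sub>R pdv (t i) k x + pdv (\<lambda>y. b y $ i) k x *\<^sub>R t i x"
    by (rule pdv_bilinear[OF bounded_bilinear_scaleR])
      (use assms smooth_bi smooth_t smooth_on_differentiable in blast)+
  finally show ?thesis .
qed

lemma second_ff_eq:
  assumes "x \<in> U"
  shows "second_ff X x i k =
    (if i = k then \<Sum>j\<in>UNIV. (A x $ j $ i * b x $ i) *\<^sub>R e j x else 0)"
proof -
  have 1: "(\<Sum>l\<in>UNIV. c l *\<^sub>R t l x) \<bullet> e j x = 0" for c j
    using assms by (simp add: inner_sum_left te)
  have "pdv (pdv X i) k x \<bullet> e j x = (if i = k then - (A x $ j $ i * b x $ i) else 0)" for j
    using assms by (simp add: ddX dt inner_add_left inner_diff_left te Xe combination_inner_e 1)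
  then show ?thesis
    using assms by (simp add: second_ff_def normal_part_eq sum_negf if_distrib if_distribR cong: if_cong)
qed

lemma shape_op_eq:
  assumes "x \<in> U"
  shows "shape_op X x v = diag_mat (\<chi> i. (\<Sum>j\<in>UNIV. A x $ j $ i * (e j x \<bullet> v)) / b x $ i)"
proof -
  have "(\<chi> i k. second_ff X x i k \<bullet> v) =
      diag_mat (\<chi> i. b x $ i * (\<Sum>j\<in>UNIV. A x $ j $ i * (e j x \<bullet> v)))"
    using assms by (simp add: vec_eq_iff second_ff_eq diag_mat_def inner_sum_left sum_distrib_left
        ac_simps)
  then show ?thesis
    using assms b_nz unfolding shape_op_def
    by (simp add: first_ff_diag matrix_inv_diag_mat diag_mat_mult power2_eq_square field_simps)
qed

text \<open>Shape operators are diagonal in these coordinates; that they fill all diagonal matrices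
  is due to \<open>ortho_A\<close>, which makes the transpose of A surjective. Both nondegeneracy
  and the description of the principal directions rest on this.\<close>

lemma shape_op_image:
  assumes "x \<in> U"
  shows "shape_op X x ` normal_fibre X x = range diag_mat"
proof (rule equalityI)
  show "shape_op X x ` normal_fibre X x \<subseteq> range diag_mat" using assms by (auto simp: shape_op_eq)
  show "range diag_mat \<subseteq> shape_op X x ` normal_fibre X x"
  proof (rule subsetI, elim rangeE)
    fix M and w :: "real ^ 'n" assume M: "M = diag_mat w"
    \<comment> \<open>The coefficient vector is A applied to (b_k w_k): the transpose of A recovers
      b_k w_k, and the shape operator divides by b_k.\<close>
    define v where "v = (\<Sum>j\<in>UNIV. (\<Sum>k\<in>UNIV. A x $ j $ k * (b x $ k * w $ k)) *\<^sub>R e j x)"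
    have vj: "e j x \<bullet> v = (\<Sum>k\<in>UNIV. A x $ j $ k * (b x $ k * w $ k))" for j
      unfolding v_def using combination_inner_e[OF assms] by (simp add: inner_commute)
    have "(\<Sum>j\<in>UNIV. A x $ j $ i * (e j x \<bullet> v)) = b x $ i * w $ i" for i
    proof -
      have "(\<Sum>j\<in>UNIV. A x $ j $ i * A x $ j $ k) = (if i = k then 1 else 0)" for k
        using ortho_A[OF assms] by (simp add: vec_eq_iff matrix_matrix_mult_def transpose_def mat_def)
      then have "(\<Sum>k\<in>UNIV. (\<Sum>j\<in>UNIV. A x $ j $ i * A x $ j $ k) * (b x $ k * w $ k)) = b x $ i * w $ i"
        by (simp only:) (simp add: mult_delta_left)
      moreover have "(\<Sum>j\<in>UNIV. A x $ j $ i * (e j x \<bullet> v)) =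
          (\<Sum>k\<in>UNIV. (\<Sum>j\<in>UNIV. A x $ j $ i * A x $ j $ k) * (b x $ k * w $ k))"
        unfolding vj sum_distrib_left sum_distrib_right by (subst sum.swap) (simp add: mult.assoc)
      ultimately show ?thesis by simp
    qed
    then have "M = shape_op X x v"
      using assms b_nz by (simp add: M shape_op_eq vec_eq_iff diag_mat_def)
    moreover have "v \<in> normal_fibre X x"
      unfolding v_def by (rule combination_in_normal_fibre[OF assms])
    ultimately show "M \<in> shape_op X x ` normal_fibre X x" by blast
  qed
qed

lemma nondegenerate: "nondegenerate_normal_bundle U X"
  by (simp add: nondegenerate_normal_bundle_def shape_op_image dim_range_diag_mat)

lemma curvature_line: "line_of_curvature_coordinates U X"
  by (simp add: line_of_curvature_coordinates_def first_ff_eq second_ff_eq)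

lemma immersion: "sphere_immersion U X"
proof -
  have "inj (frechet_derivative X (at x))" if "x \<in> U" for x
  proof -
    have d: "X differentiable (at x)" using smooth_on_differentiable[OF smooth_X that] .
    have "h = 0" if h: "frechet_derivative X (at x) h = 0" for h
    proof -
      have "frechet_derivative X (at x) h \<bullet> t i x = h $ i * b x $ i" for i
        using \<open>x \<in> U\<close>
        by (simp add: frechet_derivative_eq_sum_pdv[OF d] inner_sum_left dX tt if_distrib cong: if_cong)
      then show "h = 0" using h b_nz[OF \<open>x \<in> U\<close>] by (auto simp: vec_eq_iff)
    qed
    then show ?thesis using linear_injective_0[OF linear_frechet_derivative[OF d]] by blast
  qed
  moreover have "norm (X x) = 1" if "x \<in> U" for x using XX[OF that] by (simp add: norm_eq_1)
  ultimately show ?thesis using open_U smooth_X by (simp add: sphere_immersion_def)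
qed

section \<open>The normal connection in the frame \<open>e\<close>\<close>

lemma smooth_coefficient:
  "smooth_on U \<zeta> \<Longrightarrow> smooth_on U (\<lambda>y. \<zeta> y \<bullet> e j y)"
  by (rule smooth_on_inner[OF open_U _ smooth_e])

lemma pdv_coefficient:
  assumes "normal_field U X \<zeta>" "x \<in> U"
  shows "pdv (\<lambda>y. \<zeta> y \<bullet> e j y) i x = pdv \<zeta> i x \<bullet> e j x"
proof -
  have "pdv (\<lambda>y. \<zeta> y \<bullet> e j y) i x = \<zeta> x \<bullet> pdv (e j) i x + pdv \<zeta> i x \<bullet> e j x"
    by (rule pdv_bilinear[OF bounded_bilinear_inner])
      (use assms smooth_e smooth_on_differentiable normal_field_def in blast)+
  moreover have "\<zeta> x \<bullet> t i x = 0" using assms by (auto simp: normal_field_def normal_fibre_iff)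
  ultimately show ?thesis using assms(2) by (simp add: de)
qed

text \<open>Derivatives of the \<open>e j\<close> are tangent, so the normal connection
  differentiates coefficients. Flatness becomes the symmetry of second derivatives, and parallel
  fields are those whose coefficients have zero derivative.\<close>

lemma normal_conn_eq:
  assumes "normal_field U X \<zeta>" "x \<in> U"
  shows "normal_conn X i \<zeta> x = (\<Sum>j\<in>UNIV. pdv (\<lambda>y. \<zeta> y \<bullet> e j y) i x *\<^sub>R e j x)"
  using assms by (simp add: normal_conn_def normal_part_eq pdv_coefficient)

lemma normal_field_combination:
  assumes "\<And>j. smooth_on U (c j)"
  shows "normal_field U X (\<lambda>x. \<Sum>j\<in>UNIV. c j x *\<^sub>R e j x)"
  unfolding normal_field_def
  using assms smooth_e open_U
  by (auto intro!: smooth_on_sum smooth_on_scaleR combination_in_normal_fibre)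

lemma normal_conn_combination:
  assumes "\<And>j. smooth_on U (c j)" "x \<in> U"
  shows "normal_conn X i (\<lambda>x. \<Sum>j\<in>UNIV. c j x *\<^sub>R e j x) x = (\<Sum>j\<in>UNIV. pdv (c j) i x *\<^sub>R e j x)"
proof -
  have "pdv (\<lambda>y. (\<Sum>j\<in>UNIV. c j y *\<^sub>R e j y) \<bullet> e k y) i x = pdv (c k) i x" for k
    by (rule pdv_cong[OF open_U assms(2)]) (simp add: combination_inner_e)
  then show ?thesis
    using normal_conn_eq[OF normal_field_combination[of c] assms(2)] assms(1) by simp
qed

lemma flat: "flat_normal_bundle U X"
  unfolding flat_normal_bundle_def
proof (intro allI impI ballI)
  fix \<zeta> x i k assume z: "normal_field U X \<zeta>" and x: "x \<in> U"
  let ?c = "\<lambda>j y. \<zeta> y \<bullet> e j y"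
  have c: "smooth_on U (?c j)" for j using z smooth_coefficient by (auto simp: normal_field_def)
  have dd: "normal_conn X l (normal_conn X h \<zeta>) x = (\<Sum>j\<in>UNIV. pdv (pdv (?c j) h) l x *\<^sub>R e j x)" for l h
  proof -
    have "normal_conn X l (normal_conn X h \<zeta>) x =
        normal_conn X l (\<lambda>y. \<Sum>j\<in>UNIV. pdv (?c j) h y *\<^sub>R e j y) x"
      unfolding normal_conn_def[of X l]
      by (subst pdv_cong[OF open_U x normal_conn_eq[OF z]]) simp_all
    also have "\<dots> = (\<Sum>j\<in>UNIV. pdv (pdv (?c j) h) l x *\<^sub>R e j x)"
      by (rule normal_conn_combination[OF smooth_on_pdv[OF c] x])
    finally show ?thesis .
  qed
  show "normal_conn X i (normal_conn X k \<zeta>) x = normal_conn X k (normal_conn X i \<zeta>) x"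
    unfolding dd using pdv_commute[OF open_U c x] by metis
qed

lemma frame: "parallel_normal_frame U X e"
proof -
  have "normal_field U X (e j)" for j
    by (simp add: normal_field_def smooth_e e_in_normal_fibre)
  moreover have "normal_conn X i (e j) x = 0" if "x \<in> U" for i j x
    using that by (simp add: normal_conn_def normal_part_eq de te)
  moreover have "span (range (\<lambda>j. e j x)) = normal_fibre X x" if "x \<in> U" for x
  proof (rule equalityI)
    show "span (range (\<lambda>j. e j x)) \<subseteq> normal_fibre X x"
      by (rule span_minimal) (use e_in_normal_fibre[OF that] subspace_normal_fibre in auto)
    show "normal_fibre X x \<subseteq> span (range (\<lambda>j. e j x))"
    proof
      fix v assume "v \<in> normal_fibre X x"
      then have "v = (\<Sum>j\<in>UNIV. (v \<bullet> e j x) *\<^sub>R e j x)" by (rule normal_expansion[OF that])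
      also have "\<dots> \<in> span (range (\<lambda>j. e j x))"
        by (intro span_sum span_scale span_base) auto
      finally show "v \<in> span (range (\<lambda>j. e j x))" .
    qed
  qed
  ultimately show ?thesis by (simp add: parallel_normal_frame_def parallel_normal_field_def ee)
qed

text \<open>Compare the components along \<open>t i\<close> of the two mixed second derivatives of
  X: one is the k-th derivative of b_i, the other is b_k F_ik.\<close>

lemma rotation_coefficient:
  assumes "x \<in> U" "i \<noteq> k"
  shows "F x $ i $ k = pdv (\<lambda>y. b y $ i) k x / b x $ k"
proof -
  have "pdv (pdv X i) k x \<bullet> t i x = pdv (pdv X k) i x \<bullet> t i x"
    using pdv_commute[OF open_U smooth_X assms(1)] by metis
  then show ?thesis
    using assms b_nz[of x k] by (simp add: ddX dt inner_add_left tt field_simps)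
qed

lemma corresponding:
  assumes "partial_G_I_solution U A F b"
  shows "corresponding_solution U X e A F b"
  using assms unfolding corresponding_solution_def
  by (auto simp: first_ff_eq second_ff_eq rotation_coefficient partial_G_I_solution_def)

end

section \<open>Reflected frames and Ribaucour transformations\<close>

text \<open>Negative c is included because \<open>b\<close> and \<open>b'\<close> may have opposite
  signs; the parity of cos and sin absorbs the sign.\<close>

lemma sphere_geodesic_scaled:
  assumes "norm v = 1" "c \<noteq> 0"
  shows "sphere_geodesic p (c *\<^sub>R v) (\<tau> / c) = cos \<tau> *\<^sub>R p + sin \<tau> *\<^sub>R v"
  using assms by (cases "c > 0") (auto simp: sphere_geodesic_def)

text \<open>The great circle through \<open>p\<close> with direction \<open>v\<close> meets the hyperplane fixed by the reflection,
  and the point of intersection also lies on the reflected circle.\<close>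
lemma meet_equidistantly_reflected:
  fixes p q v w \<xi> :: "'a::euclidean_space"
  assumes pq: "p \<bullet> p = 1" "q \<bullet> q = 1" and vw: "norm v = 1" "norm w = 1"
    and orth: "p \<bullet> v = 0" "q \<bullet> w = 0"
    and refl: "q = p - \<alpha> *\<^sub>R \<xi>" "w = v - \<beta> *\<^sub>R \<xi>" and cd: "c \<noteq> 0" "d \<noteq> 0"
  shows "meet_equidistantly p (c *\<^sub>R v) q (d *\<^sub>R w)"
proof -
  \<comment> \<open>The point C p + S v and its counterpart C q + S w differ by (C \<alpha> + S
    \<beta>) \<xi>. A unit vector (C, S) orthogonal to (\<alpha>, \<beta>) therefore gives a common
    point; if \<alpha> = \<beta> = 0 the circles coincide and p itself is taken.\<close>
  have "\<exists>C S. C\<^sup>2 + S\<^sup>2 = 1 \<and> C * \<alpha> + S * \<beta> = 0"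
  proof (cases "\<alpha> = 0 \<and> \<beta> = 0")
    case True
    then show ?thesis by (intro exI[of _ 1] exI[of _ 0]) auto
  next
    case False
    define r where "r = sqrt (\<alpha>\<^sup>2 + \<beta>\<^sup>2)"
    have r: "r\<^sup>2 = \<alpha>\<^sup>2 + \<beta>\<^sup>2" "r \<noteq> 0" using False by (auto simp: r_def sum_power2_eq_zero_iff)
    have "(\<beta> / r)\<^sup>2 + (- \<alpha> / r)\<^sup>2 = (\<alpha>\<^sup>2 + \<beta>\<^sup>2) / r\<^sup>2"
      by (simp add: power_divide add_divide_distrib)
    also have "\<dots> = 1" using r(2) unfolding r(1)[symmetric] by simp
    finally have "(\<beta> / r)\<^sup>2 + (- \<alpha> / r)\<^sup>2 = 1" .
    moreover have "(\<beta> / r) * \<alpha> + (- \<alpha> / r) * \<beta> = 0" by simp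
    ultimately show ?thesis by blast
  qed
  then obtain C S where "C\<^sup>2 + S\<^sup>2 = 1" and CS: "C * \<alpha> + S * \<beta> = 0" by blast
  then obtain \<tau> where \<tau>: "C = cos \<tau>" "S = sin \<tau>" using sincos_total_2pi by metis
  define z where "z = cos \<tau> *\<^sub>R p + sin \<tau> *\<^sub>R v"
  have "cos \<tau> *\<^sub>R q + sin \<tau> *\<^sub>R w = z - (C * \<alpha> + S * \<beta>) *\<^sub>R \<xi>"
    by (simp add: z_def refl \<tau> algebra_simps)
  then have z: "z = cos \<tau> *\<^sub>R q + sin \<tau> *\<^sub>R w" using CS by simp
  have "z \<in> range (sphere_geodesic p (c *\<^sub>R v))"
    unfolding z_def using sphere_geodesic_scaled[OF vw(1) cd(1)] by (metis rangeI)
  moreover have "z \<in> range (sphere_geodesic q (d *\<^sub>R w))"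
    unfolding z using sphere_geodesic_scaled[OF vw(2) cd(2)] by (metis rangeI)
  moreover have "z \<bullet> p = cos \<tau>" "z \<bullet> q = cos \<tau>"
    using pq orth by (simp add: z_def inner_add_left inner_commute[of v],
        simp add: z inner_add_left inner_commute[of w])
  ultimately show ?thesis
    unfolding meet_equidistantly_def sphere_dist_def by (intro bexI[of _ z] IntI) simp_all
qed

text \<open>Testing with the diagonal matrix of the single axis i, where a_i \<noteq> 0, forces the
  eigenvalue 1 and kills every other component.\<close>

lemma common_eigenvector_diag_mat:
  assumes "\<And>w. eigenvector (diag_mat w) a"
  obtains i where "a $ i \<noteq> 0" "a = a $ i *\<^sub>R axis i 1"
proof -
  have "a \<noteq> 0" using assms by (auto simp: eigenvector_def)
  then obtain i where i: "a $ i \<noteq> 0" by (auto simp: vec_eq_iff)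
  obtain \<mu> where \<mu>: "diag_mat (axis i 1) *v a = \<mu> *\<^sub>R a"
    using assms[of "axis i 1"] by (auto simp: eigenvector_def)
  have comp: "axis i 1 $ k * a $ k = \<mu> * a $ k" for k
    using arg_cong[OF \<mu>, of "\<lambda>v. v $ k"] by (simp add: diag_mat_mult_vec)
  have "\<mu> = 1" using comp[of i] i by (simp add: axis_def)
  then have "a $ k = 0" if "k \<noteq> i" for k using comp[of k] that by (simp add: axis_def)
  then have "a = a $ i *\<^sub>R axis i 1" by (auto simp: vec_eq_iff axis_def)
  with i show ?thesis by (rule that)
qed

lemma diag_mat_axis: "diag_mat w *v (c *\<^sub>R axis i 1) = w $ i *\<^sub>R (c *\<^sub>R axis i 1)"
  by (simp add: vec_eq_iff diag_mat_mult_vec axis_def)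

context adapted_frame
begin

lemma combination_inner:
  "x \<in> U \<Longrightarrow> (\<Sum>j\<in>UNIV. c j *\<^sub>R e j x) \<bullet> (\<Sum>j\<in>UNIV. d j *\<^sub>R e j x) = (\<Sum>j\<in>UNIV. c j * d j)"
  by (simp add: inner_sum_right combination_inner_e ac_simps)

text \<open>P is arbitrary off the normal fibre, so linearity has to be unfolded along the sum while
  every partial sum is kept in the fibre.\<close>

lemma linear_on_normal_fibre:
  assumes x: "x \<in> U" and P: "linear_on_subspace (normal_fibre X x) P" "\<And>j. P (e j x) = f j"
    and v: "v \<in> normal_fibre X x"
  shows "P v = (\<Sum>j\<in>UNIV. (v \<bullet> e j x) *\<^sub>R f j)"
proof -
  have "P (\<Sum>j\<in>J. c j *\<^sub>R e j x) = (\<Sum>j\<in>J. c j *\<^sub>R f j)" if "finite J" for J c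
    using that
  proof (induction J rule: finite_induct)
    case empty
    have "P (0 *\<^sub>R 0) = 0 *\<^sub>R P 0"
      using P(1) subspace_0[OF subspace_normal_fibre] unfolding linear_on_subspace_def by blast
    then show ?case by simp
  next
    case (insert k J)
    have "c k *\<^sub>R e k x \<in> normal_fibre X x" "(\<Sum>j\<in>J. c j *\<^sub>R e j x) \<in> normal_fibre X x"
      using e_in_normal_fibre[OF x] subspace_normal_fibre[of X x]
      by (auto intro!: subspace_scale subspace_sum)
    then have "P (c k *\<^sub>R e k x + (\<Sum>j\<in>J. c j *\<^sub>R e j x)) = P (c k *\<^sub>R e k x) + P (\<Sum>j\<in>J. c j *\<^sub>R e j x)"
      "P (c k *\<^sub>R e k x) = c k *\<^sub>R f k"
      using P(1) e_in_normal_fibre[OF x, of k] unfolding linear_on_subspace_def by (blast, simp add: P(2))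
    then show ?case using insert by simp
  qed
  from this[of UNIV "\<lambda>j. v \<bullet> e j x"] show ?thesis using normal_expansion[OF x v] by simp
qed

lemma common_eigenvector:
  assumes x: "x \<in> U" and a: "\<And>v. v \<in> normal_fibre X x \<Longrightarrow> eigenvector (shape_op X x v) a"
  obtains i where "a $ i \<noteq> 0" "a = a $ i *\<^sub>R axis i 1"
proof (rule common_eigenvector_diag_mat)
  fix w
  have "diag_mat w \<in> shape_op X x ` normal_fibre X x" by (simp add: shape_op_image[OF x])
  then show "eigenvector (diag_mat w) a" using a by auto
qed

lemma derivative_axis:
  assumes "x \<in> U"
  shows "frechet_derivative X (at x) (c *\<^sub>R axis i 1) = (c * b x $ i) *\<^sub>R t i x"
proof -
  have "linear (frechet_derivative X (at x))"
    by (rule linear_frechet_derivative[OF smooth_on_differentiable[OF smooth_X assms]])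
  then show ?thesis using dX[OF assms] by (simp add: linear_cmul flip: pdv_def)
qed

end

lemma smooth_on_id: "open U \<Longrightarrow> smooth_on U (\<lambda>x. x)"
proof -
  have "pdv (\<lambda>x. x) i = (\<lambda>x. axis i 1)" for i :: 'a
    by (rule ext) (simp add: pdv_eqI[OF has_derivative_ident])
  then have "C_k_on k U (\<lambda>x. x)" for k by (cases k) (auto simp: C_k_on_const)
  then show ?thesis by (simp add: smooth_on_def)
qed

lemma push_section_id: "y \<in> U \<Longrightarrow> push_section U id P \<zeta> y = P y (\<zeta> y)"
  unfolding push_section_def using inv_into_f_f[of id U y] by simp

lemma normal_field_cong:
  assumes "open U" "normal_field U X \<zeta>" "\<And>y. y \<in> U \<Longrightarrow> \<zeta> y = \<eta> y"
  shows "normal_field U X \<eta>"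
  using assms smooth_on_cong[OF assms(1), of \<zeta> \<eta>] by (auto simp: normal_field_def)

text \<open>All columns of the two orthonormal frames differ by multiples of one vector
  \<open>\<xi> x\<close>, so corresponding unit combinations do too, which gives the meeting points.
  Both immersions have the same curvature line coordinates: the covering map is the identity on
  coordinates, and principal directions correspond to coordinate directions.\<close>

lemma reflected_frames_ribaucour:
  assumes M: "adapted_frame U X e t A F b" and M': "adapted_frame U X' e' t' A' F' b'"
    and X': "\<And>x. x \<in> U \<Longrightarrow> X' x = X x - \<alpha> x *\<^sub>R \<xi> x"
    and e': "\<And>x j. x \<in> U \<Longrightarrow> e' j x = e j x - \<beta> x j *\<^sub>R \<xi> x"
    and t': "\<And>x i. x \<in> U \<Longrightarrow> t' i x = t i x - \<gamma> x i *\<^sub>R \<xi> x"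
    and P: "\<And>x. x \<in> U \<Longrightarrow> linear_on_subspace (normal_fibre X x) (P x)"
    and Pe: "\<And>x j. x \<in> U \<Longrightarrow> P x (e j x) = e' j x"
  shows "ribaucour_transformation U X U X' id P"
proof -
  interpret M: adapted_frame U X e t A F b by (rule M)
  interpret M': adapted_frame U X' e' t' A' F' b' by (rule M')
  have Pv: "P x v = (\<Sum>j\<in>UNIV. (v \<bullet> e j x) *\<^sub>R e' j x)" if "x \<in> U" "v \<in> normal_fibre X x" for x v
    by (rule M.linear_on_normal_fibre[OF that(1) P[OF that(1)] Pe[OF that(1)] that(2)])
  have P_in: "P x v \<in> normal_fibre X' x" if "x \<in> U" "v \<in> normal_fibre X x" for x v
    using Pv[OF that] M'.combination_in_normal_fibre[OF that(1)] by simp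
  have bij: "bij_betw (P x) (normal_fibre X x) (normal_fibre X' x)" if x: "x \<in> U" for x
  proof (rule bij_betwI)
    let ?Q = "\<lambda>w. \<Sum>j\<in>UNIV. (w \<bullet> e' j x) *\<^sub>R e j x"
    show "P x \<in> normal_fibre X x \<rightarrow> normal_fibre X' x" using P_in[OF x] by blast
    show "?Q \<in> normal_fibre X' x \<rightarrow> normal_fibre X x"
      by (intro Pi_I M.combination_in_normal_fibre[OF x])
    show "?Q (P x v) = v" if "v \<in> normal_fibre X x" for v
      using M.normal_expansion[OF x that] by (simp add: Pv[OF x that] M'.combination_inner_e[OF x])
    show "P x (?Q w) = w" if "w \<in> normal_fibre X' x" for w
      using M'.normal_expansion[OF x that]
      by (simp add: Pv[OF x M.combination_in_normal_fibre[OF x]] M.combination_inner_e[OF x])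
  qed
  have push: "(\<Sum>j\<in>UNIV. (\<zeta> y \<bullet> e j y) *\<^sub>R e' j y) = push_section U id P \<zeta> y"
    if "normal_field U X \<zeta>" "y \<in> U" for \<zeta> y
    using that by (simp add: push_section_id Pv normal_field_def)
  have smooth_c: "smooth_on U (\<lambda>y. \<zeta> y \<bullet> e j y)" if "normal_field U X \<zeta>" for \<zeta> j
    using that by (intro M.smooth_coefficient) (simp add: normal_field_def)
  have push_field: "normal_field U X' (push_section U id P \<zeta>)" if z: "normal_field U X \<zeta>" for \<zeta>
    by (rule normal_field_cong[OF M.open_U M'.normal_field_combination[OF smooth_c[OF z]] push[OF z]])
  have push_parallel: "parallel_normal_field U X' (push_section U id P \<zeta>)"
    if z: "parallel_normal_field U X \<zeta>" for \<zeta>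
  proof -
    have nf: "normal_field U X \<zeta>" using z by (simp add: parallel_normal_field_def)
    have "normal_conn X' i (push_section U id P \<zeta>) x = 0" if x: "x \<in> U" for i x
    proof -
      have "pdv (\<lambda>y. \<zeta> y \<bullet> e j y) i x = normal_conn X i \<zeta> x \<bullet> e j x" for j
        by (simp add: M.normal_conn_eq[OF nf x] M.combination_inner_e[OF x])
      then have c0: "pdv (\<lambda>y. \<zeta> y \<bullet> e j y) i x = 0" for j
        using z x by (simp add: parallel_normal_field_def)
      have "normal_conn X' i (push_section U id P \<zeta>) x =
          normal_conn X' i (\<lambda>y. \<Sum>j\<in>UNIV. (\<zeta> y \<bullet> e j y) *\<^sub>R e' j y) x"
        unfolding normal_conn_def by (subst pdv_cong[OF M.open_U x push[OF nf], symmetric]) simp_all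
      also have "\<dots> = 0"
        by (subst M'.normal_conn_combination[OF smooth_c[OF nf] x]) (simp add: c0)
      finally show ?thesis .
    qed
    then show ?thesis using push_field[OF nf] by (simp add: parallel_normal_field_def)
  qed
  have meet_normal: "meet_equidistantly (X x) v (X' x) (P x v)"
    if x: "x \<in> U" and v: "v \<in> normal_fibre X x" "v \<noteq> 0" for x v
  proof -
    \<comment> \<open>The meeting lemma needs unit directions. Normalized coefficients give unit
      combinations in both frames, and these differ by
      (\<open>\<Sum>j\<in>UNIV. c j * \<beta> x j\<close>) times \<open>\<xi> x\<close>.\<close>
    define c where "c j = (v \<bullet> e j x) / norm v" for j
    have vc: "v = norm v *\<^sub>R (\<Sum>j\<in>UNIV. c j *\<^sub>R e j x)"
      using M.normal_expansion[OF x v(1)] v(2) by (simp add: c_def scaleR_sum_right)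
    have Pvc: "P x v = norm v *\<^sub>R (\<Sum>j\<in>UNIV. c j *\<^sub>R e' j x)"
      using v(2) by (simp add: Pv[OF x v(1)] c_def scaleR_sum_right)
    have "norm v * norm (\<Sum>j\<in>UNIV. c j *\<^sub>R e j x) = norm v" using arg_cong[OF vc, of norm] by simp
    then have n1: "norm (\<Sum>j\<in>UNIV. c j *\<^sub>R e j x) = 1" using v(2) by simp
    then have "(\<Sum>j\<in>UNIV. c j * c j) = 1"
      using M.combination_inner[OF x, of c c] by (simp add: norm_eq_1)
    then have n2: "norm (\<Sum>j\<in>UNIV. c j *\<^sub>R e' j x) = 1"
      using M'.combination_inner[OF x, of c c] by (simp add: norm_eq_1)
    have "meet_equidistantly (X x) (norm v *\<^sub>R (\<Sum>j\<in>UNIV. c j *\<^sub>R e j x))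
        (X' x) (norm v *\<^sub>R (\<Sum>j\<in>UNIV. c j *\<^sub>R e' j x))"
    proof (rule meet_equidistantly_reflected[OF M.XX[OF x] M'.XX[OF x] n1 n2 _ _ X'[OF x]])
      show "X x \<bullet> (\<Sum>j\<in>UNIV. c j *\<^sub>R e j x) = 0" by (simp add: inner_sum_right M.Xe[OF x])
      show "X' x \<bullet> (\<Sum>j\<in>UNIV. c j *\<^sub>R e' j x) = 0" by (simp add: inner_sum_right M'.Xe[OF x])
      show "(\<Sum>j\<in>UNIV. c j *\<^sub>R e' j x) = (\<Sum>j\<in>UNIV. c j *\<^sub>R e j x) - (\<Sum>j\<in>UNIV. c j * \<beta> x j) *\<^sub>R \<xi> x"
        by (simp add: e'[OF x] scaleR_diff_right sum_subtractf scaleR_sum_left)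
    qed (use v(2) in auto)
    then show ?thesis using vc Pvc by metis
  qed
  have tangent: "(\<forall>v \<in> normal_fibre X x. eigenvector (shape_op X' x (P x v)) a) \<and>
      meet_equidistantly (X x) (frechet_derivative X (at x) a) (X' x) (frechet_derivative X' (at x) a)"
    if x: "x \<in> U" and a: "\<And>v. v \<in> normal_fibre X x \<Longrightarrow> eigenvector (shape_op X x v) a" for x a
  proof -
    obtain i where i: "a $ i \<noteq> 0" and ai: "a = a $ i *\<^sub>R axis i 1"
      using M.common_eigenvector[OF x a] by blast
    have "eigenvector (diag_mat w) (c *\<^sub>R axis i 1)" if "c \<noteq> 0" for c w
      using that by (auto simp: eigenvector_def diag_mat_axis axis_eq_0_iff)
    then have "eigenvector (diag_mat w) a" for w using i ai by metis
    then have "eigenvector (shape_op X' x u) a" for u by (simp add: M'.shape_op_eq[OF x])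
    \<comment> \<open>The images of a may have different lengths and opposite orientations; only the
      lines of \<open>t i x\<close> and \<open>t' i x\<close> matter for the great circles.\<close>
    moreover have "meet_equidistantly (X x) ((a $ i * b x $ i) *\<^sub>R t i x)
        (X' x) ((a $ i * b' x $ i) *\<^sub>R t' i x)"
      using i M.b_nz[OF x] M'.b_nz[OF x] M.tt[OF x] M'.tt[OF x] M.tX[OF x] M'.tX[OF x]
      by (intro meet_equidistantly_reflected[OF M.XX[OF x] M'.XX[OF x] _ _ _ _ X'[OF x] t'[OF x]])
        (auto simp: norm_eq_1 inner_commute)
    ultimately show ?thesis
      using M.derivative_axis[OF x, of "a $ i" i] M'.derivative_axis[OF x, of "a $ i" i] ai by metis
  qed
  have "diffeomorphism_on U U id"
    unfolding diffeomorphism_on_def id_def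
    using smooth_on_cong[OF M.open_U smooth_on_id[OF M.open_U]] smooth_on_id[OF M.open_U]
      inv_into_f_f[of "\<lambda>x. x" U]
    by (auto simp: bij_betw_def)
  then show ?thesis
    using M.immersion M'.immersion P bij push_field push_parallel meet_normal tangent
    by (simp add: ribaucour_transformation_def sphere_congruence_def normal_bundle_isomorphism_def)
qed

section \<open>The Lax connection as a wedge product\<close>

text \<open>Bilinear over the complex numbers too, without conjugation: this is the form preserved
  by frames with E E^t = I, and it admits nonzero isotropic vectors.\<close>

definition dotp :: "'c::semiring_0 ^ 'k::finite \<Rightarrow> 'c ^ 'k \<Rightarrow> 'c" where
  "dotp u v = (\<Sum>k\<in>UNIV. u $ k * v $ k)"

definition wedge :: "'c::comm_ring_1 ^ 'k \<Rightarrow> 'c ^ 'k \<Rightarrow> 'c ^ 'k ^ 'k" where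
  "wedge u v = outer u v - outer v u"

abbreviation tangent_axis :: "'n::finite \<Rightarrow> 'c::zero_neq_one ^ ('m::finite + 'n option)" where
  "tangent_axis i \<equiv> axis (Inr (Some i)) 1"

text \<open>Generic in the scalars, so that the same vector serves the complex Lax connection and
  its restriction to real parameters.\<close>

definition lax_vec ::
    "real ^ 'n ^ 'm \<Rightarrow> real ^ 'n ^ 'n \<Rightarrow> real ^ 'n \<Rightarrow> 'c::real_algebra_1 \<Rightarrow> 'n::finite \<Rightarrow>
     'c ^ ('m::finite + 'n option)" where
  "lax_vec A F b lam i = (\<chi> r. case r of
      Inl p \<Rightarrow> lam * of_real (A $ p $ i)
    | Inr (Some k) \<Rightarrow> of_real (F $ i $ k)
    | Inr None \<Rightarrow> of_real (b $ i))"

lemma lax_vec_nth [simp]: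
  "lax_vec A F b lam i $ Inl p = lam * of_real (A $ p $ i)"
  "lax_vec A F b lam i $ Inr (Some k) = of_real (F $ i $ k)"
  "lax_vec A F b lam i $ Inr None = of_real (b $ i)"
  by (simp_all add: lax_vec_def)

lemma sum_UNIV_Plus:
  fixes f :: "'m::finite + 'k::finite \<Rightarrow> 'b::comm_monoid_add"
  shows "(\<Sum>r\<in>UNIV. f r) = (\<Sum>p\<in>UNIV. f (Inl p)) + (\<Sum>q\<in>UNIV. f (Inr q))"
  using sum.Plus[of UNIV UNIV f] by (simp add: comp_def)

lemma sum_UNIV_Plus_option:
  fixes f :: "'m::finite + 'n::finite option \<Rightarrow> 'b::comm_monoid_add"
  shows "(\<Sum>r\<in>UNIV. f r) = (\<Sum>p\<in>UNIV. f (Inl p)) + (\<Sum>k\<in>UNIV. f (Inr (Some k))) + f (Inr None)"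
proof -
  have "(\<Sum>q\<in>UNIV. f (Inr q)) = (\<Sum>k\<in>UNIV. f (Inr (Some k))) + f (Inr None)"
    by (simp add: UNIV_option_conv sum.reindex add.commute)
  then show ?thesis by (simp add: sum_UNIV_Plus add.assoc)
qed

lemma all_Plus_option:
  "(\<forall>r. P (r :: 'm + 'n option)) \<longleftrightarrow> (\<forall>p. P (Inl p)) \<and> (\<forall>k. P (Inr (Some k))) \<and> P (Inr None)"
  by (metis option.exhaust sum.exhaust)

lemma elem_diag_simps:
  "(M ** elem_diag i) $ p $ q = (if q = i then M $ p $ i else 0)"
  "(elem_diag i ** N) $ p' $ q' = (if p' = i then N $ i $ q' else 0)"
  "(elem_diag i *v v) $ k = (if k = i then v $ i else 0)"
  "(v v* elem_diag i) $ k = (if k = i then v $ i else 0)"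
  by (auto simp: elem_diag_def matrix_matrix_mult_def matrix_vector_mult_def vector_matrix_mult_def
      mult_delta_left mult_delta_right)

text \<open>C_i retains only column i of A and row i of F, and the matrix is skew, so it is
  concentrated in one row and one column. The entry F_ii cancels, hence adding a multiple of
  \<epsilon>_i to the vector changes nothing.\<close>

lemma lax_G_I_wedge: "lax_G_I A F b lam i = wedge (tangent_axis i) (lax_vec A F b lam i)"
  by (simp add: vec_eq_iff all_Plus_option lax_G_I_def Let_def wedge_def outer_def axis_def elem_diag_simps
      transpose_def)

lemma outer_mult_vec: "outer u v *v x = dotp v x *s (u :: 'c::comm_ring_1 ^ 'k::finite)"
  by (simp add: vec_eq_iff outer_def matrix_vector_mult_def dotp_def sum_distrib_left ac_simps)

lemma wedge_mult_vec: "wedge u v *v x = dotp v x *s u - dotp u x *s (v :: 'c::comm_ring_1 ^ 'k::finite)"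
  by (simp add: wedge_def matrix_vector_mult_diff_rdistrib outer_mult_vec)

lemma transpose_wedge: "transpose (wedge u v) = wedge v u"
  by (simp add: vec_eq_iff wedge_def outer_def transpose_def)

lemma dotp_real: "dotp u v = u \<bullet> (v :: real ^ 'k::finite)"
  by (simp add: dotp_def inner_vec_def)

lemma dotp_axis: "dotp (axis i 1) x = (x $ i :: 'c::comm_ring_1)"
  by (simp add: dotp_def axis_def mult_delta_left)

lemma matrix_mult_outer: "M ** outer u v = outer (M *v u) (v :: real ^ 'k::finite)"
  by (simp add: vec_eq_iff outer_def matrix_vector_mult_def matrix_matrix_mult_def sum_distrib_right
      mult.assoc)

lemma outer_mult_matrix: "outer u v ** M = outer u (transpose M *v (v :: real ^ 'k::finite))"
  by (simp add: vec_eq_iff outer_def matrix_vector_mult_def matrix_matrix_mult_def sum_distrib_left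
      transpose_def ac_simps)

text \<open>The gauge transform of \<open>wedge \<epsilon> w\<close> by the reflection in \<open>n\<close>, in differentiated form.\<close>
lemma reflection_gauge:
  fixes n dn w \<epsilon> :: "real ^ 'k::finite"
  assumes dn: "dn = (n \<bullet> \<epsilon>) *\<^sub>R w - (w \<bullet> n) *\<^sub>R \<epsilon> + (\<sigma> * \<alpha>) *\<^sub>R \<epsilon>"
    and nn: "n \<bullet> n = \<sigma> * \<rho>" and nz: "\<sigma> \<noteq> 0" "\<rho> \<noteq> 0"
    and c: "c = 2 / (\<sigma> * \<rho>)" and dc: "dc = - c * (2 * (n \<bullet> \<epsilon>) * \<alpha> / \<rho>)"
    and R: "R = mat 1 - c *\<^sub>R outer n n"
  shows "- (c *\<^sub>R (outer n dn + outer dn n) + dc *\<^sub>R outer n n) =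
    R ** wedge \<epsilon> (w - (2 * \<alpha> / \<rho>) *\<^sub>R n) - wedge \<epsilon> w ** R"
proof -
  \<comment> \<open>The multiple of n to be subtracted from w. Since c = 2 / (\<sigma> \<rho>), the
    factor \<sigma> cancels and \<kappa> = 2 \<alpha> / \<rho>.\<close>
  define \<kappa> where "\<kappa> = c * \<sigma> * \<alpha>"
  have \<kappa>: "2 * \<alpha> / \<rho> = \<kappa>" using nz by (simp add: \<kappa>_def c)
  have dc': "dc = - c * (n \<bullet> \<epsilon>) * \<kappa>" by (simp add: dc mult.assoc flip: \<kappa>)
  have 2: "c * (n \<bullet> n) = 2" using nz by (simp add: c nn)
  have RW: "R ** wedge \<epsilon> v = wedge \<epsilon> v - c *\<^sub>R outer n ((n \<bullet> \<epsilon>) *\<^sub>R v - (n \<bullet> v) *\<^sub>R \<epsilon>)" for v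
  proof -
    have "R ** wedge \<epsilon> v = wedge \<epsilon> v - c *\<^sub>R (outer n n ** wedge \<epsilon> v)"
      by (simp add: R vec_eq_iff matrix_matrix_mult_def mat_def algebra_simps sum_subtractf
          sum_distrib_left mult_delta_left mult_delta_right)
    moreover have "outer n n ** wedge \<epsilon> v = outer n ((n \<bullet> \<epsilon>) *\<^sub>R v - (n \<bullet> v) *\<^sub>R \<epsilon>)"
      unfolding outer_mult_matrix transpose_wedge
      by (simp add: wedge_mult_vec dotp_real inner_commute scalar_mult_eq_scaleR)
    ultimately show ?thesis by simp
  qed
  have WR: "wedge \<epsilon> w ** R = wedge \<epsilon> w - c *\<^sub>R outer ((w \<bullet> n) *\<^sub>R \<epsilon> - (n \<bullet> \<epsilon>) *\<^sub>R w) n"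
  proof -
    have "wedge \<epsilon> w ** R = wedge \<epsilon> w - c *\<^sub>R (wedge \<epsilon> w ** outer n n)"
      by (simp add: R vec_eq_iff matrix_matrix_mult_def mat_def algebra_simps sum_subtractf
          sum_distrib_left mult_delta_left mult_delta_right)
    then show ?thesis
      by (simp add: matrix_mult_outer wedge_mult_vec dotp_real inner_commute scalar_mult_eq_scaleR)
  qed
  show ?thesis
  proof (intro vec_eq_iff[THEN iffD2] allI)
    fix r q
    define p m where "p = n \<bullet> \<epsilon>" and "m = w \<bullet> n"
    have nv: "n \<bullet> (w - \<kappa> *\<^sub>R n) = m - \<kappa> * (n \<bullet> n)"
      by (simp add: m_def inner_diff_right inner_commute)
    \<comment> \<open>The only relation needed beyond the definition of \<kappa>: with it each
      matrix entry of the claim is a polynomial identity.\<close>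
    have 3: "c * (\<kappa> * (n \<bullet> n)) = 2 * \<kappa>"
      unfolding mult.left_commute[of c] 2 by simp
    show "(- (c *\<^sub>R (outer n dn + outer dn n) + dc *\<^sub>R outer n n)) $ r $ q =
        (R ** wedge \<epsilon> (w - (2 * \<alpha> / \<rho>) *\<^sub>R n) - wedge \<epsilon> w ** R) $ r $ q"
      unfolding \<kappa> RW WR nv dc' dn p_def[symmetric] m_def[symmetric]
      using 3 \<kappa>_def by (simp add: wedge_def outer_def) algebra
  qed
qed

section \<open>Moving frames of the Lax connection\<close>

lemma bounded_bilinear_matrix_mult:
  "bounded_bilinear ((**) :: real ^ 'k::finite ^ 'l::finite \<Rightarrow> real ^ 'j::finite ^ 'k \<Rightarrow> _)"
  unfolding bilinear_conv_bounded_bilinear[symmetric] bilinear_def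
  by (auto intro!: linearI simp: matrix_add_ldistrib matrix_matrix_mult_def vec_eq_iff sum_distrib_left
      sum.distrib algebra_simps)

lemma bounded_bilinear_outer:
  "bounded_bilinear (outer :: real ^ 'k::finite \<Rightarrow> real ^ 'j::finite \<Rightarrow> _)"
  unfolding bilinear_conv_bounded_bilinear[symmetric] bilinear_def
  by (auto intro!: linearI simp: outer_def vec_eq_iff algebra_simps)

lemma bounded_linear_column: "bounded_linear (column c :: real ^ 'k::finite ^ 'j::finite \<Rightarrow> _)"
  unfolding linear_conv_bounded_linear[symmetric]
  by (auto intro!: linearI simp: column_def vec_eq_iff)

text \<open>Mixed second derivatives of E commute, and cancelling E leaves the curvature. Flatness
  of the new system thus comes from its explicit frame instead of a computation with the new
  coefficients.\<close>

lemma frame_curvature_zero: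
  fixes E :: "real ^ 'n::finite \<Rightarrow> real ^ 'k::finite ^ 'k" and L :: "'n \<Rightarrow> real ^ 'n \<Rightarrow> real ^ 'k ^ 'k"
  assumes U: "open U" and x: "x \<in> U" and E: "smooth_on U E" and L: "\<And>i. smooth_on U (L i)"
    and dE: "\<And>y i. y \<in> U \<Longrightarrow> pdv E i y = E y ** L i y" and inv: "E' ** E x = mat 1"
  shows "pdv (L k) i x - pdv (L i) k x + (L i x ** L k x - L k x ** L i x) = 0"
proof -
  have dd: "pdv (pdv E k) i x = E x ** (pdv (L k) i x + L i x ** L k x)" for i k
  proof -
    have "pdv (pdv E k) i x = pdv (\<lambda>y. E y ** L k y) i x" by (rule pdv_cong[OF U x dE])
    also have "\<dots> = E x ** pdv (L k) i x + pdv E i x ** L k x"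
      using smooth_on_differentiable[OF E x] smooth_on_differentiable[OF L x]
      by (rule pdv_bilinear[OF bounded_bilinear_matrix_mult])
    finally show ?thesis by (simp add: dE[OF x] matrix_add_ldistrib matrix_mul_assoc)
  qed
  have "E x ** (pdv (L k) i x + L i x ** L k x) = E x ** (pdv (L i) k x + L k x ** L i x)"
    using pdv_commute[OF U E x] by (simp flip: dd)
  then have "(E' ** E x) ** (pdv (L k) i x + L i x ** L k x) =
      (E' ** E x) ** (pdv (L i) k x + L k x ** L i x)"
    by (metis matrix_mul_assoc)
  then have "pdv (L k) i x + L i x ** L k x = pdv (L i) k x + L k x ** L i x" by (simp add: inv)
  then show ?thesis by (simp add: algebra_simps)
qed

lemma column_wedge: "column c (wedge u v) = v $ c *\<^sub>R u - u $ c *\<^sub>R (v :: real ^ 'k::finite)"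
  by (simp add: vec_eq_iff column_def wedge_def outer_def)

lemma column_mult: "column c (M ** N) = M *v column c N"
  by (simp add: vec_eq_iff column_def matrix_matrix_mult_def matrix_vector_mult_def)

text \<open>Column c of \<epsilon> \<and> w is w_c \<epsilon> - \<epsilon>_c w. So every column
  except the i-th tangent one moves along that tangent column alone, which encodes both parallelism
  of the normal frame and the curvature line condition.\<close>

lemma pdv_column_frame:
  fixes g :: "real ^ 'n::finite \<Rightarrow> real ^ ('m::finite + 'n option) ^ ('m + 'n option)"
  assumes x: "x \<in> U" and g: "smooth_on U g"
    and dg: "pdv g i x = g x ** wedge (tangent_axis i) (lax_vec A F b lam i)"
  shows "pdv (\<lambda>y. column c (g y)) i x =
    lax_vec A F b lam i $ c *\<^sub>R column (Inr (Some i)) (g x) -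
    (if c = Inr (Some i) then (\<Sum>p\<in>UNIV. (lam * A $ p $ i) *\<^sub>R column (Inl p) (g x)) +
       (\<Sum>k\<in>UNIV. F $ i $ k *\<^sub>R column (Inr (Some k)) (g x)) + b $ i *\<^sub>R column (Inr None) (g x) else 0)"
proof -
  have "pdv (\<lambda>y. column c (g y)) i x = column c (pdv g i x)"
    by (rule pdv_linear[OF bounded_linear_column smooth_on_differentiable[OF g x]])
  also have "\<dots> = lax_vec A F b lam i $ c *\<^sub>R (g x *v tangent_axis i) -
      (tangent_axis i :: real ^ ('m + 'n option)) $ c *\<^sub>R (g x *v lax_vec A F b lam i)"
    by (simp add: dg column_mult column_wedge matrix_vector_mult_diff_distrib matrix_vector_mult_scaleR)
  also have "g x *v tangent_axis i = column (Inr (Some i)) (g x)"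
    by (simp add: matrix_vector_mul_component vec_eq_iff column_def matrix_vector_mult_basis)
  also have "g x *v lax_vec A F b lam i = (\<Sum>p\<in>UNIV. (lam * A $ p $ i) *\<^sub>R column (Inl p) (g x)) +
       (\<Sum>k\<in>UNIV. F $ i $ k *\<^sub>R column (Inr (Some k)) (g x)) + b $ i *\<^sub>R column (Inr None) (g x)"
    by (simp add: matrix_mult_sum sum_UNIV_Plus_option scalar_mult_eq_scaleR)
  finally show ?thesis by (simp add: axis_def)
qed

lemma orthogonal_columns:
  fixes M :: "real ^ 'k::finite ^ 'k"
  assumes "orthogonal_matrix M"
  shows "column c M \<bullet> column d M = (if c = d then 1 else 0)"
proof -
  have "(transpose M ** M) $ c $ d = (if c = d then 1 else 0)"
    using assms by (simp add: orthogonal_matrix_def mat_def)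
  then show ?thesis
    by (simp add: matrix_matrix_mult_def transpose_def column_def inner_vec_def)
qed

lemma orthogonal_expansion:
  fixes M :: "real ^ 'k::finite ^ 'k"
  assumes "orthogonal_matrix M"
  shows "v = (\<Sum>c\<in>UNIV. (v \<bullet> column c M) *\<^sub>R column c M)"
proof -
  have comp: "(transpose M *v v) $ c = v \<bullet> column c M" for c
    by (simp add: matrix_vector_mult_def transpose_def column_def inner_vec_def mult.commute)
  have "v = M *v (transpose M *v v)"
    using assms unfolding matrix_vector_mul_assoc by (simp add: orthogonal_matrix_def)
  also have "\<dots> = (\<Sum>c\<in>UNIV. (transpose M *v v) $ c *\<^sub>R column c M)"
    by (simp only: matrix_mult_sum scalar_mult_eq_scaleR)
  finally show ?thesis unfolding comp .
qed

lemma adapted_frame_of_matrix: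
  fixes g :: "real ^ 'n::finite \<Rightarrow> real ^ ('m::finite + 'n option) ^ ('m + 'n option)"
  assumes U: "open U" and g: "smooth_on U g" and b: "smooth_on U b"
    and nz: "\<And>x i. x \<in> U \<Longrightarrow> b x $ i \<noteq> 0"
    and A: "\<And>x. x \<in> U \<Longrightarrow> transpose (A x) ** A x = mat 1"
    and F: "\<And>x i. x \<in> U \<Longrightarrow> F x $ i $ i = 0"
    and orth: "\<And>x. x \<in> U \<Longrightarrow> orthogonal_matrix (g x)"
    and dg: "\<And>x i. x \<in> U \<Longrightarrow>
      pdv g i x = g x ** wedge (tangent_axis i) (lax_vec (A x) (F x) (b x) 1 i)"
  shows "adapted_frame U (\<lambda>x. column (Inr None) (g x)) (\<lambda>j x. column (Inl j) (g x))
    (\<lambda>i x. column (Inr (Some i)) (g x)) A F b"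
proof
  have "smooth_on U (\<lambda>x. column c (g x))" for c
    by (rule smooth_on_linear[OF U bounded_linear_column g])
  then show "smooth_on U (\<lambda>x. column (Inr None) (g x))"
    "\<And>j. smooth_on U (\<lambda>x. column (Inl j) (g x))"
    "\<And>i. smooth_on U (\<lambda>x. column (Inr (Some i)) (g x))" by blast+
  fix x assume x: "x \<in> U"
  show "v = (\<Sum>j\<in>UNIV. (v \<bullet> column (Inl j) (g x)) *\<^sub>R column (Inl j) (g x)) +
      (\<Sum>i\<in>UNIV. (v \<bullet> column (Inr (Some i)) (g x)) *\<^sub>R column (Inr (Some i)) (g x)) +
      (v \<bullet> column (Inr None) (g x)) *\<^sub>R column (Inr None) (g x)" for v
    using orthogonal_expansion[OF orth[OF x], of v] by (simp add: sum_UNIV_Plus_option)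
qed (use U b nz A F orth in
  \<open>simp_all add: pdv_column_frame[OF _ g dg] orthogonal_columns cong: if_cong\<close>)

text \<open>The frame g belongs to parameter 0, while X comes from another parameter; only b is
  shared. At 0 the matrix splits into blocks, so the lower part of its last column is a map into the
  n-sphere with derivatives b_i times orthonormal vectors, hence with the first fundamental form of
  X.\<close>

lemma local_isometry_of_frame:
  fixes g :: "real ^ 'n::finite \<Rightarrow> real ^ ('m::finite + 'n option) ^ ('m + 'n option)"
    and X :: "real ^ 'n \<Rightarrow> 'a::euclidean_space"
  assumes X: "sphere_immersion U X" and g: "smooth_on U g"
    and orth: "\<And>x. x \<in> U \<Longrightarrow> orthogonal_matrix (g x)"
    and block: "\<And>x p r. x \<in> U \<Longrightarrow> g x $ Inl p $ Inr r = 0"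
    and dg: "\<And>x i. x \<in> U \<Longrightarrow>
      pdv g i x = g x ** wedge (tangent_axis i) (lax_vec (A x) (F x) (b x) 0 i)"
    and ff: "\<And>x i k. x \<in> U \<Longrightarrow> first_ff X x $ i $ k = (if i = k then (b x $ i)\<^sup>2 else 0)"
  shows "local_isometric_immersion_of_sphere U X"
proof -
  define lower :: "real ^ ('m + 'n option) \<Rightarrow> real ^ 'n option" where "lower v = (\<chi> r. v $ Inr r)" for v
  have lin: "bounded_linear lower"
    unfolding linear_conv_bounded_linear[symmetric] by (auto intro!: linearI simp: lower_def vec_eq_iff)
  have U: "open U" using X by (simp add: sphere_immersion_def)
  define \<phi> where "\<phi> x = lower (column (Inr None) (g x))" for x
  have col: "smooth_on U (\<lambda>x. column c (g x))" for c
    by (rule smooth_on_linear[OF U bounded_linear_column g])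
  have smooth: "smooth_on U \<phi>" unfolding \<phi>_def by (rule smooth_on_linear[OF U lin col])
  have lower_ip: "lower (column (Inr r) (g x)) \<bullet> lower (column (Inr q) (g x)) = (if r = q then 1 else 0)"
    if "x \<in> U" for x r q
  proof -
    have "column (Inr r) (g x) \<bullet> column (Inr q) (g x) =
        lower (column (Inr r) (g x)) \<bullet> lower (column (Inr q) (g x))"
      using block[OF that]
      by (simp add: inner_vec_def lower_def column_def sum_UNIV_Plus_option UNIV_option_conv sum.reindex)
    then show ?thesis using orthogonal_columns[OF orth[OF that]] by simp
  qed
  have d\<phi>: "pdv \<phi> i x = b x $ i *\<^sub>R lower (column (Inr (Some i)) (g x))" if x: "x \<in> U" for x i
  proof -
    have "pdv \<phi> i x = lower (pdv (\<lambda>x. column (Inr None) (g x)) i x)"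
      unfolding \<phi>_def by (rule pdv_linear[OF lin smooth_on_differentiable[OF col x]])
    then show ?thesis
      using linear_cmul[OF bounded_linear.linear[OF lin]] by (simp add: pdv_column_frame[OF x g dg[OF x]])
  qed
  have "norm (\<phi> x) = 1 \<and> first_ff \<phi> x = first_ff X x" if "x \<in> U" for x
    using that lower_ip[OF that, of None None]
    by (simp add: norm_eq_1 \<phi>_def[symmetric] vec_eq_iff ff)
      (simp add: first_ff_def d\<phi> lower_ip power2_eq_square)
  then show ?thesis
    using X U smooth unfolding local_isometric_immersion_of_sphere_def by blast
qed

section \<open>Reflections of frames\<close>

text \<open>For v = 0 division by zero makes this the identity, so orthogonality holds for every
  v.\<close>

definition reflection :: "real ^ 'k \<Rightarrow> real ^ 'k ^ 'k::finite" where
  "reflection v = mat 1 - (2 / (v \<bullet> v)) *\<^sub>R outer v v"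

lemma orthogonal_matrix_reflection: "orthogonal_matrix (reflection v)"
proof -
  have t: "transpose (reflection v) = reflection v"
    by (simp add: reflection_def vec_eq_iff transpose_def mat_def outer_def mult.commute)
  have "outer v v ** reflection v = - outer v v"
  proof (cases "v = 0")
    case False
    have "outer v v ** outer v v = (v \<bullet> v) *\<^sub>R outer v v"
      by (simp add: matrix_mult_outer outer_mult_vec dotp_real scalar_mult_eq_scaleR)
        (simp add: outer_def vec_eq_iff)
    moreover have "outer v v ** reflection v = outer v v - (2 / (v \<bullet> v)) *\<^sub>R (outer v v ** outer v v)"
      unfolding reflection_def
      by (simp add: vec_eq_iff matrix_matrix_mult_def mat_def algebra_simps sum_subtractf
          sum_distrib_left mult_delta_left mult_delta_right)
    ultimately show ?thesis using False by (simp add: scaleR_2)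
  qed (simp add: vec_eq_iff outer_def matrix_matrix_mult_def)
  moreover have "reflection v ** reflection v =
      reflection v - (2 / (v \<bullet> v)) *\<^sub>R (outer v v ** reflection v)"
    by (subst (1) reflection_def)
      (simp add: vec_eq_iff matrix_matrix_mult_def mat_def algebra_simps sum_subtractf
        sum_distrib_left mult_delta_left mult_delta_right)
  ultimately have "reflection v ** reflection v = mat 1" by (simp add: reflection_def)
  then show ?thesis by (simp add: orthogonal_matrix_def t)
qed

lemma column_mult_reflection:
  "column c (M ** reflection v) = column c M - (2 / (v \<bullet> v) * v $ c) *\<^sub>R (M *v v)"
proof -
  have "column c (reflection v) = axis c 1 - (2 / (v \<bullet> v) * v $ c) *\<^sub>R v"
    by (auto simp: reflection_def column_def outer_def mat_def axis_def vec_eq_iff)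
  then show ?thesis
    by (simp add: column_mult matrix_vector_mult_diff_distrib matrix_vector_mult_scaleR
        matrix_vector_mult_basis)
qed

lemma smooth_on_reflection:
  assumes "open U" "smooth_on U v" "\<And>x. x \<in> U \<Longrightarrow> v x \<bullet> v x \<noteq> 0"
  shows "smooth_on U (\<lambda>x. reflection (v x))"
  unfolding reflection_def using assms
  by (intro smooth_on_diff smooth_on_const smooth_on_scaleR smooth_on_divide smooth_on_inner
      smooth_on_bilinear[OF _ bounded_bilinear_outer])

text \<open>The same \<sigma> occurs in \<open>dv\<close> and \<open>vv\<close>. It will be \<mu>^2
  + s^2, whereas \<alpha> and \<rho> are free of \<mu>, so the coefficient 2 \<alpha> / \<rho> of v
  is common to all parameters.\<close>

lemma pdv_reflected_frame:
  assumes U: "open U" and x: "x \<in> U" and g: "smooth_on U g" and v: "smooth_on U v"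
    and nz: "\<And>y. y \<in> U \<Longrightarrow> v y \<bullet> v y \<noteq> 0"
    and dg: "pdv g i x = g x ** wedge \<epsilon> w"
    and dv: "pdv v i x = (v x \<bullet> \<epsilon>) *\<^sub>R w - (w \<bullet> v x) *\<^sub>R \<epsilon> + (\<sigma> * \<alpha>) *\<^sub>R \<epsilon>"
    and vv: "v x \<bullet> v x = \<sigma> * \<rho>"
  shows "pdv (\<lambda>y. g y ** reflection (v y)) i x =
    (g x ** reflection (v x)) ** wedge \<epsilon> (w - (2 * \<alpha> / \<rho>) *\<^sub>R v x)"
proof -
  have nz': "\<sigma> \<noteq> 0" "\<rho> \<noteq> 0" using nz[OF x] vv by auto
  note d = smooth_on_differentiable[OF _ x]
  let ?c = "\<lambda>y. 2 / (v y \<bullet> v y)" and ?o = "\<lambda>y. outer (v y) (v y)"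
  have so: "smooth_on U ?o" by (rule smooth_on_bilinear[OF U bounded_bilinear_outer v v])
  have si: "smooth_on U (\<lambda>y. v y \<bullet> v y)" by (rule smooth_on_inner[OF U v v])
  have sc: "smooth_on U ?c" by (rule smooth_on_divide[OF U smooth_on_const si nz])
  \<comment> \<open>The first two terms of \<open>dv\<close> form a skew map applied to v and do not
    change v \<bullet> v; only the term in \<sigma> contributes.\<close>
  have di: "pdv (\<lambda>y. v y \<bullet> v y) i x = 2 * (\<sigma> * \<alpha> * (v x \<bullet> \<epsilon>))"
    unfolding pdv_bilinear[OF bounded_bilinear_inner d[OF v] d[OF v]] dv
    by (simp add: inner_add_left inner_add_right inner_diff_left inner_diff_right inner_commute
        algebra_simps)
  have "pdv ?c i x = 2 * pdv (\<lambda>y. inverse (v y \<bullet> v y)) i x"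
    unfolding divide_inverse
    by (rule pdv_linear[OF bounded_linear_mult_right])
      (use d[OF si] nz[OF x] in \<open>rule differentiable_inverse\<close>)
  also have "\<dots> = - ?c x * (2 * (v x \<bullet> \<epsilon>) * \<alpha> / \<rho>)"
    unfolding pdv_inverse[OF d[OF si] nz[OF x]] di using nz' by (simp add: vv field_simps)
  finally have dc: "pdv ?c i x = - ?c x * (2 * (v x \<bullet> \<epsilon>) * \<alpha> / \<rho>)" .
  have "pdv (\<lambda>y. reflection (v y)) i x = - pdv (\<lambda>y. ?c y *\<^sub>R ?o y) i x"
  proof -
    have "pdv (\<lambda>y. reflection (v y)) i x = pdv (\<lambda>y. mat 1 + - (?c y *\<^sub>R ?o y)) i x"
      by (simp add: reflection_def)
    also have "\<dots> = pdv (\<lambda>y. mat 1) i x + pdv (\<lambda>y. - (?c y *\<^sub>R ?o y)) i x"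
      by (rule pdv_add[OF d[OF smooth_on_const] d[OF smooth_on_minus[OF U smooth_on_scaleR[OF U sc so]]]])
    also have "pdv (\<lambda>y. - (?c y *\<^sub>R ?o y)) i x = - pdv (\<lambda>y. ?c y *\<^sub>R ?o y) i x"
      by (rule pdv_linear[OF bounded_linear_minus[OF bounded_linear_ident] d[OF smooth_on_scaleR[OF U sc so]]])
    finally show ?thesis by simp
  qed
  also have "\<dots> = - (?c x *\<^sub>R (outer (v x) (pdv v i x) + outer (pdv v i x) (v x)) + pdv ?c i x *\<^sub>R ?o x)"
    unfolding pdv_bilinear[OF bounded_bilinear_scaleR d[OF sc] d[OF so]]
      pdv_bilinear[OF bounded_bilinear_outer d[OF v] d[OF v]] by simp
  also have "\<dots> = reflection (v x) ** wedge \<epsilon> (w - (2 * \<alpha> / \<rho>) *\<^sub>R v x) - wedge \<epsilon> w ** reflection (v x)"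
    by (rule reflection_gauge[OF dv vv nz' _ dc]) (simp_all add: vv reflection_def)
  finally have dR: "pdv (\<lambda>y. reflection (v y)) i x = \<dots>" .
  have "pdv (\<lambda>y. g y ** reflection (v y)) i x =
      g x ** pdv (\<lambda>y. reflection (v y)) i x + pdv g i x ** reflection (v x)"
    by (rule pdv_bilinear[OF bounded_bilinear_matrix_mult d[OF g] d[OF smooth_on_reflection[OF U v nz]]])
  also have "\<dots> = g x ** (pdv (\<lambda>y. reflection (v y)) i x + wedge \<epsilon> w ** reflection (v x))"
    by (simp add: dg matrix_add_ldistrib matrix_mul_assoc)
  finally show ?thesis by (simp add: dR matrix_mul_assoc)
qed

section \<open>Flatness for all spectral parameters\<close>

lemma smooth_on_vecI:
  fixes f :: "real ^ 'n::finite \<Rightarrow> 'b::euclidean_space ^ 'k::finite"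
  assumes "open U" "\<And>r. smooth_on U (\<lambda>x. f x $ r)"
  shows "smooth_on U f"
proof -
  have lin: "bounded_linear (axis r :: 'b \<Rightarrow> 'b ^ 'k)" for r
    unfolding linear_conv_bounded_linear[symmetric]
    by (auto intro!: linearI simp: axis_def vec_eq_iff)
  have "smooth_on U (\<lambda>x. \<Sum>r\<in>UNIV. axis r (f x $ r))"
    by (rule smooth_on_sum[OF assms(1) smooth_on_linear[OF assms(1) lin assms(2)]])
  moreover have "(\<Sum>r\<in>UNIV. axis r (f x $ r)) = f x" for x
    by (simp add: vec_eq_iff axis_def if_distrib cong: if_cong)
  ultimately show ?thesis by simp
qed

lemma smooth_on_nth: "open U \<Longrightarrow> smooth_on U f \<Longrightarrow> smooth_on U (\<lambda>x. f x $ r)"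
  by (rule smooth_on_linear[OF _ bounded_linear_vec_nth])

lemma smooth_on_lax_vec:
  fixes lam :: real
  assumes U: "open U" and "smooth_on U A" "smooth_on U F" "smooth_on U b"
  shows "smooth_on U (\<lambda>x. lax_vec (A x) (F x) (b x) lam i)"
proof -
  have "\<forall>r. smooth_on U (\<lambda>x. lax_vec (A x) (F x) (b x) lam i $ r)"
    unfolding all_Plus_option using assms
    by (auto intro!: smooth_on_mult smooth_on_const smooth_on_nth)
  then show ?thesis by (intro smooth_on_vecI[OF U]) simp
qed

lemma smooth_on_wedge: "open U \<Longrightarrow> smooth_on U v \<Longrightarrow> smooth_on U (\<lambda>x. wedge (u :: real ^ 'k::finite) (v x))"
  unfolding wedge_def
  by (intro smooth_on_diff smooth_on_bilinear[OF _ bounded_bilinear_outer] smooth_on_const)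

text \<open>The curvature is a quadratic polynomial in the spectral parameter, so three real parameters
  suffice.\<close>
lemma flat_connection_lax_G_I:
  fixes A :: "real ^ 'n::finite \<Rightarrow> real ^ 'n ^ 'm::finite"
    and F :: "real ^ 'n \<Rightarrow> real ^ 'n ^ 'n" and b :: "real ^ 'n \<Rightarrow> real ^ 'n"
  defines "L \<equiv> \<lambda>\<mu> i x. wedge (tangent_axis i) (lax_vec (A x) (F x) (b x) (\<mu> :: real) i)"
  assumes U: "open U" and sA: "smooth_on U A" and sF: "smooth_on U F" and sb: "smooth_on U b"
    and flat: "\<And>\<mu> i k x. x \<in> U \<Longrightarrow>
      pdv (L \<mu> k) i x - pdv (L \<mu> i) k x + (L \<mu> i x ** L \<mu> k x - L \<mu> k x ** L \<mu> i x) = 0"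
  shows "flat_connection U (\<lambda>x. lax_G_I (A x) (F x) (b x) lam)"
  unfolding flat_connection_def
proof (intro ballI allI)
  fix x i k assume x: "x \<in> U"
  define M where "M i x = L 0 i x" for i x
  \<comment> \<open>The part linear in \<mu>: only the block of A carries the parameter, so F and b
    are set to 0.\<close>
  define N :: "'n \<Rightarrow> real ^ 'n \<Rightarrow> real ^ ('m + 'n option) ^ ('m + 'n option)"
    where "N i x = wedge (tangent_axis i) (lax_vec (A x) 0 0 1 i)" for i x
  have sM: "smooth_on U (M i)" for i
    unfolding M_def L_def by (rule smooth_on_wedge[OF U smooth_on_lax_vec[OF U sA sF sb]])
  have sN: "smooth_on U (N i)" for i
    unfolding N_def
    by (rule smooth_on_wedge[OF U smooth_on_lax_vec[OF U sA smooth_on_const smooth_on_const]])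
  note d = smooth_on_differentiable[OF _ x]
  have L: "L \<mu> i = (\<lambda>y. M i y + \<mu> *\<^sub>R N i y)" for \<mu> i
    by (simp add: fun_eq_iff L_def M_def N_def vec_eq_iff all_Plus_option wedge_def outer_def axis_def)
  have dL: "pdv (L \<mu> i) k x = pdv (M i) k x + \<mu> *\<^sub>R pdv (N i) k x" for \<mu> i k
    unfolding L
    by (subst pdv_add[OF d[OF sM] d[OF smooth_on_linear[OF U bounded_linear_scaleR_right sN]]])
      (simp add: pdv_linear[OF bounded_linear_scaleR_right d[OF sN]])
  \<comment> \<open>Complexification followed by multiplication with lam; it is real linear and so
    commutes with \<open>pdv\<close>, which lets the complex curvature be expressed by the same real
    coefficients Q0, Q1, Q2.\<close>
  define h :: "real ^ ('m + 'n option) ^ ('m + 'n option) \<Rightarrow> complex ^ ('m + 'n option) ^ ('m + 'n option)"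
    where "h T = (\<chi> r c. lam * of_real (T $ r $ c))" for T
  have bc: "bounded_linear (cmat :: real ^ ('m + 'n option) ^ ('m + 'n option) \<Rightarrow> _)"
    unfolding linear_conv_bounded_linear[symmetric]
    by (auto intro!: linearI simp: map_matrix_def vec_eq_iff scaleR_conv_of_real[where 'a = complex])
  have bh: "bounded_linear h"
    unfolding linear_conv_bounded_linear[symmetric]
    by (auto intro!: linearI simp: h_def vec_eq_iff algebra_simps scaleR_conv_of_real[where 'a = complex])
  have C: "(\<lambda>y. lax_G_I (A y) (F y) (b y) lam i) = (\<lambda>y. cmat (M i y) + h (N i y))" for i
    by (simp add: lax_G_I_wedge fun_eq_iff L_def M_def N_def h_def vec_eq_iff all_Plus_option wedge_def
        outer_def axis_def map_matrix_def)
  have Cx: "lax_G_I (A x) (F x) (b x) lam i = cmat (M i x) + h (N i x)" for i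
    using C[of i] by (rule fun_cong)
  have dC: "pdv (\<lambda>y. lax_G_I (A y) (F y) (b y) lam i) k x = cmat (pdv (M i) k x) + h (pdv (N i) k x)" for i k
    unfolding C
    by (subst pdv_add[OF d[OF smooth_on_linear[OF U bc sM]] d[OF smooth_on_linear[OF U bh sN]]])
      (simp add: pdv_linear[OF bc d[OF sM]] pdv_linear[OF bh d[OF sN]])
  define Q0 where "Q0 = pdv (M k) i x - pdv (M i) k x + (M i x ** M k x - M k x ** M i x)"
  define Q1 where "Q1 = pdv (N k) i x - pdv (N i) k x +
    (M i x ** N k x + N i x ** M k x - M k x ** N i x - N k x ** M i x)"
  define Q2 where "Q2 = N i x ** N k x - N k x ** N i x"
  have Q: "Q0 + \<mu> *\<^sub>R Q1 + \<mu>\<^sup>2 *\<^sub>R Q2 = 0" for \<mu>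
    using flat[OF x, of \<mu> k i] unfolding dL unfolding L
    by (simp add: Q0_def Q1_def Q2_def vec_eq_iff matrix_matrix_mult_def algebra_simps sum.distrib
        sum_distrib_left power2_eq_square)
  have "Q0 = 0" using Q[of 0] by simp
  moreover have "Q1 = 0" "Q2 = 0"
    using Q[of 1] Q[of "-1"] \<open>Q0 = 0\<close> by (simp_all add: vec_eq_iff)
  moreover have "pdv (\<lambda>y. lax_G_I (A y) (F y) (b y) lam k) i x - pdv (\<lambda>y. lax_G_I (A y) (F y) (b y) lam i) k x +
      (lax_G_I (A x) (F x) (b x) lam i ** lax_G_I (A x) (F x) (b x) lam k -
       lax_G_I (A x) (F x) (b x) lam k ** lax_G_I (A x) (F x) (b x) lam i) =
      (\<chi> r c. of_real (Q0 $ r $ c) + lam * of_real (Q1 $ r $ c) + lam\<^sup>2 * of_real (Q2 $ r $ c))"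
    unfolding dC Cx
    by (simp add: Q0_def Q1_def Q2_def h_def map_matrix_def vec_eq_iff matrix_matrix_mult_def algebra_simps
        sum.distrib sum_distrib_left power2_eq_square)
  ultimately show "pdv (\<lambda>y. lax_G_I (A y) (F y) (b y) lam k) i x - pdv (\<lambda>y. lax_G_I (A y) (F y) (b y) lam i) k x +
      (lax_G_I (A x) (F x) (b x) lam i ** lax_G_I (A x) (F x) (b x) lam k -
       lax_G_I (A x) (F x) (b x) lam k ** lax_G_I (A x) (F x) (b x) lam i) = 0"
    by (simp add: vec_eq_iff)
qed

section \<open>Real frames and the dressing vector\<close>

lemma cmat_mult: "cmat (M ** N) = cmat M ** cmat N"
  by (simp add: map_matrix_def vec_eq_iff matrix_matrix_mult_def)

lemma cmat_eq_iff: "cmat M = cmat N \<longleftrightarrow> M = N"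
  by (simp add: map_matrix_def vec_eq_iff)

lemma matrix_inv_mult:
  fixes M :: "'a::semiring_1 ^ 'k::finite ^ 'k"
  assumes "invertible M"
  shows "M ** matrix_inv M = mat 1" "matrix_inv M ** M = mat 1"
  using assms matrix_inv_eqI unfolding invertible_def by metis+

lemma dotp_transpose: "dotp (M *v u) v = dotp u (transpose M *v (v :: 'c::comm_ring_1 ^ 'k::finite))"
  unfolding dotp_def matrix_vector_mult_def transpose_def
  by (simp add: sum_distrib_left sum_distrib_right) (subst sum.swap, simp add: ac_simps)

lemma join_vec_nth [simp]: "join_vec u v $ Inl p = u $ p" "join_vec u v $ Inr q = v $ q"
  by (simp_all add: join_vec_def)

lemma dotp_join_vec: "dotp (join_vec u v) (join_vec u' v') = dotp u u' + dotp v v'"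
  by (simp add: dotp_def sum_UNIV_Plus)

lemma dotp_cvec: "dotp (cvec u) (cvec v) = of_real (u \<bullet> v)"
  by (simp add: dotp_def cvec_def inner_vec_def)

lemma dotp_cvec_i: "dotp (\<i> *s cvec u) (\<i> *s cvec v) = - of_real (u \<bullet> v)"
proof -
  have "\<i> * of_real a * (\<i> * of_real c) = - of_real (a * c)" for a c
    by (simp add: complex_eq_iff)
  then show ?thesis by (simp add: dotp_def cvec_def inner_vec_def sum_negf)
qed

definition real_frame ::
    "(real ^ 'n \<Rightarrow> complex \<Rightarrow> complex ^ 'k ^ 'k) \<Rightarrow> real \<Rightarrow> real ^ 'n \<Rightarrow> real ^ 'k ^ 'k" where
  "real_frame E \<mu> x = map_matrix Re (E x (of_real \<mu>))"

lemma lax_G_I_of_real: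
  "lax_G_I A F b (of_real \<mu>) i = cmat (wedge (tangent_axis i) (lax_vec A F b \<mu> i))"
  by (simp add: lax_G_I_wedge vec_eq_iff all_Plus_option wedge_def outer_def axis_def map_matrix_def)

lemma frame_derivative:
  assumes "frame_G_I U A F b E" "x \<in> U"
  shows "pdv (\<lambda>y. E y lam) i x = E x lam ** lax_G_I (A x) (F x) (b x) lam i"
proof -
  have "invertible (E x lam)" "matrix_inv (E x lam) ** pdv (\<lambda>y. E y lam) i x = lax_G_I (A x) (F x) (b x) lam i"
    using assms by (auto simp: frame_G_I_def lax_frame_def)
  then show ?thesis by (metis matrix_inv_mult(1) matrix_mul_assoc matrix_mul_lid)
qed

lemma frame_transpose:
  assumes "frame_G_I U A F b E" "x \<in> U"
  shows "E x lam ** transpose (E x lam) = mat 1" "transpose (E x lam) ** E x lam = mat 1"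
proof -
  show "E x lam ** transpose (E x lam) = mat 1"
    using assms by (auto simp: frame_G_I_def lax_frame_def reality_condition_def)
  then show "transpose (E x lam) ** E x lam = mat 1" by (simp add: matrix_left_right_inverse)
qed

text \<open>Each clause of the reality condition has its own use: conjugation makes the frame real
  at real parameters, E E^t = I makes it orthogonal, and the sign symmetry, at the fixed point 0 of
  lam \<mapsto> - lam, makes it block diagonal.\<close>

lemma real_frame:
  fixes A :: "real ^ 'n::finite \<Rightarrow> real ^ 'n ^ 'm::finite"
  assumes U: "open U" and fr: "frame_G_I U A F b E"
  shows cmat_real_frame: "\<And>x. x \<in> U \<Longrightarrow> E x (of_real \<mu>) = cmat (real_frame E \<mu> x)"
    and smooth_on_real_frame: "smooth_on U (real_frame E \<mu>)"
    and orthogonal_real_frame: "\<And>x. x \<in> U \<Longrightarrow> orthogonal_matrix (real_frame E \<mu> x)"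
    and pdv_real_frame: "\<And>x i. x \<in> U \<Longrightarrow> pdv (real_frame E \<mu>) i x =
      real_frame E \<mu> x ** wedge (tangent_axis i) (lax_vec (A x) (F x) (b x) \<mu> i)"
    and real_frame_block: "\<And>x p r. x \<in> U \<Longrightarrow> real_frame E 0 x $ Inl p $ Inr r = 0"
proof -
  have real: "map_matrix cnj (E x (cnj lam)) = E x lam"
    and sign: "sign_mat ** E x lam ** matrix_inv sign_mat = E x (- lam)" if "x \<in> U" for x lam
    using fr that by (auto simp: frame_G_I_def lax_frame_def reality_condition_def)
  have smooth: "smooth_on U (\<lambda>x. E x lam)" for lam using fr by (simp add: frame_G_I_def lax_frame_def)
  have lin: "bounded_linear (map_matrix Re :: complex ^ ('m + 'n option) ^ ('m + 'n option) \<Rightarrow> _)"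
    unfolding linear_conv_bounded_linear[symmetric]
    by (auto intro!: linearI simp: map_matrix_def vec_eq_iff)
  show cm: "E x (of_real \<mu>) = cmat (real_frame E \<mu> x)" if "x \<in> U" for x \<mu>
  proof -
    have "cnj (E x (of_real \<mu>) $ r $ c) = E x (of_real \<mu>) $ r $ c" for r c
      using arg_cong[OF real[OF that, of "of_real \<mu>"], of "\<lambda>M. M $ r $ c"] by (simp add: map_matrix_def)
    then have "of_real (Re (E x (of_real \<mu>) $ r $ c)) = E x (of_real \<mu>) $ r $ c" for r c
      by (simp add: complex_eq_iff)
    then show ?thesis by (simp add: real_frame_def map_matrix_def vec_eq_iff)
  qed
  show "smooth_on U (real_frame E \<mu>)"
    unfolding real_frame_def[abs_def] by (rule smooth_on_linear[OF U lin smooth])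
  fix x assume x: "x \<in> U"
  have "cmat (real_frame E \<mu> x ** transpose (real_frame E \<mu> x)) = cmat (mat 1)"
    using frame_transpose(1)[OF fr x, of "of_real \<mu>"] unfolding cm[OF x] cmat_mult
    by (simp add: map_matrix_def transpose_def mat_def vec_eq_iff)
  then have "real_frame E \<mu> x ** transpose (real_frame E \<mu> x) = mat 1" by (simp only: cmat_eq_iff)
  then show "orthogonal_matrix (real_frame E \<mu> x)"
    unfolding orthogonal_matrix_def using matrix_left_right_inverse by blast
  show "pdv (real_frame E \<mu>) i x =
      real_frame E \<mu> x ** wedge (tangent_axis i) (lax_vec (A x) (F x) (b x) \<mu> i)" for i
  proof -
    have "pdv (real_frame E \<mu>) i x = map_matrix Re (pdv (\<lambda>y. E y (of_real \<mu>)) i x)"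
      unfolding real_frame_def[abs_def]
      by (rule pdv_linear[OF lin smooth_on_differentiable[OF smooth x]])
    also have "\<dots> = map_matrix Re (cmat (real_frame E \<mu> x **
        wedge (tangent_axis i) (lax_vec (A x) (F x) (b x) \<mu> i)))"
      by (simp only: frame_derivative[OF fr x] lax_G_I_of_real cm[OF x] cmat_mult)
    finally show ?thesis by (simp add: map_matrix_def vec_eq_iff)
  qed
  show "real_frame E 0 x $ Inl p $ Inr r = 0" for p r
  proof -
    let ?S = "sign_mat :: complex ^ ('m + 'n option) ^ ('m + 'n option)"
    have SS: "?S ** ?S = mat 1"
      by (auto simp: sign_mat_def matrix_matrix_mult_def mat_def vec_eq_iff mult_delta_left split: sum.splits)
    have "?S ** E x 0 ** ?S = E x 0" using sign[OF x, of 0] by (simp add: matrix_inv_eqI[OF SS SS])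
    moreover have "(?S ** E x 0 ** ?S) $ Inl p $ Inr r = - (E x 0 $ Inl p $ Inr r)"
      by (simp add: sign_mat_def matrix_matrix_mult_def mult_delta_left mult_delta_right)
    ultimately show ?thesis by (simp add: real_frame_def map_matrix_def)
  qed
qed

text \<open>For \<open>u = (Y, \<i>Z)\<close> with \<open>E u\<close> constant at \<open>lam = - \<i> s\<close>, the vector
  \<open>(\<mu> Y, s Z)\<close> is the one in which the frame at \<open>lam = \<mu>\<close> gets reflected.\<close>
lemma dressing_vector:
  fixes A :: "real ^ 'n::finite \<Rightarrow> real ^ 'n ^ 'm::finite"
  assumes U: "open U" and fr: "frame_G_I U A F b E"
    and EYZ: "\<And>x. x \<in> U \<Longrightarrow> E x (- \<i> * of_real s) *v join_vec (cvec (Y x)) (\<i> *s cvec (Z x)) = w0"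
  shows "smooth_on U Y" "smooth_on U Z"
    and "\<And>x i. x \<in> U \<Longrightarrow> pdv (\<lambda>x. join_vec (\<mu> *\<^sub>R Y x) (s *\<^sub>R Z x)) i x =
      (let v = join_vec (\<mu> *\<^sub>R Y x) (s *\<^sub>R Z x); w = lax_vec (A x) (F x) (b x) \<mu> i in
       (v \<bullet> tangent_axis i) *\<^sub>R w - (w \<bullet> v) *\<^sub>R tangent_axis i +
       ((\<mu>\<^sup>2 + s\<^sup>2) * (column i (A x) \<bullet> Y x)) *\<^sub>R tangent_axis i)"
proof -
  define lam where "lam = - \<i> * of_real s"
  define u where "u x = join_vec (cvec (Y x)) (\<i> *s cvec (Z x))" for x
  have lin: "bounded_linear (\<lambda>M :: complex ^ ('m + 'n option) ^ ('m + 'n option). transpose M *v w0)"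
    unfolding linear_conv_bounded_linear[symmetric]
    by (auto intro!: linearI simp: transpose_def matrix_vector_mult_def vec_eq_iff algebra_simps
        sum.distrib scaleR_sum_right)
  have smooth: "smooth_on U (\<lambda>x. E x lam)" using fr by (simp add: frame_G_I_def lax_frame_def)
  \<comment> \<open>The transpose of E is its inverse, so u depends linearly on E; smoothness and
    the derivative of u follow from those of the frame.\<close>
  have u: "transpose (E x lam) *v w0 = u x" if "x \<in> U" for x
    unfolding EYZ[OF that, folded lam_def u_def, symmetric]
    by (simp add: matrix_vector_mul_assoc frame_transpose(2)[OF fr that])
  have su: "smooth_on U u"
    by (rule smooth_on_cong[OF U smooth_on_linear[OF U lin smooth] u])
  have du: "pdv u i x = u x $ Inr (Some i) *s lax_vec (A x) (F x) (b x) lam i -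
      dotp (lax_vec (A x) (F x) (b x) lam i) (u x) *s tangent_axis i" if x: "x \<in> U" for x i
  proof -
    have "pdv u i x = pdv (\<lambda>x. transpose (E x lam) *v w0) i x"
      by (rule pdv_cong[OF U x u[symmetric]])
    also have "\<dots> = transpose (pdv (\<lambda>x. E x lam) i x) *v w0"
      by (rule pdv_linear[OF lin smooth_on_differentiable[OF smooth x]])
    also have "\<dots> = transpose (lax_G_I (A x) (F x) (b x) lam i) *v u x"
      by (simp only: frame_derivative[OF fr x] matrix_transpose_mul u[OF x, symmetric]
          matrix_vector_mul_assoc)
    also have "\<dots> = wedge (lax_vec (A x) (F x) (b x) lam i) (tangent_axis i) *v u x"
      by (simp only: lax_G_I_wedge transpose_wedge)
    finally show ?thesis by (simp add: wedge_mult_vec dotp_axis)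
  qed
  \<comment> \<open>Real part above, imaginary part below, rescaled. With a = c = 1 it recovers Y
    and Z, with a = \<mu> and c = s it sends u to the reflection vector.\<close>
  define h where "h a c v = (join_vec (\<chi> p. a * Re (v $ Inl p)) (\<chi> q. c * Im (v $ Inr q)) ::
    real ^ ('m + 'n option))" for a c and v :: "complex ^ ('m + 'n option)"
  have lh: "bounded_linear (h a c)" for a c
    unfolding linear_conv_bounded_linear[symmetric]
    by (auto intro!: linearI simp: h_def vec_eq_iff all_Plus_option algebra_simps)
  have hu: "h a c (u x) = join_vec (a *\<^sub>R Y x) (c *\<^sub>R Z x)" for a c x
    by (simp add: h_def u_def vec_eq_iff all_Plus_option cvec_def)
  have shu: "smooth_on U (\<lambda>x. h 1 1 (u x) $ r)" for r
    by (rule smooth_on_nth[OF U smooth_on_linear[OF U lh su]])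
  show "smooth_on U Y" by (rule smooth_on_vecI[OF U]) (use shu[of "Inl _"] in \<open>simp add: hu\<close>)
  show "smooth_on U Z" by (rule smooth_on_vecI[OF U]) (use shu[of "Inr _"] in \<open>simp add: hu\<close>)
  fix x i assume x: "x \<in> U"
  \<comment> \<open>The contribution of F and b to the pairing, which does not involve the
    parameter. The section yields the coefficient - s (W - s \<alpha>) of \<epsilon>_i, whereas the
    pairing at \<mu> is \<mu>^2 \<alpha> + s W; the discrepancy is exactly (\<mu>^2 + s^2)
    \<alpha>.\<close>
  define W where "W = (\<Sum>k\<in>UNIV. F x $ i $ k * Z x $ Some k) + b x $ i * Z x $ None"
  define \<alpha> where "\<alpha> = column i (A x) \<bullet> Y x"
  have \<alpha>: "(\<Sum>p\<in>UNIV. A x $ p $ i * Y x $ p) = \<alpha>"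
    by (simp add: \<alpha>_def column_def inner_vec_def)
  have "dotp (lax_vec (A x) (F x) (b x) lam i) (u x) =
      lam * of_real (\<Sum>p\<in>UNIV. A x $ p $ i * Y x $ p) + \<i> * of_real W"
    by (simp add: dotp_def sum_UNIV_Plus_option u_def cvec_def W_def sum_distrib_left algebra_simps)
  then have wu: "dotp (lax_vec (A x) (F x) (b x) lam i) (u x) = \<i> * of_real (W - s * \<alpha>)"
    unfolding \<alpha> by (simp add: lam_def algebra_simps)
  have "lax_vec (A x) (F x) (b x) \<mu> i \<bullet> join_vec (\<mu> *\<^sub>R Y x) (s *\<^sub>R Z x) =
      \<mu> * \<mu> * (\<Sum>p\<in>UNIV. A x $ p $ i * Y x $ p) + s * W"
    by (simp add: inner_vec_def sum_UNIV_Plus_option W_def sum_distrib_left algebra_simps)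
  then have wv: "lax_vec (A x) (F x) (b x) \<mu> i \<bullet> join_vec (\<mu> *\<^sub>R Y x) (s *\<^sub>R Z x) = \<mu>\<^sup>2 * \<alpha> + s * W"
    by (simp add: \<alpha> power2_eq_square)
  have dv: "pdv (\<lambda>x. join_vec (\<mu> *\<^sub>R Y x) (s *\<^sub>R Z x)) i x = h \<mu> s (pdv u i x)"
    unfolding hu[symmetric] by (rule pdv_linear[OF lh smooth_on_differentiable[OF su x]])
  show "pdv (\<lambda>x. join_vec (\<mu> *\<^sub>R Y x) (s *\<^sub>R Z x)) i x =
      (let v = join_vec (\<mu> *\<^sub>R Y x) (s *\<^sub>R Z x); w = lax_vec (A x) (F x) (b x) \<mu> i in
       (v \<bullet> tangent_axis i) *\<^sub>R w - (w \<bullet> v) *\<^sub>R tangent_axis i +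
       ((\<mu>\<^sup>2 + s\<^sup>2) * (column i (A x) \<bullet> Y x)) *\<^sub>R tangent_axis i)"
    unfolding dv du[OF x] wu Let_def wv inner_axis \<alpha>_def[symmetric]
    by (simp add: h_def vec_eq_iff all_Plus_option u_def cvec_def lam_def axis_def power2_eq_square
        algebra_simps)
qed

text \<open>Absorbing the gauge matrix A into Y = A Wt expresses the whole action through
  \<open>EI\<close> and \<open>A1\<close>. The normalizations of Wt and Zt merge into the single
  denominator V \<bullet> V because both vectors have the same length.\<close>

lemma simple_element_action_real:
  fixes EI EI' :: "real ^ 'n::finite \<Rightarrow> complex \<Rightarrow> complex ^ ('m::finite + 'n option) ^ ('m + 'n option)"
  assumes act: "simple_element_action U \<iota> s W Z A1 F b EI A1' F' b' EI'"
    and fr: "frame_G_I U A1 F b EI" and WZ: "norm W = 1" "norm Z = 1"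
  obtains Y V where
    "\<And>x. x \<in> U \<Longrightarrow> EI x (- \<i> * of_real s) *v join_vec (cvec (Y x)) (\<i> *s cvec (V x)) =
      join_vec (cvec W) (\<i> *s cvec Z)"
    "\<And>x. x \<in> U \<Longrightarrow> V x \<noteq> 0" "\<And>x. x \<in> U \<Longrightarrow> Y x \<bullet> Y x = V x \<bullet> V x"
    "\<And>x i k. x \<in> U \<Longrightarrow> F' x $ i $ k = (if i = k then 0
      else F x $ i $ k - 2 * (column i (A1 x) \<bullet> Y x) / (V x \<bullet> V x) * (s * V x $ Some k))"
    "\<And>x i. x \<in> U \<Longrightarrow> b' x $ i =
      b x $ i - 2 * (column i (A1 x) \<bullet> Y x) / (V x \<bullet> V x) * (s * V x $ None)"
    "\<And>x i. x \<in> U \<Longrightarrow> column i (A1' x) =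
      column i (A1 x) - (2 * (column i (A1 x) \<bullet> Y x) / (V x \<bullet> V x)) *\<^sub>R Y x"
    "\<And>x \<mu>. x \<in> U \<Longrightarrow> \<mu>\<^sup>2 + s\<^sup>2 \<noteq> 0 \<Longrightarrow> EI' x (of_real \<mu>) =
      EI x (of_real \<mu>) ** cmat (reflection (join_vec (\<mu> *\<^sub>R Y x) (s *\<^sub>R V x)))"
proof -
  obtain A G E Wt Zt Wh Zh where fG: "frame_G U \<iota> F G b E" and
    rel: "\<forall>x\<in>U. orthogonal_matrix (A x) \<and>
           (\<forall>i. column (\<iota> i) (A x) = column i (A1 x)) \<and>
           (\<forall>lam. E x lam = EI x lam ** cmat (diag_block (A x))) \<and>
           join_vec (cvec (Wt x)) (\<i> *s cvec (Zt x)) =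
             matrix_inv (E x (- \<i> * of_real s)) *v join_vec (cvec W) (\<i> *s cvec Z) \<and>
           Wh x = Wt x /\<^sub>R norm (Wt x) \<and>
           Zh x = Zt x /\<^sub>R norm (Zt x) \<and>
           (\<forall>i k. F' x $ i $ k =
              (if i = k then 0 else F x $ i $ k - 2 * s * Wh x $ \<iota> i * Zh x $ Some k)) \<and>
           (\<forall>i. b' x $ i = b x $ i - 2 * s * Wh x $ \<iota> i * Zh x $ None) \<and>
           (\<forall>i. column i (A1' x) =
              column (\<iota> i) (A x ** (mat 1 - 2 *\<^sub>R outer (Wh x) (Wh x)))) \<and>
           (\<forall>lam. lam\<^sup>2 + (of_real s)\<^sup>2 \<noteq> 0 \<longrightarrow>
              (let N = join_vec (lam *s cvec (A x *v Wh x)) (of_real s *s cvec (Zh x)) in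
               EI' x lam =
                 EI x lam ** (mat 1 - map_matrix (\<lambda>z. 2 / (lam\<^sup>2 + (of_real s)\<^sup>2) * z) (outer N N))))"
    using act unfolding simple_element_action_def by blast
  define Y where "Y x = A x *v Wt x" for x
  let ?lam = "- \<i> * complex_of_real s" and ?w0 = "join_vec (cvec W) (\<i> *s cvec Z)"
  have EY: "EI x ?lam *v join_vec (cvec (Y x)) (\<i> *s cvec (Zt x)) = ?w0" if x: "x \<in> U" for x
  proof -
    have inv: "invertible (E x ?lam)" using fG x by (simp add: frame_G_def lax_frame_def)
    have "E x ?lam *v join_vec (cvec (Wt x)) (\<i> *s cvec (Zt x)) =
        (E x ?lam ** matrix_inv (E x ?lam)) *v ?w0"
      using bspec[OF rel x] by (simp add: matrix_vector_mul_assoc)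
    then have "E x ?lam *v join_vec (cvec (Wt x)) (\<i> *s cvec (Zt x)) = ?w0"
      unfolding matrix_inv_mult(1)[OF inv] by simp
    moreover have "E x ?lam = EI x ?lam ** cmat (diag_block (A x))" using bspec[OF rel x] by blast
    moreover have "cmat (diag_block (A x)) *v join_vec (cvec (Wt x)) (\<i> *s cvec (Zt x)) =
        join_vec (cvec (Y x)) (\<i> *s cvec (Zt x))"
      by (simp add: vec_eq_iff all_Plus_option matrix_vector_mult_def sum_UNIV_Plus map_matrix_def
          diag_block_def cvec_def Y_def mult_delta_left
          if_distrib[where f = complex_of_real] cong: if_cong)
    ultimately show ?thesis by (simp flip: matrix_vector_mul_assoc)
  qed
  \<comment> \<open>The frame preserves the bilinear form, and (W, iZ) is isotropic because W and Z
    are unit vectors.\<close>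
  have YY: "Y x \<bullet> Y x = Zt x \<bullet> Zt x" if x: "x \<in> U" for x
  proof -
    let ?u = "join_vec (cvec (Y x)) (\<i> *s cvec (Zt x))"
    have "dotp ?u ?u = dotp (EI x ?lam *v ?u) (EI x ?lam *v ?u)"
      unfolding dotp_transpose[of "EI x ?lam"]
      by (simp add: matrix_vector_mul_assoc frame_transpose(2)[OF fr x])
    also have "\<dots> = of_real (W \<bullet> W - Z \<bullet> Z)"
      unfolding EY[OF x] by (simp add: dotp_join_vec dotp_cvec dotp_cvec_i)
    also have "W \<bullet> W - Z \<bullet> Z = 0" using WZ by (simp add: norm_eq_1)
    finally have "complex_of_real (Y x \<bullet> Y x - Zt x \<bullet> Zt x) = of_real 0"
      by (simp add: dotp_join_vec dotp_cvec dotp_cvec_i)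
    then show ?thesis by (simp only: of_real_eq_iff)
  qed
  \<comment> \<open>By equality of lengths Y would vanish as well, and \<open>EI\<close> would send
    0 to the nonzero vector (W, iZ).\<close>
  have nz: "Zt x \<noteq> 0" if x: "x \<in> U" for x
  proof
    assume "Zt x = 0"
    then have "Y x = 0" using YY[OF x] by simp
    then have "?w0 = 0" using EY[OF x] \<open>Zt x = 0\<close>
      by (simp add: vec_eq_iff all_Plus_option matrix_vector_mult_def sum_UNIV_Plus_option cvec_def)
    then have "W = 0" by (simp add: vec_eq_iff all_Plus_option cvec_def)
    then show False using WZ by simp
  qed
  show ?thesis
  proof (rule that[of Y Zt])
    fix x assume x: "x \<in> U"
    define r where "r = norm (Zt x)"
    have r: "r \<noteq> 0" "Zt x \<bullet> Zt x = r * r"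
      using nz[OF x] by (auto simp: r_def dot_square_norm power2_eq_square)
    have orth: "transpose (A x) ** A x = mat 1" using rel x by (simp add: orthogonal_matrix_def)
    have "Y x \<bullet> Y x = Wt x \<bullet> Wt x"
      unfolding dotp_real[symmetric] Y_def dotp_transpose by (simp only: matrix_vector_mul_assoc orth matrix_vector_mul_lid)
    then have nW: "norm (Wt x) = r" by (simp add: r_def norm_eq_sqrt_inner YY[OF x])
    have Wh: "Wh x = Wt x /\<^sub>R r" and Zh: "Zh x = Zt x /\<^sub>R r" using rel x nW by (auto simp: r_def)
    have AWh: "A x *v Wh x = Y x /\<^sub>R r" by (simp add: Wh Y_def matrix_vector_mult_scaleR)
    have Wti: "Wt x $ \<iota> i = column i (A1 x) \<bullet> Y x" for i
    proof -
      have "Wt x = transpose (A x) *v Y x"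
        unfolding Y_def by (simp only: matrix_vector_mul_assoc orth matrix_vector_mul_lid)
      then have "Wt x $ \<iota> i = column (\<iota> i) (A x) \<bullet> Y x"
        by (simp only: matrix_vector_mult_def transpose_def column_def inner_vec_def vec_lambda_beta inner_real_def)
      then show ?thesis using rel x by simp
    qed
    show "F' x $ i $ k = (if i = k then 0
      else F x $ i $ k - 2 * (column i (A1 x) \<bullet> Y x) / (Zt x \<bullet> Zt x) * (s * Zt x $ Some k))" for i k
      using bspec[OF rel x] r by (simp add: Wh Zh Wti field_simps)
    show "b' x $ i = b x $ i - 2 * (column i (A1 x) \<bullet> Y x) / (Zt x \<bullet> Zt x) * (s * Zt x $ None)" for i
      using bspec[OF rel x] r by (simp add: Wh Zh Wti field_simps)
    show "column i (A1' x) =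
      column i (A1 x) - (2 * (column i (A1 x) \<bullet> Y x) / (Zt x \<bullet> Zt x)) *\<^sub>R Y x" for i
    proof -
      have "column (\<iota> i) (mat 1 - 2 *\<^sub>R outer (Wh x) (Wh x)) = axis (\<iota> i) 1 - (2 * Wh x $ \<iota> i) *\<^sub>R Wh x"
        by (auto simp: column_def mat_def outer_def axis_def vec_eq_iff)
      then have "column i (A1' x) = column (\<iota> i) (A x) - (2 * Wh x $ \<iota> i) *\<^sub>R (A x *v Wh x)"
        using bspec[OF rel x]
        by (simp add: column_mult matrix_vector_mult_diff_distrib matrix_vector_mult_scaleR
            matrix_vector_mult_basis)
      also have "column (\<iota> i) (A x) = column i (A1 x)" using rel x by simp
      finally show ?thesis unfolding AWh using r by (simp add: Wh Wti field_simps)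
    qed
    show "EI' x (of_real \<mu>) =
      EI x (of_real \<mu>) ** cmat (reflection (join_vec (\<mu> *\<^sub>R Y x) (s *\<^sub>R Zt x)))"
      if \<sigma>: "\<mu>\<^sup>2 + s\<^sup>2 \<noteq> 0" for \<mu>
    proof -
      let ?v = "join_vec (\<mu> *\<^sub>R Y x) (s *\<^sub>R Zt x)"
      let ?N = "join_vec (of_real \<mu> *s cvec (A x *v Wh x)) (of_real s *s cvec (Zh x))"
      have vv: "?v \<bullet> ?v = (\<mu>\<^sup>2 + s\<^sup>2) * (r * r)"
        unfolding dotp_real[symmetric] dotp_join_vec
        by (simp add: dotp_real YY[OF x] r(2) power2_eq_square algebra_simps)
      \<comment> \<open>N is the real vector v divided by r, and v \<bullet> v carries the factor
        r^2; hence 2 / (lam^2 + s^2) is exactly the normalization of a reflection.\<close>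
      have "?N $ q = of_real (?v $ q / r)" for q
        by (cases q) (simp_all add: AWh Zh cvec_def field_simps)
      then have "mat 1 - map_matrix (\<lambda>z. 2 / ((of_real \<mu>)\<^sup>2 + (of_real s)\<^sup>2) * z) (outer ?N ?N) =
          cmat (reflection ?v)"
        using \<sigma> r(1)
        by (simp add: vec_eq_iff map_matrix_def outer_def reflection_def vv mat_def flip: of_real_power of_real_add)
      moreover have "(of_real \<mu>)\<^sup>2 + (of_real s)\<^sup>2 \<noteq> (0 :: complex)"
        using \<sigma> by (simp flip: of_real_power of_real_add)
      ultimately show ?thesis using bspec[OF rel x] by (simp add: Let_def)
    qed
  qed (use EY nz YY in auto)
qed

section \<open>The action of \<open>g\<^sub>s\<^sub>,\<^sub>\<pi>\<close> on submanifolds\<close>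

lemma adapted_frame_cong:
  assumes M: "adapted_frame U X e t A F b"
    and eq: "\<And>x. x \<in> U \<Longrightarrow> X x = X' x" "\<And>x j. x \<in> U \<Longrightarrow> e j x = e' j x"
      "\<And>x i. x \<in> U \<Longrightarrow> t i x = t' i x"
  shows "adapted_frame U X' e' t' A F b"
proof -
  interpret adapted_frame U X e t A F b by (rule M)
  have d: "pdv X' i x = pdv X i x" "pdv (e' j) i x = pdv (e j) i x" "pdv (t' k) i x = pdv (t k) i x"
    if "x \<in> U" for x i j k
    using eq that by (auto intro!: pdv_cong[OF open_U])
  show ?thesis
  proof
    show "smooth_on U X'" by (rule smooth_on_cong[OF open_U smooth_X eq(1)])
    show "smooth_on U (e' j)" for j by (rule smooth_on_cong[OF open_U smooth_e eq(2)])
    show "smooth_on U (t' i)" for i by (rule smooth_on_cong[OF open_U smooth_t eq(3)])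
    show "v = (\<Sum>j\<in>UNIV. (v \<bullet> e' j x) *\<^sub>R e' j x) + (\<Sum>i\<in>UNIV. (v \<bullet> t' i x) *\<^sub>R t' i x) +
        (v \<bullet> X' x) *\<^sub>R X' x" if "x \<in> U" for x v
      using expansion[OF that, of v] by (simp add: eq[OF that])
  qed (use open_U smooth_b b_nz ortho_A ip dX de dt in \<open>simp_all add: d flip: eq cong: if_cong\<close>)
qed

lemma column_column_matrix:
  "column (Inl j) (column_matrix e t X) = e j"
  "column (Inr (Some i)) (column_matrix e t X) = t i"
  "column (Inr None) (column_matrix e t X) = X"
  by (simp_all add: column_def column_matrix_def vec_eq_iff)

lemma column_matrix_columns:
  "column_matrix (\<lambda>j. column (Inl j) M) (\<lambda>i. column (Inr (Some i)) M) (column (Inr None) M) = M"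
  by (simp add: column_def column_matrix_def vec_eq_iff all_Plus_option)

lemma sphere_immersion_pdv_nonzero:
  assumes "sphere_immersion U X" "x \<in> U"
  shows "pdv X i x \<noteq> 0"
proof
  assume "pdv X i x = 0"
  moreover have "X differentiable (at x)"
    using assms smooth_on_differentiable by (auto simp: sphere_immersion_def)
  then have "frechet_derivative X (at x) 0 = 0"
    by (rule linear_0[OF linear_frechet_derivative])
  moreover have inj: "inj (frechet_derivative X (at x))"
    using assms by (simp add: sphere_immersion_def)
  ultimately have "axis i (1 :: real) = 0" by (intro injD[OF inj]) (simp add: pdv_def)
  then show False by (simp add: axis_eq_0_iff)
qed

theorem theorem10p5:
  fixes U :: "(real ^ 'n::finite) set"
    and \<iota> :: "'n \<Rightarrow> 'm::finite"
    and X :: "real ^ 'n \<Rightarrow> real ^ ('m + 'n option)"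
    and e :: "'m \<Rightarrow> real ^ 'n \<Rightarrow> real ^ ('m + 'n option)"
    and A1 A1' :: "real ^ 'n \<Rightarrow> real ^ 'n ^ 'm"
    and F F' :: "real ^ 'n \<Rightarrow> real ^ 'n ^ 'n"
    and b b' :: "real ^ 'n \<Rightarrow> real ^ 'n"
    and EI EI' :: "real ^ 'n \<Rightarrow> complex \<Rightarrow> complex ^ ('m + 'n option) ^ ('m + 'n option)"
    and s :: real and W :: "real ^ 'm" and Z :: "real ^ 'n option"
  assumes "inj \<iota>"
    and "local_isometric_immersion_of_sphere U X"
    and "flat_normal_bundle U X"
    and "nondegenerate_normal_bundle U X"
    and "line_of_curvature_coordinates U X"
    and "parallel_normal_frame U X e"
    and "corresponding_solution U X e A1 F b"
    and "frame_G_I U A1 F b EI"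
    and "\<forall>x\<in>U. EI x 1 =
           cmat (column_matrix (\<lambda>j. e j x) (\<lambda>i. pdv X i x /\<^sub>R (b x $ i)) (X x))"
    and "s \<noteq> 0" and "norm W = 1" and "norm Z = 1"
    and "simple_element_action U \<iota> s W Z A1 F b EI A1' F' b' EI'"
  shows "\<exists>et tt Xt.
    (\<forall>x\<in>U. EI' x 1 = cmat (column_matrix (\<lambda>j. et j x) (\<lambda>i. tt i x) (Xt x))) \<and>
    (let U' = {x \<in> U. \<forall>i. b' x $ i \<noteq> 0} in
       (local_isometric_immersion_of_sphere U' Xt \<and>
        flat_normal_bundle U' Xt \<and>
        nondegenerate_normal_bundle U' Xt \<and>
        line_of_curvature_coordinates U' Xt \<and>
        parallel_normal_frame U' Xt et) \<and>
       corresponding_solution U' Xt et A1' F' b' \<and>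
       (\<forall>P. (\<forall>x\<in>U'. linear_on_subspace (normal_fibre X x) (P x) \<and> (\<forall>j. P x (e j x) = et j x))
            \<longrightarrow> ribaucour_transformation U' X U' Xt id P))"
proof -
  note fr = assms(8)
  have imm: "sphere_immersion U X" using assms(2) by (simp add: local_isometric_immersion_of_sphere_def)
  then have U: "open U" by (simp add: sphere_immersion_def)
  have ff: "first_ff X x $ i $ i = (b x $ i)\<^sup>2" if "x \<in> U" for x i
    using assms(7) that by (auto simp: corresponding_solution_def)
  have sA: "smooth_on U A1" and sF: "smooth_on U F" and sb: "smooth_on U b"
    and A: "\<And>x. x \<in> U \<Longrightarrow> transpose (A1 x) ** A1 x = mat 1" and F0: "\<And>x i. x \<in> U \<Longrightarrow> F x $ i $ i = 0"
    using assms(7) by (auto simp: corresponding_solution_def partial_G_I_solution_def)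
  \<comment> \<open>b_i^2 is the squared length of the i-th coordinate derivative, which is nonzero
    for an immersion.\<close>
  have b_nz: "b x $ i \<noteq> 0" if "x \<in> U" for x i
    using ff[OF that, of i] sphere_immersion_pdv_nonzero[OF imm that, of i] by (auto simp: first_ff_def)
  obtain Y V where
    EYV: "\<And>x. x \<in> U \<Longrightarrow> EI x (- \<i> * of_real s) *v join_vec (cvec (Y x)) (\<i> *s cvec (V x)) =
      join_vec (cvec W) (\<i> *s cvec Z)"
    and V_nz: "\<And>x. x \<in> U \<Longrightarrow> V x \<noteq> 0" and YV: "\<And>x. x \<in> U \<Longrightarrow> Y x \<bullet> Y x = V x \<bullet> V x"
    and F': "\<And>x i k. x \<in> U \<Longrightarrow> F' x $ i $ k = (if i = k then 0
      else F x $ i $ k - 2 * (column i (A1 x) \<bullet> Y x) / (V x \<bullet> V x) * (s * V x $ Some k))"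
    and b': "\<And>x i. x \<in> U \<Longrightarrow> b' x $ i =
      b x $ i - 2 * (column i (A1 x) \<bullet> Y x) / (V x \<bullet> V x) * (s * V x $ None)"
    and A': "\<And>x i. x \<in> U \<Longrightarrow> column i (A1' x) =
      column i (A1 x) - (2 * (column i (A1 x) \<bullet> Y x) / (V x \<bullet> V x)) *\<^sub>R Y x"
    and EI': "\<And>x \<mu>. x \<in> U \<Longrightarrow> \<mu>\<^sup>2 + s\<^sup>2 \<noteq> 0 \<Longrightarrow> EI' x (of_real \<mu>) =
      EI x (of_real \<mu>) ** cmat (reflection (join_vec (\<mu> *\<^sub>R Y x) (s *\<^sub>R V x)))"
    using simple_element_action_real[OF assms(13) fr assms(11,12)] by blast
  note sY = dressing_vector(1)[OF U fr EYV] and sV = dressing_vector(2)[OF U fr EYV]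
  have \<rho>: "V x \<bullet> V x \<noteq> 0" if "x \<in> U" for x using V_nz[OF that] by simp
  have \<sigma>: "\<mu>\<^sup>2 + s\<^sup>2 \<noteq> 0" for \<mu>
    using assms(10) by (simp add: sum_power2_eq_zero_iff)
  define v where "v \<mu> x = join_vec (\<mu> *\<^sub>R Y x) (s *\<^sub>R V x)" for \<mu> x
  have vv: "v \<mu> x \<bullet> v \<mu> x = (\<mu>\<^sup>2 + s\<^sup>2) * (V x \<bullet> V x)" if "x \<in> U" for \<mu> x
    unfolding dotp_real[symmetric] v_def dotp_join_vec
    by (simp add: dotp_real YV[OF that] power2_eq_square algebra_simps)
  have vv_nz: "v \<mu> x \<bullet> v \<mu> x \<noteq> 0" if "x \<in> U" for \<mu> x using vv[OF that] \<rho>[OF that] \<sigma> by simp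
  have sv: "smooth_on U (v \<mu>)" for \<mu>
  proof -
    have "\<forall>r. smooth_on U (\<lambda>x. v \<mu> x $ r)"
      unfolding all_Plus_option using U sY sV
      by (auto simp: v_def intro!: smooth_on_mult smooth_on_const smooth_on_nth)
    then show ?thesis by (intro smooth_on_vecI[OF U]) simp
  qed
  define g where "g \<mu> x = real_frame EI \<mu> x ** reflection (v \<mu> x)" for \<mu> x
  have sg: "smooth_on U (g \<mu>)" for \<mu>
    unfolding g_def
    by (rule smooth_on_bilinear[OF U bounded_bilinear_matrix_mult smooth_on_real_frame[OF U fr]
          smooth_on_reflection[OF U sv vv_nz]])
  have og: "orthogonal_matrix (g \<mu> x)" if "x \<in> U" for \<mu> x
    unfolding g_def
    by (rule orthogonal_matrix_mul[OF orthogonal_real_frame[OF U fr that] orthogonal_matrix_reflection])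
  have dg: "pdv (g \<mu>) i x = g \<mu> x ** wedge (tangent_axis i) (lax_vec (A1' x) (F' x) (b' x) \<mu> i)"
    if x: "x \<in> U" for \<mu> i x
  proof -
    let ?w = "lax_vec (A1 x) (F x) (b x) \<mu> i" and ?\<alpha> = "column i (A1 x) \<bullet> Y x"
    have dv: "pdv (v \<mu>) i x = (v \<mu> x \<bullet> tangent_axis i) *\<^sub>R ?w - (?w \<bullet> v \<mu> x) *\<^sub>R tangent_axis i +
        ((\<mu>\<^sup>2 + s\<^sup>2) * ?\<alpha>) *\<^sub>R tangent_axis i"
      unfolding v_def[abs_def] using dressing_vector(3)[OF U fr EYV x, of \<mu> i] by (simp only: Let_def)
    have "pdv (g \<mu>) i x =
        g \<mu> x ** wedge (tangent_axis i) (?w - (2 * ?\<alpha> / (V x \<bullet> V x)) *\<^sub>R v \<mu> x)"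
      unfolding g_def
      by (rule pdv_reflected_frame[OF U x smooth_on_real_frame[OF U fr] sv vv_nz
            pdv_real_frame[OF U fr x] dv vv[OF x]])
    \<comment> \<open>The reflection also alters the \<epsilon>_i component of w, which the wedge
      discards. This is why F'_ii may be reset to 0.\<close>
    also have "wedge (tangent_axis i) (?w - (2 * ?\<alpha> / (V x \<bullet> V x)) *\<^sub>R v \<mu> x) =
        wedge (tangent_axis i) (lax_vec (A1' x) (F' x) (b' x) \<mu> i)"
    proof -
      have "A1' x $ p $ i = A1 x $ p $ i - 2 * ?\<alpha> / (V x \<bullet> V x) * Y x $ p" for p
        using arg_cong[OF A'[OF x, of i], of "\<lambda>u. u $ p"] by (simp add: column_def)
      then show ?thesis
        by (simp add: vec_eq_iff all_Plus_option wedge_def outer_def axis_def v_def F'[OF x] b'[OF x]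
            F0[OF x] right_diff_distrib)
    qed
    finally show ?thesis .
  qed
  have AY: "smooth_on U (\<lambda>x. column i (A1 x) \<bullet> Y x)" for i
    by (rule smooth_on_inner[OF U smooth_on_linear[OF U bounded_linear_column sA] sY])
  note sm = smooth_on_diff smooth_on_mult smooth_on_divide smooth_on_const smooth_on_inner
    smooth_on_nth AY sV sY sA sF sb U \<rho>
  have sA': "smooth_on U A1'"
  proof (intro smooth_on_vecI[OF U])
    fix p i
    have "smooth_on U (\<lambda>x. A1 x $ p $ i - 2 * (column i (A1 x) \<bullet> Y x) / (V x \<bullet> V x) * Y x $ p)"
      by (intro sm)
    moreover have "A1 x $ p $ i - 2 * (column i (A1 x) \<bullet> Y x) / (V x \<bullet> V x) * Y x $ p = A1' x $ p $ i"
      if "x \<in> U" for x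
      using arg_cong[OF A'[OF that, of i], of "\<lambda>u. u $ p"] by (simp add: column_def)
    ultimately show "smooth_on U (\<lambda>x. A1' x $ p $ i)" by (rule smooth_on_cong[OF U])
  qed
  have sF': "smooth_on U F'"
  proof (intro smooth_on_vecI[OF U])
    fix i k
    have "smooth_on U (\<lambda>x. if i = k then 0
      else F x $ i $ k - 2 * (column i (A1 x) \<bullet> Y x) / (V x \<bullet> V x) * (s * V x $ Some k))"
      by (cases "i = k"; simp only: if_True if_False simp_thms; intro sm)
    then show "smooth_on U (\<lambda>x. F' x $ i $ k)" by (rule smooth_on_cong[OF U]) (simp add: F')
  qed
  have sb': "smooth_on U b'"
  proof (intro smooth_on_vecI[OF U])
    fix i
    have "smooth_on U (\<lambda>x. b x $ i - 2 * (column i (A1 x) \<bullet> Y x) / (V x \<bullet> V x) * (s * V x $ None))"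
      by (intro sm)
    then show "smooth_on U (\<lambda>x. b' x $ i)" by (rule smooth_on_cong[OF U]) (simp add: b')
  qed
  have ortho_A': "transpose (A1' x) ** A1' x = mat 1" if x: "x \<in> U" for x
  proof -
    have entry: "(transpose M ** M) $ i $ k = column i M \<bullet> column k M" for M :: "real ^ 'n ^ 'm" and i k
      by (simp add: matrix_matrix_mult_def transpose_def column_def inner_vec_def)
    \<comment> \<open>The new columns are the old ones reflected in Y: the denominator V \<bullet> V
      equals Y \<bullet> Y.\<close>
    have "column i (A1' x) \<bullet> column k (A1' x) = column i (A1 x) \<bullet> column k (A1 x)" for i k
      using \<rho>[OF x] unfolding A'[OF x]
      by (simp add: inner_diff_left inner_diff_right YV[OF x] inner_commute[of "Y x" "column _ _"]
          field_simps)
    then have "transpose (A1' x) ** A1' x = transpose (A1 x) ** A1 x"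
      by (simp add: vec_eq_iff entry)
    then show ?thesis using A[OF x] by simp
  qed
  have flat: "flat_connection U (\<lambda>x. lax_G_I (A1' x) (F' x) (b' x) lam)" for lam
  proof (rule flat_connection_lax_G_I[OF U sA' sF' sb'])
    fix \<mu> :: real and i k x assume x: "x \<in> U"
    let ?L = "\<lambda>i x. wedge (tangent_axis i) (lax_vec (A1' x) (F' x) (b' x) \<mu> i)"
    show "pdv (?L k) i x - pdv (?L i) k x + (?L i x ** ?L k x - ?L k x ** ?L i x) = 0"
      by (rule frame_curvature_zero[OF U x sg, where E' = "transpose (g \<mu> x)"])
        (use og[OF x] in \<open>auto simp: dg orthogonal_matrix_def
          intro!: smooth_on_wedge[OF U smooth_on_lax_vec[OF U sA' sF' sb']]\<close>)
  qed
  \<comment> \<open>The coordinate derivatives of the new map are b'_i times unit vectors, so it is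
    an immersion exactly where no b'_i vanishes.\<close>
  define U' where "U' = {x \<in> U. \<forall>i. b' x $ i \<noteq> 0}"
  have sub: "U' \<subseteq> U" by (auto simp: U'_def)
  have U': "open U'"
  proof -
    have "open ((\<lambda>x. b' x $ i) -` (- {0}) \<inter> U)" for i
      using smooth_on_continuous[OF smooth_on_nth[OF U sb']] U
      by (simp add: continuous_on_open_vimage open_Compl)
    then have "open (U \<inter> (\<Inter>i. (\<lambda>x. b' x $ i) -` (- {0}) \<inter> U))" using U by (intro open_Int open_INT) auto
    moreover have "U \<inter> (\<Inter>i. (\<lambda>x. b' x $ i) -` (- {0}) \<inter> U) = U'" by (auto simp: U'_def)
    ultimately show ?thesis by simp
  qed
  have sol': "partial_G_I_solution U' A1' F' b'"
    using smooth_on_subset[OF sA' sub] smooth_on_subset[OF sF' sub] smooth_on_subset[OF sb' sub]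
      ortho_A' F' sub flat
    by (auto simp: partial_G_I_solution_def flat_connection_def subset_iff)
  define Xt where "Xt x = column (Inr None) (g 1 x)" for x
  define et where "et j x = column (Inl j) (g 1 x)" for j x
  define tt where "tt i x = column (Inr (Some i)) (g 1 x)" for i x
  have M': "adapted_frame U' Xt et tt A1' F' b'"
    unfolding Xt_def[abs_def] et_def[abs_def] tt_def[abs_def]
    using sub U' smooth_on_subset[OF sg sub] smooth_on_subset[OF sb' sub] ortho_A' F' og dg
    by (intro adapted_frame_of_matrix) (auto simp: U'_def)
  have cols: "real_frame EI 1 x = column_matrix (\<lambda>j. e j x) (\<lambda>i. pdv X i x /\<^sub>R (b x $ i)) (X x)"
    if "x \<in> U" for x
    using cmat_real_frame[OF U fr that, of 1] assms(9) that by (simp add: cmat_eq_iff)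
  \<comment> \<open>The structure equations of the given immersion are taken from the Lax equation
    at parameter 1 and then transferred to X and e, with which these columns agree on U.\<close>
  have "adapted_frame U' (\<lambda>x. column (Inr None) (real_frame EI 1 x))
      (\<lambda>j x. column (Inl j) (real_frame EI 1 x)) (\<lambda>i x. column (Inr (Some i)) (real_frame EI 1 x)) A1 F b"
    using sub U' smooth_on_subset[OF smooth_on_real_frame[OF U fr] sub] smooth_on_subset[OF sb sub]
      b_nz A F0 orthogonal_real_frame[OF U fr] pdv_real_frame[OF U fr]
    by (intro adapted_frame_of_matrix) auto
  then have M: "adapted_frame U' X e (\<lambda>i x. pdv X i x /\<^sub>R (b x $ i)) A1 F b"
    by (rule adapted_frame_cong) (use sub in \<open>auto simp: cols column_column_matrix subset_iff\<close>)
  interpret M': adapted_frame U' Xt et tt A1' F' b' by (rule M')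
  have "local_isometric_immersion_of_sphere U' Xt"
  proof (rule local_isometry_of_frame[OF M'.immersion smooth_on_subset[OF sg[of 0] sub]])
    fix x p and r :: "'n option" assume "x \<in> U'"
    then have "real_frame EI 0 x $ Inl p $ Inr q = 0" for q using real_frame_block[OF U fr] sub by blast
    \<comment> \<open>At \<mu> = 0 the reflection vector is (0, s V), so the reflection respects the
      block splitting of the frame.\<close>
    moreover have "reflection (v 0 x) $ Inl q $ Inr r = 0" for q
      by (simp add: reflection_def v_def outer_def mat_def)
    ultimately show "g 0 x $ Inl p $ Inr r = 0"
      by (simp add: g_def matrix_matrix_mult_def sum_UNIV_Plus)
  qed (use sub og dg M'.first_ff_eq in auto)
  moreover have "EI' x 1 = cmat (column_matrix (\<lambda>j. et j x) (\<lambda>i. tt i x) (Xt x))" if "x \<in> U" for x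
    using EI'[OF that \<sigma>, of 1] cmat_real_frame[OF U fr that, of 1]
    by (simp add: et_def tt_def Xt_def column_matrix_columns g_def v_def cmat_mult)
  moreover have "ribaucour_transformation U' X U' Xt id P"
    if P: "\<forall>x\<in>U'. linear_on_subspace (normal_fibre X x) (P x) \<and> (\<forall>j. P x (e j x) = et j x)" for P
  proof (rule reflected_frames_ribaucour[OF M M'])
    fix x assume "x \<in> U'"
    \<comment> \<open>Multiplying by a reflection on the right moves every column along the single
      vector \<open>real_frame EI 1 x *v v 1 x\<close>, the common \<xi>.\<close>
    then have "column c (g 1 x) = column c (column_matrix (\<lambda>j. e j x) (\<lambda>i. pdv X i x /\<^sub>R (b x $ i)) (X x)) -
        (2 / (v 1 x \<bullet> v 1 x) * v 1 x $ c) *\<^sub>R (real_frame EI 1 x *v v 1 x)" for c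
      using cols sub by (simp add: g_def column_mult_reflection subset_iff)
    then show "Xt x = X x - (2 / (v 1 x \<bullet> v 1 x) * v 1 x $ Inr None) *\<^sub>R (real_frame EI 1 x *v v 1 x)"
      "et j x = e j x - (2 / (v 1 x \<bullet> v 1 x) * v 1 x $ Inl j) *\<^sub>R (real_frame EI 1 x *v v 1 x)"
      "tt i x = pdv X i x /\<^sub>R (b x $ i) -
        (2 / (v 1 x \<bullet> v 1 x) * v 1 x $ Inr (Some i)) *\<^sub>R (real_frame EI 1 x *v v 1 x)" for i j
      by (simp_all add: Xt_def et_def tt_def column_column_matrix)
  qed (use P in auto)
  ultimately show ?thesis
    using M'.flat M'.nondegenerate M'.curvature_line M'.frame M'.corresponding[OF sol']
    unfolding Let_def U'_def[symmetric] by blast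
qed

end
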